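(* Let $F(z)=\sum_{n\ge1}|\mathbf{E}(\mathrm{Tam}_n)|z^n$. Then $F$ is algebraic of degree $4$: it satisfies $Q(F(z),z)=0$, where \[Q(y,z)=z+(-1+3z+z^2)y+(-2+2z+3z^2)y^2+3z^2y^3+z^2y^4.\] Consequently, $|\mathbf{E}(\mathrm{Tam}_n)|\sim\frac{\gamma}{\sqrt\pi}n^{-3/2}\rho^n$, where $\rho\approx2.90511$ is the unique positive real root of $32z^7-32z^6-155z^5-20z^4-148z^3+60z^2-8z-4$ and $\gamma\approx1.04240$ is a root of \[17348952064z^{14}-11927404544z^{12}-6678731520z^{10}-886278144z^8-33824320z^6-516144z^4+4048z^2+11.\]
   Context: $\mathrm{Tam}_n$ (the $n$-th Tamari lattice) is the set of $312$-avoiding permutations of $[n]$ (those with no $i_1<i_2<i_3$ with $w(i_2)<w(i_3)<w(i_1)$), which forms a sublattice of the right weak order on $S_n$ (where $u\le v$ iff every inversion of $u$ is an inversion of $v$). For a finite lattice $L$ and $x\in L$, an Ungar move sends $x$ to $\bigwedge(\{x\}\cup T)$ with $T$ a subset of the elements covered by $x$; it is nontrivial if $T\neq\emptyset$. Recursively, the bottom element $\hat0$ is an Eeta win in $L$, and $x$ is an Eeta win iff no element obtainable from $x$ by a nontrivial Ungar move is an Eeta win (equivalently, in the game on $[\hat0,x]$ starting at $x$ where Atniss then Eeta alternately make nontrivial Ungar moves and the player unable to move loses, Eeta has a winning strategy). $\mathbf{E}(L)$ is the set of Eeta wins in $L$. *)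

theory Defs
  imports
    Complex_Main
    "HOL-Algebra.Lattice"
    "HOL-Combinatorics.Permutations"
    "HOL-Computational_Algebra.Polynomial_FPS"
    "HOL-Library.Landau_Symbols"
begin

subsection \<open>The Ungar game on a finite lattice\<close>

definition lower_covers :: "('a, 'b) gorder_scheme \<Rightarrow> 'a \<Rightarrow> 'a set" where
  "lower_covers L x = {y \<in> carrier L. y \<sqsubset>\<^bsub>L\<^esub> x \<and> \<not> (\<exists>z\<in>carrier L. y \<sqsubset>\<^bsub>L\<^esub> z \<and> z \<sqsubset>\<^bsub>L\<^esub> x)}"

definition nontrivial_Ungar_moves :: "('a, 'b) gorder_scheme \<Rightarrow> 'a \<Rightarrow> 'a set" where
  "nontrivial_Ungar_moves L x =
     {\<Sqinter>\<^bsub>L\<^esub>({x} \<union> T) | T. T \<subseteq> lower_covers L x \<and> T \<noteq> {}}"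

locale finite_lattice = lattice L for L (structure) +
  assumes finite_carrier: "finite (carrier L)"
begin

lemma nontrivial_Ungar_moves_less:
  assumes "x \<in> carrier L" and "y \<in> nontrivial_Ungar_moves L x"
  shows "y \<in> carrier L" and "y \<sqsubset> x"
proof -
  obtain T t where T: "T \<subseteq> lower_covers L x" "t \<in> T" and y: "y = \<Sqinter>({x} \<union> T)"
    using assms(2) unfolding nontrivial_Ungar_moves_def by blast
  have sub: "{x} \<union> T \<subseteq> carrier L"
    using T assms(1) unfolding lower_covers_def by blast
  have "greatest L y (Lower L ({x} \<union> T))"
    unfolding y using sub finite_subset[OF sub finite_carrier]
    by (intro finite_inf_greatest) auto
  hence "y \<in> Lower L ({x} \<union> T)" unfolding greatest_def by blast
  hence yc: "y \<in> carrier L" and "y \<sqsubseteq> t"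
    using T sub unfolding Lower_def by auto
  moreover have "t \<in> carrier L" "t \<sqsubset> x"
    using T unfolding lower_covers_def by auto
  ultimately show "y \<in> carrier L" "y \<sqsubset> x"
    using assms(1) by (auto simp: lless_eq intro: le_trans dest: le_antisym)
qed

text \<open>The bottom element admits no nontrivial move, so it satisfies the recursive condition
  vacuously; the condition on the carrier is what makes the recursion terminate.\<close>

context notes conj_cong [fundef_cong]
begin

function Eeta_win :: "'a \<Rightarrow> bool" where
  "Eeta_win x \<longleftrightarrow> x \<in> carrier L \<and> (\<forall>y\<in>nontrivial_Ungar_moves L x. \<not> Eeta_win y)"
  by auto
termination
proof (relation "measure (\<lambda>x. card {z \<in> carrier L. z \<sqsubset> x})", goal_cases)
  case 1
  show ?case by simp
next
  case (2 x y)
  note y = nontrivial_Ungar_moves_less[OF 2]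
  have "{z \<in> carrier L. z \<sqsubset> y} \<subset> {z \<in> carrier L. z \<sqsubset> x}"
  proof
    show "{z \<in> carrier L. z \<sqsubset> y} \<subseteq> {z \<in> carrier L. z \<sqsubset> x}"
      using y 2(1) by (auto intro: lless_trans)
    show "{z \<in> carrier L. z \<sqsubset> y} \<noteq> {z \<in> carrier L. z \<sqsubset> x}"
      using y by (auto simp: lless_eq)
  qed
  thus ?case
    by (auto intro!: psubset_card_mono simp: finite_carrier)
qed

declare Eeta_win.simps [simp del]

end

definition Eeta_wins :: "'a set" where
  "Eeta_wins = {x \<in> carrier L. Eeta_win x}"

end

subsection \<open>Tamari lattices\<close>

text \<open>Inversions are pairs of values, so that containment of inversion sets is the
  right (rather than the left) weak order.\<close>

definition inversions :: "nat \<Rightarrow> (nat \<Rightarrow> nat) \<Rightarrow> (nat \<times> nat) set" where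
  "inversions n w = {(i, j). 1 \<le> i \<and> i < j \<and> j \<le> n \<and> inv w j < inv w i}"

definition right_weak_order :: "nat \<Rightarrow> (nat \<Rightarrow> nat) gorder" where
  "right_weak_order n =
     \<lparr>carrier = {w. w permutes {1..n}}, eq = (=), le = (\<lambda>u v. inversions n u \<subseteq> inversions n v)\<rparr>"

definition avoids_312 :: "nat \<Rightarrow> (nat \<Rightarrow> nat) \<Rightarrow> bool" where
  "avoids_312 n w \<longleftrightarrow>
     \<not> (\<exists>i\<^sub>1 i\<^sub>2 i\<^sub>3. 1 \<le> i\<^sub>1 \<and> i\<^sub>1 < i\<^sub>2 \<and> i\<^sub>2 < i\<^sub>3 \<and> i\<^sub>3 \<le> n \<and> w i\<^sub>2 < w i\<^sub>3 \<and> w i\<^sub>3 < w i\<^sub>1)"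

definition Tam :: "nat \<Rightarrow> (nat \<Rightarrow> nat) gorder" where
  "Tam n = (right_weak_order n)\<lparr>carrier := {w. w permutes {1..n} \<and> avoids_312 n w}\<rparr>"

lemma carrier_Tam: "carrier (Tam n) = {w. w permutes {1..n} \<and> avoids_312 n w}"
  and le_Tam: "u \<sqsubseteq>\<^bsub>Tam n\<^esub> v \<longleftrightarrow> inversions n u \<subseteq> inversions n v"
  and eq_Tam: "u .=\<^bsub>Tam n\<^esub> v \<longleftrightarrow> u = v"
  by (simp_all add: Tam_def right_weak_order_def)

lemma inversions_trans:
  "(a, b) \<in> inversions n w \<Longrightarrow> (b, c) \<in> inversions n w \<Longrightarrow> (a, c) \<in> inversions n w"
  by (auto simp: inversions_def)

lemma inversions_avoids_312:
  assumes w: "w permutes {1..n}" and av: "avoids_312 n w"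
    and ac: "(a, c) \<in> inversions n w" and ab: "a < b" and bc: "b < c"
  shows "(a, b) \<in> inversions n w"
proof (rule ccontr)
  assume "(a, b) \<notin> inversions n w"
  hence "\<not> inv w b < inv w a"
    using ac ab bc by (auto simp: inversions_def)
  moreover have "inv w a \<noteq> inv w b"
    using ab permutes_inverses(1)[OF w] by (metis less_irrefl)
  ultimately have 1: "inv w a < inv w b" by simp
  have 2: "inv w c < inv w a" and rng: "1 \<le> a" "c \<le> n"
    using ac by (auto simp: inversions_def)
  have "inv w c \<in> {1..n}" "inv w b \<in> {1..n}"
    using permutes_in_image[OF permutes_inv[OF w]] rng ab bc by auto
  moreover have "w (inv w a) = a" "w (inv w b) = b" "w (inv w c) = c"
    using permutes_inverses(1)[OF w] by auto
  ultimately show False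
    using av 1 2 ab bc unfolding avoids_312_def by (metis atLeastAtMost_iff)
qed

lemma inversions_inject:
  assumes u: "u permutes {1..n}" and v: "v permutes {1..n}"
    and eq: "inversions n u = inversions n v"
  shows "u = v"
proof -
  have pos: "inv w a = card {b \<in> {1..n}. inv w b \<le> inv w a}"
    if w: "w permutes {1..n}" and a: "a \<in> {1..n}" for w a
  proof -
    have iw: "inv w permutes {1..n}" using w by (rule permutes_inv)
    have "inv w ` {b \<in> {1..n}. inv w b \<le> inv w a} = {1..inv w a}"
    proof (intro equalityI subsetI)
      fix x assume "x \<in> inv w ` {b \<in> {1..n}. inv w b \<le> inv w a}"
      thus "x \<in> {1..inv w a}" using permutes_in_image[OF iw] by force
    next
      fix x assume x: "x \<in> {1..inv w a}"
      moreover have "inv w a \<in> {1..n}" using a permutes_in_image[OF iw] by blast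
      ultimately have "w x \<in> {1..n}" using permutes_in_image[OF w] by auto
      moreover have "inv w (w x) = x" using permutes_inverses(2)[OF w] .
      ultimately show "x \<in> inv w ` {b \<in> {1..n}. inv w b \<le> inv w a}"
        using x by (auto intro!: image_eqI[of x "inv w" "w x"])
    qed
    moreover have "inj_on (inv w) {b \<in> {1..n}. inv w b \<le> inv w a}"
      using permutes_inj[OF iw] by (rule inj_on_subset) simp
    ultimately show ?thesis by (metis card_image card_atLeastAtMost diff_Suc_1)
  qed
  have le_iff: "inv w b \<le> inv w a \<longleftrightarrow>
      a = b \<or> b < a \<and> (b, a) \<notin> inversions n w \<or> a < b \<and> (a, b) \<in> inversions n w"
    if w: "w permutes {1..n}" and "a \<in> {1..n}" "b \<in> {1..n}" for w a b
  proof -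
    have "inv w a = inv w b \<longleftrightarrow> a = b"
      using permutes_inj[OF permutes_inv[OF w]] by (auto dest: injD)
    thus ?thesis using that by (auto simp: inversions_def not_le not_less)
  qed
  have "inv u = inv v"
  proof
    fix a show "inv u a = inv v a"
    proof (cases "a \<in> {1..n}")
      case True
      have "{b \<in> {1..n}. inv u b \<le> inv u a} = {b \<in> {1..n}. inv v b \<le> inv v a}"
        using le_iff[OF u True] le_iff[OF v True] eq by blast
      thus ?thesis using pos[OF u True] pos[OF v True] by simp
    next
      case False
      thus ?thesis
        using permutes_not_in[OF permutes_inv[OF u]] permutes_not_in[OF permutes_inv[OF v]] by simp
    qed
  qed
  thus ?thesis using permutes_inv_inv[OF u] permutes_inv_inv[OF v] by metis
qed

lemma ex_Tam_inversions:
  assumes dom: "\<And>a b. (a, b) \<in> I \<Longrightarrow> 1 \<le> a \<and> a < b \<and> b \<le> n"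
    and tr: "\<And>a b c. (a, b) \<in> I \<Longrightarrow> (b, c) \<in> I \<Longrightarrow> (a, c) \<in> I"
    and dn: "\<And>a b c. (a, c) \<in> I \<Longrightarrow> a < b \<Longrightarrow> b < c \<Longrightarrow> (a, b) \<in> I"
  shows "\<exists>w. w permutes {1..n} \<and> avoids_312 n w \<and> inversions n w = I"
proof -
  define le where "le a b \<longleftrightarrow> a = b \<or> a < b \<and> (a, b) \<notin> I \<or> b < a \<and> (b, a) \<in> I" for a b
  have le_trans: "le a c" if "le a b" "le b c" for a b c
    using that tr dn dom unfolding le_def
    by (smt (verit, best) linorder_neqE_nat order.strict_trans)
  have le_antisym: "a = b" if "le a b" "le b a" for a b
    using that unfolding le_def by auto
  have le_total: "le a b \<or> le b a" for a b
    unfolding le_def by auto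
  define pos where "pos a = (if a \<in> {1..n} then card {b \<in> {1..n}. le b a} else a)" for a
  have pos_less: "pos a < pos b" if "le a b" "a \<noteq> b" "a \<in> {1..n}" "b \<in> {1..n}" for a b
  proof -
    have "{c \<in> {1..n}. le c a} \<subseteq> {c \<in> {1..n}. le c b}"
      using that le_trans by blast
    moreover have "b \<in> {c \<in> {1..n}. le c b}" "b \<notin> {c \<in> {1..n}. le c a}"
      using that le_antisym by (auto simp: le_def[of b b])
    ultimately have "{c \<in> {1..n}. le c a} \<subset> {c \<in> {1..n}. le c b}" by blast
    thus ?thesis using that by (auto simp: pos_def intro!: psubset_card_mono)
  qed
  have inj: "inj_on pos {1..n}"
    using pos_less le_total by (intro inj_onI) (metis less_irrefl)
  have "pos a \<in> {1..n}" if a: "a \<in> {1..n}" for a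
  proof -
    have "card {b \<in> {1..n}. le b a} \<le> card {1..n}" by (intro card_mono) auto
    moreover have "a \<in> {b \<in> {1..n}. le b a}" using a by (simp add: le_def)
    hence "0 < card {b \<in> {1..n}. le b a}" by (subst card_gt_0_iff) auto
    ultimately show ?thesis using a by (simp add: pos_def)
  qed
  hence "pos ` {1..n} = {1..n}" using inj by (intro endo_inj_surj) auto
  hence perm: "pos permutes {1..n}"
    using inj by (intro bij_imp_permutes) (auto simp: bij_betw_def pos_def)
  define w where "w = inv pos"
  have w: "w permutes {1..n}" unfolding w_def using perm by (rule permutes_inv)
  have iw: "inv w = pos" unfolding w_def using perm by (rule permutes_inv_inv)
  have I: "inversions n w = I"
  proof -
    have "pos j < pos i \<longleftrightarrow> (i, j) \<in> I" if "1 \<le> i" "i < j" "j \<le> n" for i j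
      using that pos_less[of i j] pos_less[of j i] by (cases "(i, j) \<in> I") (auto simp: le_def)
    thus ?thesis using dom by (auto simp: inversions_def iw)
  qed
  have "avoids_312 n w"
    unfolding avoids_312_def
  proof (intro notI, elim exE conjE)
    fix i j k assume ijk: "1 \<le> i" "i < j" "j < k" "k \<le> n" "w j < w k" "w k < w i"
    have rng: "w i \<in> {1..n}" "w j \<in> {1..n}"
      by (simp_all only: permutes_in_image[OF w]) (use ijk in auto)
    have iv: "inv w (w x) = x" for x using permutes_inverses(2)[OF w] .
    have "(w j, w i) \<in> I"
      unfolding I[symmetric] using ijk rng by (auto simp: inversions_def iv)
    hence "(w j, w k) \<in> I" using dn ijk by blast
    thus False unfolding I[symmetric] using ijk by (auto simp: inversions_def iv)
  qed
  thus ?thesis using w I by blast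
qed

lemma finite_lattice_Tam: "finite_lattice (Tam n)"
proof -
  have ex_Inter: "\<exists>w\<in>carrier (Tam n). inversions n w =
      {(a, b). 1 \<le> a \<and> a < b \<and> b \<le> n \<and> (\<forall>x\<in>A. (a, b) \<in> inversions n x)}"
    if A: "A \<subseteq> carrier (Tam n)" for A
  proof -
    let ?I = "{(a, b). 1 \<le> a \<and> a < b \<and> b \<le> n \<and> (\<forall>x\<in>A. (a, b) \<in> inversions n x)}"
    have "\<exists>w. w permutes {1..n} \<and> avoids_312 n w \<and> inversions n w = ?I"
    proof (rule ex_Tam_inversions)
      fix a b c assume "(a, b) \<in> ?I" "(b, c) \<in> ?I"
      thus "(a, c) \<in> ?I" using inversions_trans[of a b n _ c] by auto
    next
      fix a b c assume "(a, c) \<in> ?I" "a < b" "b < c"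
      thus "(a, b) \<in> ?I"
        using A inversions_avoids_312[of _ n a c b] by (auto simp: carrier_Tam subset_iff)
    qed auto
    thus ?thesis by (auto simp: carrier_Tam)
  qed
  have rng: "(a, b) \<in> inversions n w \<Longrightarrow> 1 \<le> a \<and> a < b \<and> b \<le> n" for a b w
    by (auto simp: inversions_def)
  interpret partial_order "Tam n"
  proof (unfold_locales, goal_cases)
    case (5 x y)
    thus ?case using inversions_inject by (auto simp: carrier_Tam le_Tam eq_Tam)
  qed (auto simp: le_Tam eq_Tam, simp_all add: fun_eq_iff eq_Tam)
  show ?thesis
  proof (unfold_locales, goal_cases)
    case (1 x y)
    let ?A = "Upper (Tam n) {x, y}"
    have "?A \<subseteq> carrier (Tam n)" by (auto simp: Upper_def)
    from ex_Inter[OF this] obtain w where w: "w \<in> carrier (Tam n)"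
      "inversions n w = {(a, b). 1 \<le> a \<and> a < b \<and> b \<le> n \<and> (\<forall>x\<in>?A. (a, b) \<in> inversions n x)}"
      by blast
    have "least (Tam n) w ?A"
      unfolding least_def using w 1 rng by (auto simp: Upper_def le_Tam)
    thus ?case by (rule exI[of _ w])
  next
    case (2 x y)
    hence "{x, y} \<subseteq> carrier (Tam n)" by auto
    from ex_Inter[OF this] obtain w where w: "w \<in> carrier (Tam n)"
      "inversions n w = {(a, b). 1 \<le> a \<and> a < b \<and> b \<le> n \<and> (\<forall>x\<in>{x, y}. (a, b) \<in> inversions n x)}"
      by blast
    have "greatest (Tam n) w (Lower (Tam n) {x, y})"
      unfolding greatest_def using w 2 rng by (auto simp: Lower_def le_Tam)
    thus ?case by (rule exI[of _ w])
  next
    case 3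
    show ?case
      by (rule finite_subset[OF _ finite_permutations[of "{1..n}"]]) (auto simp: carrier_Tam)
  qed
qed

subsection \<open>Algebraic power series\<close>

text \<open>A polynomial in \<open>y\<close> whose coefficients are polynomials in \<open>z\<close>, evaluated at \<open>y = f(z)\<close>.\<close>

definition annihilates :: "'a::field poly poly \<Rightarrow> 'a fps \<Rightarrow> bool" where
  "annihilates P f \<longleftrightarrow> poly (map_poly fps_of_poly P) f = 0"

text \<open>The degree of \<open>f\<close> over the field of rational functions in \<open>z\<close>, denominators having been
  cleared.\<close>

definition algebraic_of_degree :: "'a::field fps \<Rightarrow> nat \<Rightarrow> bool" where
  "algebraic_of_degree f d \<longleftrightarrow>
     (\<exists>P. P \<noteq> 0 \<and> annihilates P f \<and> degree P = d) \<and>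
     (\<forall>P. P \<noteq> 0 \<and> annihilates P f \<longrightarrow> d \<le> degree P)"

definition Eeta_Tam_gf :: "complex fps" where
  "Eeta_Tam_gf = Abs_fps (\<lambda>n. if n = 0 then 0 else of_nat (card (finite_lattice.Eeta_wins (Tam n))))"

definition Q_poly :: "complex poly poly" where
  "Q_poly = [: [:0, 1:], [:-1, 3, 1:], [:-2, 2, 3:], [:0, 0, 3:], [:0, 0, 1:] :]"

end

theory Submission
  imports Defs "HOL-Complex_Analysis.Complex_Analysis" "HOL-Real_Asymp.Real_Asymp"
    "HOL-Computational_Algebra.Polynomial_Factorial"
    "HOL-Computational_Algebra.Fundamental_Theorem_Algebra"
begin

unbundle no vec_syntax
unbundle fps_syntax

text \<open>An element of the Tamari lattice is a plane forest, and an Ungar move cuts off the last child at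
  each node of a chosen set of inner nodes. The trees of a forest play independently, so a forest is a
  win for Eeta iff all its trees are. A tree is a win iff its root is a leaf or has an even number of
  children, all but the last one winning trees and the last one with only winning trees below its
  root. Hence the generating function \<open>C\<close> of the winning trees satisfies \<open>C = z + z\<^sup>2 K(C)\<close> with
  \<open>K(c) = c / ((1 - c)\<^sup>2 (1 + c))\<close>, and \<open>F = C / (1 - C)\<close>.

  The polynomial \<open>Q(y, z)\<close> is quadratic in \<open>z\<close>, primitive, and its discriminant
  \<open>(1 + y)\<^sup>2 (1 + 2y) (1 + 2y + 4y\<^sup>2 + 4y\<^sup>3)\<close> is not a square. So it is, up to constants, the
  minimal polynomial of the compositional inverse of \<open>F\<close>, and every relation for \<open>F\<close> is a multiple of it.

  For the asymptotics, positivity of the equation for \<open>C\<close> bounds its partial sums at the critical point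
  \<open>r = 1 / \<rho>\<close> by \<open>\<kappa> = C(r)\<close>, so \<open>C\<close> is continuous on the closed disc of radius \<open>r\<close>, and
  \<open>z\<^sup>2 K'(C(z)) = 1\<close> only at \<open>z = r\<close>. Near \<open>r\<close> the series is a holomorphic function of
  \<open>\<surd>(1 - z / r)\<close>. Subtracting the terms of the expansion at \<open>r\<close> up to order 3 leaves a function with
  bounded second derivative, whose coefficients are \<open>O(n\<^sup>-\<^sup>2 r\<^sup>-\<^sup>n)\<close> by Cauchy's inequality.\<close>

subsection \<open>Winning forests\<close>

datatype tree = Node (children: "tree list")

fun nodes :: "tree list \<Rightarrow> nat" where
  "nodes [] = 0"
| "nodes (Node \<psi> # \<phi>) = Suc (nodes \<psi> + nodes \<phi>)"

lemma nodes_append [simp]: "nodes (\<phi> @ \<psi>) = nodes \<phi> + nodes \<psi>"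
  by (induction \<phi> rule: nodes.induct) auto

lemma nodes_eq_0_iff [simp]: "nodes \<phi> = 0 \<longleftrightarrow> \<phi> = []"
  by (cases \<phi> rule: nodes.cases) auto

lemma nodes_pos_iff [simp]: "0 < nodes \<phi> \<longleftrightarrow> \<phi> \<noteq> []"
  by (metis nodes_eq_0_iff neq0_conv)

lemma nodes_single: "nodes [t] = Suc (nodes (children t))"
  by (cases t) auto

lemma nodes_single_le:
  assumes "t \<in> set \<phi>"
  shows "nodes [t] \<le> nodes \<phi>"
proof -
  obtain \<psi> \<chi> where "\<phi> = \<psi> @ [t] @ \<chi>" using split_list[OF assms] by auto
  thus ?thesis by (simp only: nodes_append)
qed

context notes conj_cong [fundef_cong]
begin

function win :: "tree \<Rightarrow> bool" where
  "win (Node \<phi>) \<longleftrightarrow> \<phi> = [] \<or> (\<phi> \<noteq> [] \<and> even (length \<phi>) \<and>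
     (\<forall>t\<in>set (butlast \<phi>). win t) \<and> (\<forall>t\<in>set (children (last \<phi>)). win t))"
  by pat_completeness auto
termination
proof (relation "Wellfounded.measure (\<lambda>t. nodes [t])", goal_cases)
  case (2 \<phi> t)
  thus ?case using nodes_single_le[of t \<phi>] by (auto dest: in_set_butlastD)
next
  case (3 \<phi> t)
  thus ?case using nodes_single_le[of t "children (last \<phi>)"] nodes_single_le[of "last \<phi>" \<phi>]
    by (auto simp: nodes_single)
qed auto

declare win.simps [simp del]

end

abbreviation wins :: "tree list \<Rightarrow> bool" where
  "wins \<phi> \<equiv> \<forall>t\<in>set \<phi>. win t"

definition tail_wins :: "tree list \<Rightarrow> bool" where
  "tail_wins \<phi> \<longleftrightarrow> wins (butlast \<phi>) \<and> wins (children (last \<phi>))"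

lemma tail_wins_snoc [simp]: "tail_wins (\<phi> @ [Node \<psi>]) \<longleftrightarrow> wins \<phi> \<and> wins \<psi>"
  by (simp add: tail_wins_def)

lemma tail_wins_single [simp]: "tail_wins [Node \<psi>] \<longleftrightarrow> wins \<psi>"
  by (simp add: tail_wins_def)

lemma tail_wins_append: "\<psi> \<noteq> [] \<Longrightarrow> tail_wins (\<phi> @ \<psi>) \<longleftrightarrow> wins \<phi> \<and> tail_wins \<psi>"
  by (auto simp: tail_wins_def butlast_append)

lemma tail_wins_Cons: "\<psi> \<noteq> [] \<Longrightarrow> tail_wins (t # \<psi>) \<longleftrightarrow> win t \<and> tail_wins \<psi>"
  using tail_wins_append[of \<psi> "[t]"] by auto

lemma win_Node: "win (Node \<phi>) \<longleftrightarrow> \<phi> = [] \<or> (even (length \<phi>) \<and> tail_wins \<phi>)"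
  by (auto simp: tail_wins_def win.simps[of \<phi>])

text \<open>A forest with \<open>n\<close> nodes, numbered in preorder, stands for the element of the Tamari lattice in
  which \<open>(i, j)\<close> is an inversion iff \<open>j\<close> is a proper descendant of \<open>i\<close>. An Ungar move (trivial ones
  included) chooses a set of inner nodes and, at each of them, cuts off the last child, which becomes
  the next sibling.\<close>

inductive moves_to :: "tree list \<Rightarrow> tree list \<Rightarrow> bool" (infix \<open>\<leadsto>\<close> 50) where
  Nil: "[] \<leadsto> []"
| keep: "\<psi> \<leadsto> \<psi>' \<Longrightarrow> \<phi> \<leadsto> \<phi>' \<Longrightarrow> Node \<psi> # \<phi> \<leadsto> Node \<psi>' # \<phi>'"
| cut: "\<psi> \<leadsto> \<psi>' \<Longrightarrow> [t] \<leadsto> \<tau> \<Longrightarrow> \<phi> \<leadsto> \<phi>' \<Longrightarrow> Node (\<psi> @ [t]) # \<phi> \<leadsto> Node \<psi>' # \<tau> @ \<phi>'"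

inductive_simps moves_to_Nil_iff [simp]: "[] \<leadsto> \<phi>"

inductive_cases moves_to_ConsE [consumes 1, case_names keep cut]: "t # \<phi> \<leadsto> \<chi>"

lemma moves_to_refl: "\<phi> \<leadsto> \<phi>"
  by (induction \<phi> rule: nodes.induct) (auto intro: moves_to.intros)

lemma moves_to_nodes: "\<phi> \<leadsto> \<phi>' \<Longrightarrow> nodes \<phi>' = nodes \<phi>"
  by (induction rule: moves_to.induct) auto

lemma moves_to_nonempty: "\<phi> \<leadsto> \<phi>' \<Longrightarrow> \<phi>' = [] \<longleftrightarrow> \<phi> = []"
  by (induction rule: moves_to.induct) auto

lemma moves_to_append: "\<phi> \<leadsto> \<phi>' \<Longrightarrow> \<psi> \<leadsto> \<psi>' \<Longrightarrow> \<phi> @ \<psi> \<leadsto> \<phi>' @ \<psi>'"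
proof (induction rule: moves_to.induct)
  case (cut \<omega> \<omega>' t \<tau> \<phi> \<phi>')
  thus ?case using moves_to.cut[of \<omega> \<omega>' t \<tau> "\<phi> @ \<psi>" "\<phi>' @ \<psi>'"] by simp
qed (auto intro: moves_to.intros)

lemma moves_to_appendE:
  assumes "\<phi> @ \<psi> \<leadsto> \<chi>"
  obtains \<phi>' \<psi>' where "\<chi> = \<phi>' @ \<psi>'" "\<phi> \<leadsto> \<phi>'" "\<psi> \<leadsto> \<psi>'"
proof -
  have "\<exists>\<phi>' \<psi>'. \<chi> = \<phi>' @ \<psi>' \<and> \<phi> \<leadsto> \<phi>' \<and> \<psi> \<leadsto> \<psi>'"
    using assms
  proof (induction \<phi> arbitrary: \<chi>)
    case (Cons t \<phi>)
    from Cons.prems have "t # (\<phi> @ \<psi>) \<leadsto> \<chi>" by simp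
    thus ?case
    proof (cases rule: moves_to_ConsE)
      case (keep \<omega> \<omega>' \<xi>)
      with Cons.IH obtain \<phi>' \<psi>' where "\<xi> = \<phi>' @ \<psi>'" "\<phi> \<leadsto> \<phi>'" "\<psi> \<leadsto> \<psi>'" by blast
      thus ?thesis
        using keep by (intro exI[of _ "Node \<omega>' # \<phi>'"] exI[of _ \<psi>']) (auto intro: moves_to.intros)
    next
      case (cut \<omega> \<omega>' c \<tau> \<xi>)
      with Cons.IH obtain \<phi>' \<psi>' where "\<xi> = \<phi>' @ \<psi>'" "\<phi> \<leadsto> \<phi>'" "\<psi> \<leadsto> \<psi>'" by blast
      thus ?thesis
        using cut by (intro exI[of _ "Node \<omega>' # \<tau> @ \<phi>'"] exI[of _ \<psi>']) (auto intro: moves_to.intros)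
    qed
  qed auto
  thus ?thesis using that by blast
qed

lemma moves_to_singleE:
  assumes "[Node \<phi>] \<leadsto> \<chi>"
  obtains (keep) \<phi>' where "\<chi> = [Node \<phi>']" "\<phi> \<leadsto> \<phi>'"
  | (cut) \<psi> t \<psi>' \<tau> where "\<phi> = \<psi> @ [t]" "\<chi> = Node \<psi>' # \<tau>" "\<psi> \<leadsto> \<psi>'" "[t] \<leadsto> \<tau>"
  using assms by (cases rule: moves_to_ConsE) auto

lemma moves_to_single_keep: "\<phi> \<leadsto> \<phi>' \<Longrightarrow> [Node \<phi>] \<leadsto> [Node \<phi>']"
  by (intro moves_to.keep) auto

lemma moves_to_single_cut: "\<psi> \<leadsto> \<psi>' \<Longrightarrow> [t] \<leadsto> \<tau> \<Longrightarrow> [Node (\<psi> @ [t])] \<leadsto> Node \<psi>' # \<tau>"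
  using moves_to.cut[of \<psi> \<psi>' t \<tau> "[]" "[]"] by simp

text \<open>The parity clause is the strengthening that carries the induction through the case where
  the last child of the root is itself cut.\<close>

definition rigid :: "tree list \<Rightarrow> bool" where
  "rigid \<phi> \<longleftrightarrow> (\<forall>\<phi>'. \<phi> \<leadsto> \<phi>' \<longrightarrow> (wins \<phi>' \<longrightarrow> \<phi>' = \<phi>) \<and> (odd (length \<phi>) \<longrightarrow> \<not> win (Node \<phi>')))"

lemma rigid_imp_eq: "rigid \<phi> \<Longrightarrow> \<phi> \<leadsto> \<phi>' \<Longrightarrow> wins \<phi>' \<Longrightarrow> \<phi>' = \<phi>"
  by (simp add: rigid_def)

lemma rigid_odd_imp_not_win: "rigid \<phi> \<Longrightarrow> odd (length \<phi>) \<Longrightarrow> \<phi> \<leadsto> \<phi>' \<Longrightarrow> \<not> win (Node \<phi>')"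
  by (simp add: rigid_def)

lemma rigid_snoc:
  assumes "rigid \<phi>" "rigid [t]"
  shows "rigid (\<phi> @ [t])"
  unfolding rigid_def
proof (intro allI impI)
  fix \<chi> assume "\<phi> @ [t] \<leadsto> \<chi>"
  then obtain \<phi>' \<tau> where \<chi>: "\<chi> = \<phi>' @ \<tau>" "\<phi> \<leadsto> \<phi>'" "[t] \<leadsto> \<tau>" by (rule moves_to_appendE)
  hence "\<tau> \<noteq> []" using moves_to_nonempty by blast
  moreover have "wins \<phi>' \<Longrightarrow> \<phi>' = \<phi>" "wins \<tau> \<Longrightarrow> \<tau> = [t]" "\<not> win (Node \<tau>)"
    using assms \<chi> by (auto simp: rigid_def)
  ultimately show "(wins \<chi> \<longrightarrow> \<chi> = \<phi> @ [t]) \<and> (odd (length (\<phi> @ [t])) \<longrightarrow> \<not> win (Node \<chi>))"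
    using \<chi>(1) by (auto simp: win_Node tail_wins_append)
qed

lemma rigid_children_imp_eq:
  assumes "rigid \<psi>" "odd (length \<psi>)" and "rigid \<omega>" "\<And>t. t \<in> set \<omega> \<Longrightarrow> rigid [t]"
    and move: "\<psi> @ [Node \<omega>] \<leadsto> \<chi>" and win: "win (Node \<chi>)"
  shows "\<chi> = \<psi> @ [Node \<omega>]"
proof -
  obtain \<psi>' \<tau> where \<chi>: "\<chi> = \<psi>' @ \<tau>" "\<psi> \<leadsto> \<psi>'" "[Node \<omega>] \<leadsto> \<tau>"
    using move by (rule moves_to_appendE)
  have "\<tau> \<noteq> []" using \<chi>(3) moves_to_nonempty by blast
  hence "even (length \<chi>)" "wins \<psi>'" and tail: "tail_wins \<tau>"
    using win \<chi>(1) by (auto simp: win_Node tail_wins_append)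
  hence \<psi>': "\<psi>' = \<psi>" and odd: "odd (length \<tau>)"
    using rigid_imp_eq[OF assms(1) \<chi>(2)] assms(2) \<chi>(1) by auto
  from \<chi>(3) have "\<tau> = [Node \<omega>]"
  proof (cases rule: moves_to_singleE)
    case (keep \<omega>')
    thus ?thesis using tail rigid_imp_eq[OF assms(3)] by auto
  next
    case (cut \<xi> e \<xi>' \<sigma>)
    have "\<sigma> \<noteq> []" using cut moves_to_nonempty by blast
    hence "win (Node \<sigma>)" using cut tail odd by (auto simp: win_Node tail_wins_Cons)
    moreover have "rigid [e]" using assms(4) cut by auto
    ultimately show ?thesis using rigid_odd_imp_not_win[of "[e]" \<sigma>] cut by simp
  qed
  thus ?thesis using \<chi>(1) \<psi>' by simp
qed

lemma rigid_single:
  assumes "rigid \<psi>" "odd (length \<psi>)" and "rigid \<omega>" "\<And>t. t \<in> set \<omega> \<Longrightarrow> rigid [t]"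
  shows "rigid [Node (\<psi> @ [Node \<omega>])]"
  unfolding rigid_def
proof (intro allI impI)
  fix \<chi> assume "[Node (\<psi> @ [Node \<omega>])] \<leadsto> \<chi>"
  thus "(wins \<chi> \<longrightarrow> \<chi> = [Node (\<psi> @ [Node \<omega>])]) \<and>
    (odd (length [Node (\<psi> @ [Node \<omega>])]) \<longrightarrow> \<not> win (Node \<chi>))"
  proof (cases rule: moves_to_singleE)
    case (keep \<chi>')
    thus ?thesis using rigid_children_imp_eq[OF assms] by (auto simp: win_Node[of "[_]"])
  next
    case (cut \<psi>' t \<psi>'' \<tau>)
    hence "\<not> win (Node \<psi>'')" "\<tau> \<noteq> []"
      using rigid_odd_imp_not_win[OF assms(1,2)] moves_to_nonempty by auto
    thus ?thesis using cut by (auto simp: win_Node[of "_ # _"] tail_wins_Cons)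
  qed
qed

lemma wins_imp_rigid: "wins \<phi> \<Longrightarrow> rigid \<phi>"
proof (induction \<phi> rule: measure_induct_rule[of nodes])
  case (less \<phi>)
  show ?case
  proof (cases \<phi> rule: rev_cases)
    case Nil
    thus ?thesis by (simp add: rigid_def)
  next
    case (snoc \<psi> t)
    show ?thesis
    proof (cases "\<psi> = []")
      case False
      hence "rigid \<psi>" "rigid [t]" using less snoc by (auto simp: nodes_single)
      thus ?thesis unfolding snoc by (rule rigid_snoc)
    next
      case True
      obtain \<chi> where \<phi>: "\<phi> = [Node \<chi>]" using snoc True by (cases t) simp
      show ?thesis
      proof (cases \<chi> rule: rev_cases)
        case Nil
        thus ?thesis unfolding \<phi> by (auto simp: rigid_def win_Node[of "[_]"] elim: moves_to_singleE)
      next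
        case (snoc \<psi> t)
        obtain \<omega> where \<chi>: "\<chi> = \<psi> @ [Node \<omega>]" using snoc by (cases t) simp
        have "wins \<psi>" "wins \<omega>" "odd (length \<psi>)" using less.prems \<phi> \<chi> by (auto simp: win_Node)
        moreover have "nodes [t] < nodes \<phi>" if "t \<in> set \<omega>" for t
          using nodes_single_le[OF that] \<phi> \<chi> by simp
        ultimately show ?thesis
          unfolding \<phi> \<chi> using less.IH \<phi> \<chi> by (intro rigid_single) auto
      qed
    qed
  qed
qed

definition can_reach_win :: "tree list \<Rightarrow> bool" where
  "can_reach_win \<phi> \<longleftrightarrow> (\<exists>\<phi>'. \<phi> \<leadsto> \<phi>' \<and> wins \<phi>')"

text \<open>In the second case, appending one more tree with winning children makes the forest fit below a
  winning root.\<close>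

definition can_reach_win_below_root :: "tree list \<Rightarrow> bool" where
  "can_reach_win_below_root \<phi> \<longleftrightarrow>
     (\<exists>\<phi>'. \<phi> \<leadsto> \<phi>' \<and> win (Node \<phi>')) \<or> (\<exists>\<phi>'. \<phi> \<leadsto> \<phi>' \<and> odd (length \<phi>') \<and> wins \<phi>')"

lemma can_reach_win_append:
  assumes "can_reach_win \<phi>" "can_reach_win \<psi>"
  shows "can_reach_win (\<phi> @ \<psi>)"
proof -
  obtain \<phi>' \<psi>' where "\<phi> \<leadsto> \<phi>'" "wins \<phi>'" "\<psi> \<leadsto> \<psi>'" "wins \<psi>'"
    using assms by (auto simp: can_reach_win_def)
  hence "\<phi> @ \<psi> \<leadsto> \<phi>' @ \<psi>'" "wins (\<phi>' @ \<psi>')" by (auto intro: moves_to_append)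
  thus ?thesis unfolding can_reach_win_def by blast
qed

lemma can_reach_win_below_root_snoc:
  assumes "can_reach_win \<phi>" "can_reach_win \<chi>" "can_reach_win_below_root [Node \<chi>]"
  shows "can_reach_win_below_root (\<phi> @ [Node \<chi>])"
proof -
  obtain \<phi>' where \<phi>': "\<phi> \<leadsto> \<phi>'" "wins \<phi>'" using assms(1) by (auto simp: can_reach_win_def)
  obtain \<chi>' where \<chi>': "\<chi> \<leadsto> \<chi>'" "wins \<chi>'" using assms(2) by (auto simp: can_reach_win_def)
  have append: "\<phi> @ [Node \<chi>] \<leadsto> \<phi>' @ \<tau>" if "[Node \<chi>] \<leadsto> \<tau>" for \<tau>
    using moves_to_append[OF \<phi>'(1) that] .
  show ?thesis
  proof (cases "even (length \<phi>')")
    case False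
    hence "win (Node (\<phi>' @ [Node \<chi>']))" using \<phi>' \<chi>' by (auto simp: win_Node)
    thus ?thesis
      using append[OF moves_to_single_keep[OF \<chi>'(1)]] by (auto simp: can_reach_win_below_root_def)
  next
    case True
    consider (below_win) \<tau> where "[Node \<chi>] \<leadsto> \<tau>" "win (Node \<tau>)"
      | (odd_wins) \<tau> where "[Node \<chi>] \<leadsto> \<tau>" "odd (length \<tau>)" "wins \<tau>"
      using assms(3) unfolding can_reach_win_below_root_def by blast
    thus ?thesis
    proof cases
      case below_win
      hence "\<tau> \<noteq> []" using moves_to_nonempty by blast
      hence "win (Node (\<phi>' @ \<tau>))" using below_win True \<phi>' by (auto simp: win_Node tail_wins_append)
      thus ?thesis using append[OF below_win(1)] by (auto simp: can_reach_win_below_root_def)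
    next
      case odd_wins
      hence "odd (length (\<phi>' @ \<tau>))" "wins (\<phi>' @ \<tau>)" using True \<phi>' by auto
      thus ?thesis using append[OF odd_wins(1)] unfolding can_reach_win_below_root_def by blast
    qed
  qed
qed

lemma can_reach_win_single:
  assumes "can_reach_win_below_root \<psi>" "can_reach_win \<omega>" "can_reach_win [Node \<omega>]"
  shows "can_reach_win [Node (\<psi> @ [Node \<omega>])]"
    and "can_reach_win_below_root [Node (\<psi> @ [Node \<omega>])]"
proof -
  let ?\<phi> = "[Node (\<psi> @ [Node \<omega>])]"
  obtain \<omega>' where \<omega>': "\<omega> \<leadsto> \<omega>'" "wins \<omega>'" using assms(2) by (auto simp: can_reach_win_def)
  obtain \<tau> where \<tau>: "[Node \<omega>] \<leadsto> \<tau>" "wins \<tau>" using assms(3) by (auto simp: can_reach_win_def)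
  have "can_reach_win ?\<phi> \<and> can_reach_win_below_root ?\<phi>"
  proof -
    consider (below_win) \<psi>' where "\<psi> \<leadsto> \<psi>'" "win (Node \<psi>')"
      | (odd_wins) \<psi>' where "\<psi> \<leadsto> \<psi>'" "odd (length \<psi>')" "wins \<psi>'"
      using assms(1) unfolding can_reach_win_below_root_def by blast
    thus ?thesis
    proof cases
      case below_win
      have "?\<phi> \<leadsto> Node \<psi>' # \<tau>" "?\<phi> \<leadsto> Node \<psi>' # [Node \<omega>']"
        using moves_to_single_cut[OF below_win(1)] \<tau>(1) moves_to_single_keep[OF \<omega>'(1)] by auto
      moreover have "wins (Node \<psi>' # \<tau>)" "win (Node (Node \<psi>' # [Node \<omega>']))"
        using below_win \<tau> \<omega>' by (auto simp: win_Node[of "_ # _"] tail_wins_Cons)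
      ultimately show ?thesis unfolding can_reach_win_def can_reach_win_below_root_def by blast
    next
      case odd_wins
      let ?\<phi>' = "[Node (\<psi>' @ [Node \<omega>'])]"
      have "?\<phi> \<leadsto> ?\<phi>'"
        by (intro moves_to_single_keep moves_to_append odd_wins(1) \<omega>'(1))
      moreover have "wins ?\<phi>'" "odd (length ?\<phi>')" using odd_wins \<omega>' by (auto simp: win_Node[of "_ @ _"])
      ultimately show ?thesis unfolding can_reach_win_def can_reach_win_below_root_def by blast
    qed
  qed
  thus "can_reach_win ?\<phi>" "can_reach_win_below_root ?\<phi>" by blast+
qed

lemma can_reach_win_all: "can_reach_win \<phi> \<and> can_reach_win_below_root \<phi>"
proof (induction \<phi> rule: measure_induct_rule[of nodes])
  case (less \<phi>)
  show ?case
  proof (cases \<phi> rule: rev_cases)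
    case Nil
    thus ?thesis by (auto simp: can_reach_win_def can_reach_win_below_root_def win_Node)
  next
    case (snoc \<psi> t)
    obtain \<chi> where t: "t = Node \<chi>" by (cases t)
    show ?thesis
    proof (cases "\<psi> = []")
      case False
      hence "nodes \<psi> < nodes \<phi>" "nodes [Node \<chi>] < nodes \<phi>" "nodes \<chi> < nodes \<phi>"
        using snoc t by auto
      from this[THEN less.IH] show ?thesis
        using can_reach_win_append can_reach_win_below_root_snoc unfolding snoc t by blast
    next
      case True
      hence \<phi>: "\<phi> = [Node \<chi>]" using snoc t by simp
      show ?thesis
      proof (cases \<chi> rule: rev_cases)
        case Nil
        hence "wins \<phi>" "odd (length \<phi>)" using \<phi> by (auto simp: win_Node)
        thus ?thesis
          unfolding can_reach_win_def can_reach_win_below_root_def using moves_to_refl by blast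
      next
        case (snoc \<psi> d)
        obtain \<omega> where d: "d = Node \<omega>" by (cases d)
        have "nodes \<psi> < nodes \<phi>" "nodes \<omega> < nodes \<phi>" "nodes [Node \<omega>] < nodes \<phi>"
          using \<phi> snoc d by auto
        from this[THEN less.IH] show ?thesis
          using can_reach_win_single unfolding \<phi> snoc d by blast
      qed
    qed
  qed
qed

theorem wins_iff_no_winning_move: "wins \<phi> \<longleftrightarrow> (\<forall>\<phi>'. \<phi> \<leadsto> \<phi>' \<and> \<phi>' \<noteq> \<phi> \<longrightarrow> \<not> wins \<phi>')"
  using rigid_imp_eq[OF wins_imp_rigid] can_reach_win_all[unfolded can_reach_win_def] by metis

subsection \<open>Bracket vectors\<close>

text \<open>\<open>brackets\<close> lists the numbers of proper descendants in preorder; \<open>cut_brackets\<close> lists what each of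
  them becomes when that node loses its last child.\<close>

fun brackets :: "tree list \<Rightarrow> nat list" where
  "brackets [] = []"
| "brackets (Node \<psi> # \<phi>) = nodes \<psi> # brackets \<psi> @ brackets \<phi>"

fun cut_brackets :: "tree list \<Rightarrow> nat list" where
  "cut_brackets [] = []"
| "cut_brackets (Node \<psi> # \<phi>) = nodes (butlast \<psi>) # cut_brackets \<psi> @ cut_brackets \<phi>"

lemma length_brackets [simp]: "length (brackets \<phi>) = nodes \<phi>"
  by (induction \<phi> rule: nodes.induct) auto

lemma length_cut_brackets [simp]: "length (cut_brackets \<phi>) = nodes \<phi>"
  by (induction \<phi> rule: nodes.induct) auto

lemma brackets_append [simp]: "brackets (\<phi> @ \<psi>) = brackets \<phi> @ brackets \<psi>"
  by (induction \<phi> rule: nodes.induct) auto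

lemma cut_brackets_append [simp]: "cut_brackets (\<phi> @ \<psi>) = cut_brackets \<phi> @ cut_brackets \<psi>"
  by (induction \<phi> rule: nodes.induct) auto

lemma brackets_inject: "brackets \<phi> = brackets \<psi> \<longleftrightarrow> \<phi> = \<psi>"
proof
  show "brackets \<phi> = brackets \<psi> \<Longrightarrow> \<phi> = \<psi>"
  proof (induction \<phi> arbitrary: \<psi> rule: nodes.induct)
    case 1
    thus ?case by (cases \<psi> rule: nodes.cases) auto
  next
    case (2 \<omega> \<phi>)
    from 2(3) obtain \<omega>' \<phi>' where \<psi>: "\<psi> = Node \<omega>' # \<phi>'" by (cases \<psi> rule: nodes.cases) auto
    have "brackets \<omega> @ brackets \<phi> = brackets \<omega>' @ brackets \<phi>'"
      and "length (brackets \<omega>) = length (brackets \<omega>')"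
      using 2(3) \<psi> by auto
    hence "brackets \<omega> = brackets \<omega>'" "brackets \<phi> = brackets \<phi>'" by auto
    thus ?case using 2(1)[of \<omega>'] 2(2)[of \<phi>'] \<psi> by auto
  qed
qed auto

definition nested :: "nat list \<Rightarrow> bool" where
  "nested x \<longleftrightarrow>
     (\<forall>i<length x. i + x ! i < length x \<and> (\<forall>j. i < j \<and> j \<le> i + x ! i \<longrightarrow> j + x ! j \<le> i + x ! i))"

lemma nestedD:
  assumes "nested x" "i < length x"
  shows "i + x ! i < length x" and "\<And>j. i < j \<Longrightarrow> j \<le> i + x ! i \<Longrightarrow> j + x ! j \<le> i + x ! i"
  using assms by (auto simp: nested_def)

lemma nested_ConsD:
  assumes "nested (a # x)"
  shows "a \<le> length x" "nested (take a x)" "nested (drop a x)"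
proof -
  note N = nestedD[OF assms]
  show a: "a \<le> length x" using N(1)[of 0] by simp
  show "nested (take a x)"
    unfolding nested_def
  proof (intro allI impI conjI)
    fix i assume i: "i < length (take a x)"
    show bound: "i + take a x ! i < length (take a x)"
      using N(2)[of 0 "Suc i"] i a by auto
    fix j assume j: "i < j \<and> j \<le> i + take a x ! i"
    have "j < a" using j bound a by (simp del: nth_take)
    thus "j + take a x ! j \<le> i + take a x ! i"
      using N(2)[of "Suc i" "Suc j"] i j by auto
  qed
  show "nested (drop a x)"
    unfolding nested_def
  proof (intro allI impI conjI)
    fix i assume "i < length (drop a x)"
    hence i: "a + i < length x" by simp
    show "i + drop a x ! i < length (drop a x)" using N(1)[of "Suc (a + i)"] i by simp
    fix j assume "i < j \<and> j \<le> i + drop a x ! i"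
    thus "j + drop a x ! j \<le> i + drop a x ! i" using N(2)[of "Suc (a + i)" "Suc (a + j)"] i by simp
  qed
qed

lemma index_Cons_append_cases:
  assumes "i < Suc (m + n)"
  obtains (head) "i = 0" | (left) k where "i = Suc k" "k < m" | (right) k where "i = Suc (m + k)" "k < n"
proof (cases i)
  case (Suc k)
  thus ?thesis using that(2)[of k] that(3)[of "k - m"] assms by (cases "k < m") auto
qed (use that in blast)

lemma nested_ConsI:
  assumes x: "nested x" and y: "nested y"
  shows "nested (length x # x @ y)"
  unfolding nested_def
proof (intro allI impI)
  let ?z = "length x # x @ y"
  fix i assume "i < length ?z"
  hence "i < Suc (length x + length y)" by simp
  thus "i + ?z ! i < length ?z \<and> (\<forall>j. i < j \<and> j \<le> i + ?z ! i \<longrightarrow> j + ?z ! j \<le> i + ?z ! i)"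
  proof (cases rule: index_Cons_append_cases)
    case head
    have "j + ?z ! j \<le> length x" if "0 < j" "j \<le> length x" for j
      using that nestedD(1)[OF x, of "j - 1"] by (auto simp: nth_append gr0_conv_Suc)
    thus ?thesis using head by auto
  next
    case (left k)
    have "j + ?z ! j \<le> i + ?z ! i" if "i < j" "j \<le> i + ?z ! i" for j
      using that left nestedD[OF x left(2)] by (cases j) (auto simp: nth_append)
    thus ?thesis using left nestedD(1)[OF x left(2)] by (auto simp: nth_append)
  next
    case (right k)
    have "j + ?z ! j \<le> i + ?z ! i" if "i < j" "j \<le> i + ?z ! i" for j
    proof -
      define l where "l = j - Suc (length x)"
      have "j = Suc (length x + l)" "k < l" using that(1) right(1) by (auto simp: l_def)
      thus ?thesis using that right nestedD(2)[OF y right(2), of l] by auto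
    qed
    thus ?thesis using right nestedD(1)[OF y right(2)] by auto
  qed
qed

lemma nested_brackets: "nested (brackets \<phi>)"
proof (induction \<phi> rule: nodes.induct)
  case (2 \<psi> \<phi>)
  thus ?case using nested_ConsI[of "brackets \<psi>" "brackets \<phi>"] by simp
qed (simp add: nested_def)

lemma nested_imp_brackets: "nested x \<Longrightarrow> \<exists>\<phi>. brackets \<phi> = x"
proof (induction x rule: measure_induct_rule[of length])
  case (less x)
  show ?case
  proof (cases x)
    case Nil
    thus ?thesis by (intro exI[of _ "[]"]) simp
  next
    case (Cons a y)
    note nested = nested_ConsD[OF less.prems[unfolded Cons]]
    have "length (take a y) < length x" "length (drop a y) < length x" using Cons by auto
    then obtain \<psi> \<phi> where \<psi>: "brackets \<psi> = take a y" and \<phi>: "brackets \<phi> = drop a y"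
      using less.IH nested(2,3) by blast
    have "nodes \<psi> = a" using arg_cong[OF \<psi>, of length] nested(1) by simp
    hence "brackets (Node \<psi> # \<phi>) = x" using \<psi> \<phi> Cons by simp
    thus ?thesis by blast
  qed
qed

lemma cut_brackets_less:
  "a < nodes \<phi> \<Longrightarrow> 0 < brackets \<phi> ! a \<Longrightarrow> cut_brackets \<phi> ! a < brackets \<phi> ! a \<and>
     brackets \<phi> ! Suc (a + cut_brackets \<phi> ! a) = brackets \<phi> ! a - Suc (cut_brackets \<phi> ! a)"
proof (induction \<phi> arbitrary: a rule: nodes.induct)
  case (2 \<psi> \<phi>)
  have bound: "Suc (b + cut_brackets \<chi> ! b) < nodes \<chi>"
    if "b < nodes \<chi>" "cut_brackets \<chi> ! b < brackets \<chi> ! b" for b \<chi>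
    using nestedD(1)[OF nested_brackets[of \<chi>]] that by fastforce
  have "a < Suc (nodes \<psi> + nodes \<phi>)" using 2(3) by simp
  thus ?case
  proof (cases rule: index_Cons_append_cases)
    case head
    obtain \<omega> t where \<psi>: "\<psi> = \<omega> @ [t]" using head 2(4) by (cases \<psi> rule: rev_cases) auto
    show ?thesis using head \<psi> by (cases t) (auto simp: nth_append)
  next
    case (left b)
    thus ?thesis using 2(1)[of b] 2(3,4) bound[of b \<psi>] by (auto simp: nth_append)
  next
    case (right b)
    thus ?thesis using 2(2)[of b] 2(3,4) bound[of b \<phi>] by (auto simp: nth_append)
  qed
qed auto

lemma cut_brackets_le: "a < nodes \<phi> \<Longrightarrow> cut_brackets \<phi> ! a \<le> brackets \<phi> ! a"
proof (induction \<phi> arbitrary: a rule: nodes.induct)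
  case (2 \<psi> \<phi>)
  have "nodes (butlast \<psi>) \<le> nodes \<psi>" by (cases \<psi> rule: rev_cases) auto
  thus ?case using 2 by (auto simp: nth_Cons nth_append split: nat.splits)
qed auto

definition reductions :: "tree list \<Rightarrow> nat list set" where
  "reductions \<phi> = {x. list_all2 (\<lambda>(b, c) a. a = b \<or> a = c) (zip (brackets \<phi>) (cut_brackets \<phi>)) x}"

lemma mem_reductions_iff:
  "x \<in> reductions \<phi> \<longleftrightarrow>
     length x = nodes \<phi> \<and> (\<forall>i<nodes \<phi>. x ! i = brackets \<phi> ! i \<or> x ! i = cut_brackets \<phi> ! i)"
  by (auto simp: reductions_def list_all2_conv_all_nth)

lemma reductions_Nil [simp]: "reductions [] = {[]}"
  by (auto simp: reductions_def)

lemma mem_reductions_append: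
  "x \<in> reductions (\<phi> @ \<psi>) \<longleftrightarrow> (\<exists>y z. x = y @ z \<and> y \<in> reductions \<phi> \<and> z \<in> reductions \<psi>)"
proof
  assume "x \<in> reductions (\<phi> @ \<psi>)"
  then obtain y z where "x = y @ z" "y \<in> reductions \<phi>" "z \<in> reductions \<psi>"
    unfolding reductions_def by (auto simp: list_all2_append1)
  thus "\<exists>y z. x = y @ z \<and> y \<in> reductions \<phi> \<and> z \<in> reductions \<psi>" by blast
qed (auto simp: reductions_def intro!: list_all2_appendI)

lemma mem_reductions_Cons:
  "x \<in> reductions (Node \<psi> # \<phi>) \<longleftrightarrow>
     (\<exists>a y. x = a # y \<and> (a = nodes \<psi> \<or> a = nodes (butlast \<psi>)) \<and> y \<in> reductions (\<psi> @ \<phi>))"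
  by (auto simp: reductions_def list_all2_Cons1)

lemma moves_to_imp_reduction: "\<phi> \<leadsto> \<phi>' \<Longrightarrow> brackets \<phi>' \<in> reductions \<phi>"
proof (induction rule: moves_to.induct)
  case (keep \<psi> \<psi>' \<phi> \<phi>')
  hence "brackets \<psi>' @ brackets \<phi>' \<in> reductions (\<psi> @ \<phi>)"
    unfolding mem_reductions_append by blast
  thus ?case using moves_to_nodes[OF keep.hyps(1)] by (simp add: mem_reductions_Cons)
next
  case (cut \<psi> \<psi>' t \<tau> \<phi> \<phi>')
  hence "brackets \<psi>' @ brackets \<tau> @ brackets \<phi>' \<in> reductions (\<psi> @ [t] @ \<phi>)"
    unfolding mem_reductions_append by blast
  thus ?case using moves_to_nodes[OF cut.hyps(1)] by (simp add: mem_reductions_Cons)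
qed auto

lemma reduction_imp_moves_to: "x \<in> reductions \<phi> \<Longrightarrow> \<exists>\<phi>'. \<phi> \<leadsto> \<phi>' \<and> brackets \<phi>' = x"
proof (induction \<phi> arbitrary: x rule: nodes.induct)
  case 1
  thus ?case by auto
next
  case (2 \<psi> \<phi>)
  from 2(3) obtain a y z where x: "x = a # y @ z" and a: "a = nodes \<psi> \<or> a = nodes (butlast \<psi>)"
    and y: "y \<in> reductions \<psi>" and z: "z \<in> reductions \<phi>"
    by (auto simp: mem_reductions_Cons mem_reductions_append)
  obtain \<psi>' where \<psi>': "\<psi> \<leadsto> \<psi>'" "brackets \<psi>' = y" using 2(1)[OF y] by blast
  obtain \<phi>' where \<phi>': "\<phi> \<leadsto> \<phi>'" "brackets \<phi>' = z" using 2(2)[OF z] by blast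
  have keep: ?case if "a = nodes \<psi>"
    using that x \<psi>' \<phi>' moves_to_nodes[OF \<psi>'(1)]
    by (intro exI[of _ "Node \<psi>' # \<phi>'"]) (auto intro: moves_to.keep)
  show ?case
  proof (cases \<psi> rule: rev_cases)
    case Nil
    thus ?thesis using keep a by auto
  next
    case (snoc \<omega> t)
    obtain \<omega>' \<tau> where \<omega>': "\<psi>' = \<omega>' @ \<tau>" "\<omega> \<leadsto> \<omega>'" "[t] \<leadsto> \<tau>"
      using \<psi>'(1) snoc moves_to_appendE by blast
    have "brackets (Node \<omega>' # \<tau> @ \<phi>') = x" if "a = nodes \<omega>"
      using that x \<omega>' \<psi>'(2) \<phi>'(2) moves_to_nodes[OF \<omega>'(2)] by auto
    moreover have "Node \<psi> # \<phi> \<leadsto> Node \<omega>' # \<tau> @ \<phi>'"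
      using moves_to.cut[OF \<omega>'(2,3) \<phi>'(1)] snoc by simp
    ultimately show ?thesis using keep a snoc by auto
  qed
qed

definition inner_nodes :: "tree list \<Rightarrow> nat set" where
  "inner_nodes \<phi> = {a. a < nodes \<phi> \<and> 0 < brackets \<phi> ! a}"

definition cut_at :: "tree list \<Rightarrow> nat set \<Rightarrow> tree list" where
  "cut_at \<phi> S = (THE \<psi>. brackets \<psi> =
     map (\<lambda>i. if i \<in> S then cut_brackets \<phi> ! i else brackets \<phi> ! i) [0..<nodes \<phi>])"

lemma cut_at_properties:
  shows moves_to_cut_at: "\<phi> \<leadsto> cut_at \<phi> S"
    and brackets_cut_at: "brackets (cut_at \<phi> S) =
      map (\<lambda>i. if i \<in> S then cut_brackets \<phi> ! i else brackets \<phi> ! i) [0..<nodes \<phi>]" (is "_ = ?x")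
proof -
  have "?x \<in> reductions \<phi>" by (auto simp: mem_reductions_iff)
  then obtain \<psi> where \<psi>: "\<phi> \<leadsto> \<psi>" "brackets \<psi> = ?x" using reduction_imp_moves_to by blast
  have "cut_at \<phi> S = \<psi>"
    unfolding cut_at_def by (rule the_equality) (simp_all add: \<psi>(2) flip: brackets_inject)
  thus "\<phi> \<leadsto> cut_at \<phi> S" "brackets (cut_at \<phi> S) = ?x" using \<psi> by simp_all
qed

lemma nodes_cut_at [simp]: "nodes (cut_at \<phi> S) = nodes \<phi>"
  using moves_to_nodes[OF moves_to_cut_at] .

lemma nth_brackets_cut_at:
  "i < nodes \<phi> \<Longrightarrow>
     brackets (cut_at \<phi> S) ! i = (if i \<in> S then cut_brackets \<phi> ! i else brackets \<phi> ! i)"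
  by (simp add: brackets_cut_at)

lemma cut_at_eq_iff:
  assumes "S \<subseteq> inner_nodes \<phi>"
  shows "cut_at \<phi> S = \<phi> \<longleftrightarrow> S = {}"
proof
  assume eq: "cut_at \<phi> S = \<phi>"
  have "a \<notin> S" for a
  proof
    assume a: "a \<in> S"
    hence "a < nodes \<phi>" "0 < brackets \<phi> ! a" using assms by (auto simp: inner_nodes_def)
    thus False using nth_brackets_cut_at[of a \<phi> S] cut_brackets_less[of a \<phi>] a eq by simp
  qed
  thus "S = {}" by blast
next
  assume "S = {}"
  hence "brackets (cut_at \<phi> S) = brackets \<phi>"
    using map_nth[of "brackets \<phi>"] by (simp add: brackets_cut_at)
  thus "cut_at \<phi> S = \<phi>" by (simp add: brackets_inject)
qed

lemma moves_to_iff_cut_at: "\<phi> \<leadsto> \<chi> \<longleftrightarrow> (\<exists>S\<subseteq>inner_nodes \<phi>. \<chi> = cut_at \<phi> S)"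
proof
  assume "\<phi> \<leadsto> \<chi>"
  hence \<chi>: "nodes \<chi> = nodes \<phi>"
    "\<And>i. i < nodes \<phi> \<Longrightarrow> brackets \<chi> ! i = brackets \<phi> ! i \<or> brackets \<chi> ! i = cut_brackets \<phi> ! i"
    using moves_to_imp_reduction[of \<phi> \<chi>] by (auto simp: mem_reductions_iff)
  let ?S = "{i. i < nodes \<phi> \<and> brackets \<chi> ! i \<noteq> brackets \<phi> ! i}"
  have "?S \<subseteq> inner_nodes \<phi>"
    using \<chi>(2) cut_brackets_le[of _ \<phi>] by (fastforce simp: inner_nodes_def)
  moreover have "brackets \<chi> = brackets (cut_at \<phi> ?S)"
    using \<chi> by (intro nth_equalityI) (auto simp: nth_brackets_cut_at)
  ultimately show "\<exists>S\<subseteq>inner_nodes \<phi>. \<chi> = cut_at \<phi> S" unfolding brackets_inject by blast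
qed (auto intro: moves_to_cut_at)

definition forest_le :: "tree list \<Rightarrow> tree list \<Rightarrow> bool" (infix \<open>\<preceq>\<close> 50) where
  "\<phi> \<preceq> \<psi> \<longleftrightarrow> list_all2 (\<le>) (brackets \<phi>) (brackets \<psi>)"

lemma forest_le_iff:
  "\<phi> \<preceq> \<psi> \<longleftrightarrow> nodes \<phi> = nodes \<psi> \<and> (\<forall>i<nodes \<phi>. brackets \<phi> ! i \<le> brackets \<psi> ! i)"
  by (simp add: forest_le_def list_all2_conv_all_nth)

lemma forest_le_antisym: "\<phi> \<preceq> \<psi> \<Longrightarrow> \<psi> \<preceq> \<phi> \<Longrightarrow> \<phi> = \<psi>"
  unfolding forest_le_def by (metis brackets_inject list_all2_antisym order.antisym)

lemma forest_le_cut_at_iff: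
  assumes "S \<subseteq> inner_nodes \<phi>"
  shows "\<psi> \<preceq> cut_at \<phi> S \<longleftrightarrow> \<psi> \<preceq> \<phi> \<and> (\<forall>a\<in>S. brackets \<psi> ! a \<le> cut_brackets \<phi> ! a)"
proof -
  have S: "a \<in> S \<Longrightarrow> a < nodes \<phi>" for a using assms by (auto simp: inner_nodes_def)
  show ?thesis
    using S order.trans[OF _ cut_brackets_le]
    by (auto simp: forest_le_iff nth_brackets_cut_at split: if_splits)
qed

lemma cut_at_le: "S \<subseteq> inner_nodes \<phi> \<Longrightarrow> cut_at \<phi> S \<preceq> \<phi>"
  using forest_le_cut_at_iff[of S \<phi> "cut_at \<phi> S"] by (simp add: forest_le_iff)

text \<open>At the largest position where \<open>\<psi>\<close> differs from \<open>\<phi>\<close>, all later blocks are still intact, so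
  nestedness forces the whole last child block to be gone.\<close>

lemma below_some_cut_at:
  assumes le: "\<psi> \<preceq> \<phi>" and ne: "\<psi> \<noteq> \<phi>"
  shows "\<exists>a\<in>inner_nodes \<phi>. \<psi> \<preceq> cut_at \<phi> {a}"
proof -
  let ?D = "{a. a < nodes \<phi> \<and> brackets \<psi> ! a < brackets \<phi> ! a}"
  have n: "nodes \<psi> = nodes \<phi>" using le by (simp add: forest_le_iff)
  have fin: "finite ?D" by simp
  have "?D \<noteq> {}"
  proof
    assume "?D = {}"
    hence "brackets \<phi> ! i \<le> brackets \<psi> ! i" if "i < nodes \<phi>" for i using that not_less by blast
    hence "\<phi> \<preceq> \<psi>" using n by (simp add: forest_le_iff)
    thus False using forest_le_antisym le ne by blast
  qed
  hence "Max ?D \<in> ?D" using Max_in fin by blast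
  then obtain a where a: "a = Max ?D" "a < nodes \<phi>" "brackets \<psi> ! a < brackets \<phi> ! a" by auto
  have later: "brackets \<psi> ! b = brackets \<phi> ! b" if "a < b" "b < nodes \<phi>" for b
  proof -
    have "b \<notin> ?D" using that Max_ge[OF fin] a(1) by (meson leD)
    thus ?thesis using that le n by (auto simp: forest_le_iff not_less intro: order.antisym)
  qed
  let ?d = "Suc (a + cut_brackets \<phi> ! a)"
  have d: "cut_brackets \<phi> ! a < brackets \<phi> ! a"
    "brackets \<phi> ! ?d = brackets \<phi> ! a - Suc (cut_brackets \<phi> ! a)"
    using cut_brackets_less[of a \<phi>] a by auto
  have "brackets \<psi> ! a \<le> cut_brackets \<phi> ! a"
  proof (rule ccontr)
    assume "\<not> ?thesis"
    hence "?d + brackets \<psi> ! ?d \<le> a + brackets \<psi> ! a"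
      using nestedD(2)[OF nested_brackets[of \<psi>], of a ?d] a n by simp
    moreover have "a + brackets \<phi> ! a < nodes \<phi>"
      using nestedD(1)[OF nested_brackets[of \<phi>], of a] a by simp
    hence "brackets \<psi> ! ?d = brackets \<phi> ! ?d" using d later[of ?d] by auto
    ultimately show False using d a by auto
  qed
  moreover have "a \<in> inner_nodes \<phi>" using a by (auto simp: inner_nodes_def)
  ultimately show ?thesis using le by (auto simp: forest_le_cut_at_iff)
qed

lemma cut_at_single_antichain:
  assumes a: "a \<in> inner_nodes \<phi>" and b: "b \<in> inner_nodes \<phi>" and le: "cut_at \<phi> {a} \<preceq> cut_at \<phi> {b}"
  shows "a = b"
proof (rule ccontr)
  assume "a \<noteq> b"
  hence "brackets (cut_at \<phi> {a}) ! b = brackets \<phi> ! b"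
    using b by (simp add: nth_brackets_cut_at inner_nodes_def)
  moreover have "brackets (cut_at \<phi> {a}) ! b \<le> cut_brackets \<phi> ! b"
    using le b by (simp add: forest_le_cut_at_iff)
  ultimately show False using cut_brackets_less[of b \<phi>] b by (auto simp: inner_nodes_def)
qed

subsection \<open>Forests as elements of the Tamari lattice\<close>

definition forest_inversions :: "tree list \<Rightarrow> (nat \<times> nat) set" where
  "forest_inversions \<phi> = {(i, j). 1 \<le> i \<and> i \<le> nodes \<phi> \<and> i < j \<and> j \<le> i + brackets \<phi> ! (i - 1)}"

definition tam_perm :: "tree list \<Rightarrow> nat \<Rightarrow> nat" where
  "tam_perm \<phi> = (SOME w. w \<in> carrier (Tam (nodes \<phi>)) \<and>
     inversions (nodes \<phi>) w = forest_inversions \<phi>)"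

lemma tam_perm_properties:
  shows tam_perm_carrier: "tam_perm \<phi> \<in> carrier (Tam (nodes \<phi>))"
    and inversions_tam_perm: "inversions (nodes \<phi>) (tam_perm \<phi>) = forest_inversions \<phi>"
proof -
  let ?n = "nodes \<phi>" and ?I = "forest_inversions \<phi>"
  note nested = nestedD[OF nested_brackets[of \<phi>], unfolded length_brackets]
  have "\<exists>w. w permutes {1..?n} \<and> avoids_312 ?n w \<and> inversions ?n w = ?I"
  proof (rule ex_Tam_inversions)
    fix a b assume "(a, b) \<in> ?I"
    thus "1 \<le> a \<and> a < b \<and> b \<le> ?n"
      using nested(1)[of "a - 1"] by (cases a) (auto simp: forest_inversions_def)
  next
    fix a b c assume "(a, b) \<in> ?I" "(b, c) \<in> ?I"
    thus "(a, c) \<in> ?I"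
      using nested(2)[of "a - 1" "b - 1"] by (cases a; cases b) (auto simp: forest_inversions_def)
  qed (auto simp: forest_inversions_def)
  hence "\<exists>w. w \<in> carrier (Tam ?n) \<and> inversions ?n w = ?I" by (auto simp: carrier_Tam)
  from someI_ex[OF this] show "tam_perm \<phi> \<in> carrier (Tam ?n)" "inversions ?n (tam_perm \<phi>) = ?I"
    by (auto simp: tam_perm_def)
qed

lemma forest_inversions_subset_iff:
  assumes "nodes \<phi> = nodes \<psi>"
  shows "forest_inversions \<phi> \<subseteq> forest_inversions \<psi> \<longleftrightarrow> \<phi> \<preceq> \<psi>"
proof
  assume sub: "forest_inversions \<phi> \<subseteq> forest_inversions \<psi>"
  have "brackets \<phi> ! i \<le> brackets \<psi> ! i" if i: "i < nodes \<phi>" for i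
  proof (cases "brackets \<phi> ! i = 0")
    case False
    hence "(Suc i, Suc i + brackets \<phi> ! i) \<in> forest_inversions \<phi>"
      using i by (auto simp: forest_inversions_def)
    hence "(Suc i, Suc i + brackets \<phi> ! i) \<in> forest_inversions \<psi>" using sub by blast
    thus ?thesis by (auto simp: forest_inversions_def)
  qed simp
  thus "\<phi> \<preceq> \<psi>" using assms by (simp add: forest_le_iff)
next
  assume le: "\<phi> \<preceq> \<psi>"
  show "forest_inversions \<phi> \<subseteq> forest_inversions \<psi>"
  proof (rule subrelI)
    fix i j assume "(i, j) \<in> forest_inversions \<phi>"
    moreover from this have "brackets \<phi> ! (i - 1) \<le> brackets \<psi> ! (i - 1)"
      using le by (auto simp: forest_inversions_def forest_le_iff)
    ultimately show "(i, j) \<in> forest_inversions \<psi>"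
      using assms by (auto simp: forest_inversions_def)
  qed
qed

lemma tam_perm_le_iff:
  assumes "nodes \<phi> = n" "nodes \<psi> = n"
  shows "tam_perm \<phi> \<sqsubseteq>\<^bsub>Tam n\<^esub> tam_perm \<psi> \<longleftrightarrow> \<phi> \<preceq> \<psi>"
  using inversions_tam_perm[of \<phi>] inversions_tam_perm[of \<psi>] assms
  by (simp add: le_Tam forest_inversions_subset_iff)

lemma tam_perm_inject:
  assumes "nodes \<phi> = n" "nodes \<psi> = n"
  shows "tam_perm \<phi> = tam_perm \<psi> \<longleftrightarrow> \<phi> = \<psi>"
proof
  assume eq: "tam_perm \<phi> = tam_perm \<psi>"
  have "tam_perm \<phi> \<sqsubseteq>\<^bsub>Tam n\<^esub> tam_perm \<psi>" "tam_perm \<psi> \<sqsubseteq>\<^bsub>Tam n\<^esub> tam_perm \<phi>"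
    unfolding eq by (simp_all add: le_Tam)
  thus "\<phi> = \<psi>" using assms by (auto simp: tam_perm_le_iff intro: forest_le_antisym)
qed auto

lemma tam_perm_less_iff:
  assumes "nodes \<phi> = n" "nodes \<psi> = n"
  shows "tam_perm \<phi> \<sqsubset>\<^bsub>Tam n\<^esub> tam_perm \<psi> \<longleftrightarrow> \<phi> \<preceq> \<psi> \<and> \<phi> \<noteq> \<psi>"
  using assms by (auto simp: lless_def eq_Tam tam_perm_le_iff tam_perm_inject)

definition inversion_counts :: "nat \<Rightarrow> (nat \<Rightarrow> nat) \<Rightarrow> nat list" where
  "inversion_counts n w = map (\<lambda>i. card {j. (Suc i, j) \<in> inversions n w}) [0..<n]"

lemma inversions_row_eq:
  assumes "w \<in> carrier (Tam n)"
  shows "{j. (i, j) \<in> inversions n w} = {i<..i + card {j. (i, j) \<in> inversions n w}}" (is "?J = _")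
proof (cases "?J = {}")
  case False
  have "?J \<subseteq> {i<..n}" by (auto simp: inversions_def)
  hence fin: "finite ?J" by (rule finite_subset) simp
  note max = Max_in[OF fin False]
  have "?J = {i<..Max ?J}"
  proof (intro equalityI subsetI)
    fix j assume "j \<in> {i<..Max ?J}"
    thus "j \<in> ?J"
      using inversions_avoids_312[of w n i "Max ?J" j] assms max
      by (cases "j = Max ?J") (auto simp: carrier_Tam)
  qed (use fin in \<open>auto simp: inversions_def\<close>)
  moreover from this have "card ?J = Max ?J - i" by (metis card_greaterThanAtMost)
  moreover have "i < Max ?J" using max by (auto simp: inversions_def)
  ultimately show ?thesis by simp
qed auto

lemma Suc_mem_inversions_iff:
  assumes "w \<in> carrier (Tam n)" "i < n"
  shows "(Suc i, j) \<in> inversions n w \<longleftrightarrow> Suc i < j \<and> j \<le> Suc i + inversion_counts n w ! i"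
  using inversions_row_eq[OF assms(1), of "Suc i"] assms(2) by (auto simp: inversion_counts_def)

lemma nested_inversion_counts:
  assumes w: "w \<in> carrier (Tam n)"
  shows "nested (inversion_counts n w)"
proof -
  define x where "x = inversion_counts n w"
  have len: "length x = n" by (simp add: x_def inversion_counts_def)
  note inv_iff = Suc_mem_inversions_iff[OF w, folded x_def]
  have "i + x ! i < n \<and> (\<forall>j. i < j \<and> j \<le> i + x ! i \<longrightarrow> j + x ! j \<le> i + x ! i)" if i: "i < n" for i
  proof (intro conjI allI impI)
    show "i + x ! i < n"
      using inv_iff[OF i, of "Suc i + x ! i"] i by (cases "x ! i = 0") (auto simp: inversions_def)
    fix j assume j: "i < j \<and> j \<le> i + x ! i"
    hence ij: "(Suc i, Suc j) \<in> inversions n w" using inv_iff[OF i, of "Suc j"] by auto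
    show "j + x ! j \<le> i + x ! i"
    proof (cases "x ! j = 0")
      case False
      have "j < n" using ij by (auto simp: inversions_def)
      hence "(Suc j, Suc j + x ! j) \<in> inversions n w" using False inv_iff by auto
      hence "(Suc i, Suc j + x ! j) \<in> inversions n w" using ij inversions_trans by blast
      thus ?thesis using inv_iff[OF i] by auto
    qed (use j in auto)
  qed
  thus ?thesis unfolding x_def[symmetric] nested_def len by blast
qed

lemma carrier_Tam_eq: "carrier (Tam n) = tam_perm ` {\<phi>. nodes \<phi> = n}"
proof (intro equalityI subsetI)
  fix w assume w: "w \<in> carrier (Tam n)"
  obtain \<phi> where \<phi>: "brackets \<phi> = inversion_counts n w"
    using nested_imp_brackets[OF nested_inversion_counts[OF w]] by blast
  have n: "nodes \<phi> = n" using arg_cong[OF \<phi>, of length] by (simp add: inversion_counts_def)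
  have "(i, j) \<in> forest_inversions \<phi> \<longleftrightarrow> (i, j) \<in> inversions n w" for i j
    using Suc_mem_inversions_iff[OF w, of "i - 1" j] n \<phi>
    by (cases i) (auto simp: forest_inversions_def inversions_def)
  hence "forest_inversions \<phi> = inversions n w" by auto
  hence "inversions n w = inversions n (tam_perm \<phi>)" using inversions_tam_perm[of \<phi>] n by simp
  hence "w = tam_perm \<phi>"
    using inversions_inject[of w n "tam_perm \<phi>"] w tam_perm_carrier[of \<phi>] n by (auto simp: carrier_Tam)
  thus "w \<in> tam_perm ` {\<phi>. nodes \<phi> = n}" using n by blast
qed (use tam_perm_carrier in blast)

lemma finite_forests: "finite {\<phi>. nodes \<phi> = n}"
proof (rule finite_imageD)
  show "finite (tam_perm ` {\<phi>. nodes \<phi> = n})"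
    using finite_lattice.finite_carrier[OF finite_lattice_Tam, of n] unfolding carrier_Tam_eq .
  show "inj_on tam_perm {\<phi>. nodes \<phi> = n}" using tam_perm_inject unfolding inj_on_def by blast
qed

lemma (in partial_order) lower_covers_eqI:
  assumes carrier: "C \<subseteq> carrier L" "x \<in> carrier L"
    and below: "\<And>c. c \<in> C \<Longrightarrow> c \<sqsubset> x"
    and dominating: "\<And>y. y \<in> carrier L \<Longrightarrow> y \<sqsubset> x \<Longrightarrow> \<exists>c\<in>C. y \<sqsubseteq> c"
    and antichain: "\<And>c d. c \<in> C \<Longrightarrow> d \<in> C \<Longrightarrow> c \<sqsubseteq> d \<Longrightarrow> c = d"
  shows "lower_covers L x = C"
proof (intro equalityI subsetI)
  fix y assume y: "y \<in> lower_covers L x"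
  then obtain c where c: "c \<in> C" "y \<sqsubseteq> c" using dominating by (auto simp: lower_covers_def)
  hence "\<not> y \<sqsubset> c" using y carrier below by (auto simp: lower_covers_def)
  hence "y = c" using c by (auto simp: lless_eq)
  thus "y \<in> C" using c by simp
next
  fix c assume c: "c \<in> C"
  have "\<not> z \<sqsubset> x" if z: "z \<in> carrier L" "c \<sqsubset> z" for z
  proof
    assume "z \<sqsubset> x"
    then obtain d where d: "d \<in> C" "z \<sqsubseteq> d" using dominating z by blast
    have "c \<sqsubseteq> d" using le_trans[of c z d] c d z carrier by (auto simp: lless_eq)
    hence "c = d" using antichain c d by blast
    thus False using z d c carrier le_antisym[of c z] by (auto simp: lless_eq)
  qed
  thus "c \<in> lower_covers L x" using c carrier below by (auto simp: lower_covers_def)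
qed

lemma (in partial_order) inf_eqI: "is_glb L x A \<Longrightarrow> \<Sqinter>A = x"
  unfolding inf_def by (rule some_equality) (auto intro: greatest_unique)

lemma lower_covers_Tam:
  assumes n: "nodes \<phi> = n"
  shows "lower_covers (Tam n) (tam_perm \<phi>) = (\<lambda>a. tam_perm (cut_at \<phi> {a})) ` inner_nodes \<phi>"
proof -
  interpret finite_lattice "Tam n" by (rule finite_lattice_Tam)
  have cut_ne: "cut_at \<phi> {a} \<noteq> \<phi>" if "a \<in> inner_nodes \<phi>" for a
    using cut_at_eq_iff[of "{a}"] that by simp
  show ?thesis
  proof (rule lower_covers_eqI)
    show "tam_perm \<phi> \<in> carrier (Tam n)"
      and "(\<lambda>a. tam_perm (cut_at \<phi> {a})) ` inner_nodes \<phi> \<subseteq> carrier (Tam n)"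
      using n by (auto simp: carrier_Tam_eq)
  next
    fix y assume "y \<in> carrier (Tam n)" "y \<sqsubset>\<^bsub>Tam n\<^esub> tam_perm \<phi>"
    then obtain \<chi> where \<chi>: "nodes \<chi> = n" "y = tam_perm \<chi>" "\<chi> \<preceq> \<phi>" "\<chi> \<noteq> \<phi>"
      using n by (auto simp: carrier_Tam_eq tam_perm_less_iff)
    then obtain a where "a \<in> inner_nodes \<phi>" "\<chi> \<preceq> cut_at \<phi> {a}" using below_some_cut_at by blast
    thus "\<exists>c\<in>(\<lambda>a. tam_perm (cut_at \<phi> {a})) ` inner_nodes \<phi>. y \<sqsubseteq>\<^bsub>Tam n\<^esub> c"
      using \<chi> n by (auto simp: tam_perm_le_iff)
  next
    fix c d assume "c \<in> (\<lambda>a. tam_perm (cut_at \<phi> {a})) ` inner_nodes \<phi>"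
      "d \<in> (\<lambda>a. tam_perm (cut_at \<phi> {a})) ` inner_nodes \<phi>" "c \<sqsubseteq>\<^bsub>Tam n\<^esub> d"
    thus "c = d" using n by (auto simp: tam_perm_le_iff dest: cut_at_single_antichain)
  qed (use n cut_ne in \<open>auto simp: tam_perm_less_iff cut_at_le\<close>)
qed

lemma inf_cut_at_Tam:
  assumes n: "nodes \<phi> = n" and S: "S \<subseteq> inner_nodes \<phi>"
  shows "\<Sqinter>\<^bsub>Tam n\<^esub>({tam_perm \<phi>} \<union> (\<lambda>a. tam_perm (cut_at \<phi> {a})) ` S) = tam_perm (cut_at \<phi> S)"
    (is "\<Sqinter>\<^bsub>Tam n\<^esub>?A = _")
proof -
  interpret finite_lattice "Tam n" by (rule finite_lattice_Tam)
  have lower_iff: "tam_perm \<omega> \<in> Lower (Tam n) ?A \<longleftrightarrow> \<omega> \<preceq> cut_at \<phi> S" if \<omega>: "nodes \<omega> = n" for \<omega>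
  proof -
    have "tam_perm \<omega> \<in> Lower (Tam n) ?A \<longleftrightarrow> \<omega> \<preceq> \<phi> \<and> (\<forall>a\<in>S. \<omega> \<preceq> cut_at \<phi> {a})"
    proof -
      have "?A \<subseteq> carrier (Tam n)" "tam_perm \<omega> \<in> carrier (Tam n)"
        using \<omega> n by (auto simp: carrier_Tam_eq)
      hence "tam_perm \<omega> \<in> Lower (Tam n) ?A \<longleftrightarrow> (\<forall>x\<in>?A. tam_perm \<omega> \<sqsubseteq>\<^bsub>Tam n\<^esub> x)"
        unfolding Lower_def by blast
      thus ?thesis using \<omega> n by (auto simp: tam_perm_le_iff)
    qed
    also have "\<dots> \<longleftrightarrow> \<omega> \<preceq> cut_at \<phi> S"
      using forest_le_cut_at_iff[OF S] forest_le_cut_at_iff[of "{a}" \<phi> for a] S by fastforce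
    finally show ?thesis .
  qed
  have "is_glb (Tam n) (tam_perm (cut_at \<phi> S)) ?A"
    unfolding greatest_def
  proof (intro conjI ballI)
    show "Lower (Tam n) ?A \<subseteq> carrier (Tam n)" by (auto simp: Lower_def)
    show "tam_perm (cut_at \<phi> S) \<in> Lower (Tam n) ?A"
      using lower_iff[of "cut_at \<phi> S"] n by (simp add: forest_le_iff)
    fix v assume v: "v \<in> Lower (Tam n) ?A"
    then obtain \<omega> where "nodes \<omega> = n" "v = tam_perm \<omega>" by (auto simp: Lower_def carrier_Tam_eq)
    thus "v \<sqsubseteq>\<^bsub>Tam n\<^esub> tam_perm (cut_at \<phi> S)" using v lower_iff n by (simp add: tam_perm_le_iff)
  qed
  thus ?thesis by (rule inf_eqI)
qed

lemma nontrivial_Ungar_moves_Tam: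
  assumes n: "nodes \<phi> = n"
  shows "nontrivial_Ungar_moves (Tam n) (tam_perm \<phi>) = tam_perm ` {\<chi>. \<phi> \<leadsto> \<chi> \<and> \<chi> \<noteq> \<phi>}"
proof -
  let ?cover = "\<lambda>a. tam_perm (cut_at \<phi> {a})"
  have "nontrivial_Ungar_moves (Tam n) (tam_perm \<phi>) =
      (\<lambda>S. \<Sqinter>\<^bsub>Tam n\<^esub>({tam_perm \<phi>} \<union> ?cover ` S)) ` {S. S \<subseteq> inner_nodes \<phi> \<and> S \<noteq> {}}"
    unfolding nontrivial_Ungar_moves_def lower_covers_Tam[OF n] subset_image_iff by blast
  also have "\<dots> = (\<lambda>S. tam_perm (cut_at \<phi> S)) ` {S. S \<subseteq> inner_nodes \<phi> \<and> S \<noteq> {}}"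
    using inf_cut_at_Tam[OF n] by (intro image_cong) auto
  also have "\<dots> = tam_perm ` {\<chi>. \<phi> \<leadsto> \<chi> \<and> \<chi> \<noteq> \<phi>}"
  proof -
    have "{\<chi>. \<phi> \<leadsto> \<chi> \<and> \<chi> \<noteq> \<phi>} = cut_at \<phi> ` {S. S \<subseteq> inner_nodes \<phi> \<and> S \<noteq> {}}"
      using cut_at_eq_iff by (auto simp: moves_to_iff_cut_at)
    thus ?thesis by (simp add: image_image)
  qed
  finally show ?thesis .
qed

lemma Eeta_win_Tam:
  assumes "nodes \<phi> = n"
  shows "finite_lattice.Eeta_win (Tam n) (tam_perm \<phi>) \<longleftrightarrow> wins \<phi>"
proof -
  interpret finite_lattice "Tam n" by (rule finite_lattice_Tam)
  have "\<forall>\<phi>. nodes \<phi> = n \<and> w = tam_perm \<phi> \<longrightarrow> Eeta_win w = wins \<phi>" for w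
  proof (induction w rule: Eeta_win.induct)
    case (1 w)
    show ?case
    proof (intro allI impI)
      fix \<phi> assume \<phi>: "nodes \<phi> = n \<and> w = tam_perm \<phi>"
      hence w: "w \<in> carrier (Tam n)" using tam_perm_carrier[of \<phi>] by simp
      have moves: "nontrivial_Ungar_moves (Tam n) w = tam_perm ` {\<chi>. \<phi> \<leadsto> \<chi> \<and> \<chi> \<noteq> \<phi>}"
        using \<phi> nontrivial_Ungar_moves_Tam[of \<phi> n] by simp
      have IH: "Eeta_win (tam_perm \<chi>) = wins \<chi>" if "\<phi> \<leadsto> \<chi>" "\<chi> \<noteq> \<phi>" for \<chi>
        using 1[OF w, of "tam_perm \<chi>"] that \<phi> moves_to_nodes[of \<phi> \<chi>] moves by auto
      have "Eeta_win w \<longleftrightarrow> (\<forall>\<chi>. \<phi> \<leadsto> \<chi> \<and> \<chi> \<noteq> \<phi> \<longrightarrow> \<not> wins \<chi>)"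
        using Eeta_win.simps[of w] w moves IH by auto
      thus "Eeta_win w = wins \<phi>" using wins_iff_no_winning_move[of \<phi>] by simp
    qed
  qed
  thus ?thesis using assms by blast
qed

lemma card_Eeta_wins_Tam:
  "card (finite_lattice.Eeta_wins (Tam n)) = card {\<phi>. nodes \<phi> = n \<and> wins \<phi>}"
proof -
  have "finite_lattice.Eeta_wins (Tam n) = tam_perm ` {\<phi>. nodes \<phi> = n \<and> wins \<phi>}"
    unfolding finite_lattice.Eeta_wins_def[OF finite_lattice_Tam] carrier_Tam_eq
    using Eeta_win_Tam by auto
  moreover have "inj_on tam_perm {\<phi>. nodes \<phi> = n \<and> wins \<phi>}"
    by (intro inj_onI) (auto simp: tam_perm_inject)
  ultimately show ?thesis by (simp add: card_image)
qed

subsection \<open>Generating functions\<close>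

definition gf :: "tree list set \<Rightarrow> 'a :: comm_ring_1 fps" where
  "gf A = Abs_fps (\<lambda>n. of_nat (card {\<phi> \<in> A. nodes \<phi> = n}))"

lemma gf_nth_0: "gf A $ 0 = (if [] \<in> A then 1 else 0)"
proof -
  have "{\<phi> \<in> A. nodes \<phi> = 0} = (if [] \<in> A then {[]} else {})" by auto
  thus ?thesis by (simp add: gf_def del: nodes_eq_0_iff)
qed

lemma gf_Un:
  assumes "A \<inter> B = {}"
  shows "gf (A \<union> B) = gf A + gf B"
proof (rule fps_ext)
  fix n
  let ?A = "{\<phi> \<in> A. nodes \<phi> = n}" and ?B = "{\<phi> \<in> B. nodes \<phi> = n}"
  have "card (?A \<union> ?B) = card ?A + card ?B"
    using assms by (intro card_Un_disjoint finite_subset[OF _ finite_forests[of n]]) auto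
  moreover have "{\<phi> \<in> A \<union> B. nodes \<phi> = n} = ?A \<union> ?B" by blast
  ultimately show "gf (A \<union> B) $ n = (gf A + gf B) $ n" by (simp add: gf_def)
qed

lemma gf_single: "gf {\<phi>} = fps_X ^ nodes \<phi>"
proof (rule fps_ext)
  fix n
  have "{\<psi> \<in> {\<phi>}. nodes \<psi> = n} = (if n = nodes \<phi> then {\<phi>} else {})" by auto
  thus "gf {\<phi>} $ n = (fps_X ^ nodes \<phi>) $ n" by (simp add: gf_def fps_X_power_nth)
qed

lemma card_image_Times_level:
  assumes inj: "inj_on f (A \<times> B)"
    and nodes: "\<And>a b. nodes (f (a, b)) = k + nodes a + nodes b"
  shows "card {\<phi> \<in> f ` (A \<times> B). nodes \<phi> = k + m} =
    (\<Sum>i=0..m. card {\<phi> \<in> A. nodes \<phi> = i} * card {\<phi> \<in> B. nodes \<phi> = m - i})"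
proof -
  let ?A = "\<lambda>i. {\<phi> \<in> A. nodes \<phi> = i}" and ?B = "\<lambda>i. {\<phi> \<in> B. nodes \<phi> = i}"
  have fin: "finite (?A i)" "finite (?B i)" for i
    by (auto intro: finite_subset[OF _ finite_forests[of i]])
  have "{\<phi> \<in> f ` (A \<times> B). nodes \<phi> = k + m} = f ` (\<Union>i\<in>{0..m}. ?A i \<times> ?B (m - i))"
  proof (intro equalityI subsetI)
    fix \<chi> assume "\<chi> \<in> {\<phi> \<in> f ` (A \<times> B). nodes \<phi> = k + m}"
    then obtain a b where ab: "a \<in> A" "b \<in> B" "\<chi> = f (a, b)" "nodes a + nodes b = m"
      using nodes by auto
    hence "nodes a \<in> {0..m}" "nodes b = m - nodes a" by auto
    thus "\<chi> \<in> f ` (\<Union>i\<in>{0..m}. ?A i \<times> ?B (m - i))" using ab by blast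
  qed (use nodes in auto)
  moreover have "inj_on f (\<Union>i\<in>{0..m}. ?A i \<times> ?B (m - i))"
    by (rule inj_on_subset[OF inj]) auto
  ultimately have "card {\<phi> \<in> f ` (A \<times> B). nodes \<phi> = k + m} = card (\<Union>i\<in>{0..m}. ?A i \<times> ?B (m - i))"
    by (simp add: card_image)
  also have "\<dots> = (\<Sum>i=0..m. card (?A i \<times> ?B (m - i)))"
    by (rule card_UN_disjoint) (use fin in auto)
  finally show ?thesis by (simp add: card_cartesian_product)
qed

lemma gf_image_Times:
  assumes inj: "inj_on f (A \<times> B)"
    and nodes: "\<And>a b. nodes (f (a, b)) = k + nodes a + nodes b"
  shows "gf (f ` (A \<times> B)) = fps_X ^ k * (gf A * gf B)"
proof (rule fps_ext)
  fix n
  show "gf (f ` (A \<times> B)) $ n = (fps_X ^ k * (gf A * gf B)) $ n"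
  proof (cases "n < k")
    case True
    hence empty: "{\<phi> \<in> f ` (A \<times> B). nodes \<phi> = n} = {}" using nodes by auto
    show ?thesis using True by (simp only: gf_def fps_nth_Abs_fps empty) (simp add: fps_X_power_mult_nth)
  next
    case False
    then obtain m where n: "n = k + m" by (metis le_iff_add not_less)
    have "gf (f ` (A \<times> B)) $ n = (gf A * gf B) $ m"
      unfolding n by (simp only: gf_def fps_nth_Abs_fps card_image_Times_level[OF assms] fps_mult_nth
          of_nat_sum of_nat_mult)
    thus ?thesis by (simp add: n fps_X_power_mult_nth)
  qed
qed

definition win_trees :: "tree list set" where "win_trees = {[t] | t. win t}"
definition win_forests :: "tree list set" where "win_forests = {\<phi>. wins \<phi>}"
definition odd_win_forests :: "tree list set" where
  "odd_win_forests = {\<phi>. wins \<phi> \<and> odd (length \<phi>)}"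
definition even_win_forests :: "tree list set" where
  "even_win_forests = {\<phi>. wins \<phi> \<and> even (length \<phi>)}"

lemma gf_wins_length:
  "gf {\<phi>. wins \<phi> \<and> P (length \<phi>)} =
     (if P 0 then 1 else 0) + gf win_trees * gf {\<phi>. wins \<phi> \<and> P (Suc (length \<phi>))}"
proof -
  let ?A = "{\<phi>. wins \<phi> \<and> P (Suc (length \<phi>))}" and ?N = "if P 0 then {[]} else {}"
  let ?f = "\<lambda>(\<tau>, \<phi>). \<tau> @ \<phi> :: tree list"
  have "\<phi> \<in> {\<phi>. wins \<phi> \<and> P (length \<phi>)} \<longleftrightarrow> \<phi> \<in> ?N \<union> ?f ` (win_trees \<times> ?A)" for \<phi>
  proof (cases \<phi>)
    case (Cons t \<psi>)
    have "\<phi> \<in> ?f ` (win_trees \<times> ?A) \<longleftrightarrow> win t \<and> \<psi> \<in> ?A"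
      unfolding Cons by (force simp: win_trees_def image_iff)
    thus ?thesis using Cons by auto
  qed (auto simp: win_trees_def)
  hence "{\<phi>. wins \<phi> \<and> P (length \<phi>)} = ?N \<union> ?f ` (win_trees \<times> ?A)" by blast
  hence "gf {\<phi>. wins \<phi> \<and> P (length \<phi>)} = gf (?N \<union> ?f ` (win_trees \<times> ?A))" by (rule arg_cong)
  also have "\<dots> = gf ?N + gf (?f ` (win_trees \<times> ?A))"
    by (rule gf_Un) (auto simp: win_trees_def)
  also have "gf ?N = (if P 0 then 1 else 0)"
    by (simp add: gf_single fps_eq_iff) (simp add: gf_def)
  also have "gf (?f ` (win_trees \<times> ?A)) = gf win_trees * gf ?A"
    by (subst gf_image_Times[where k = 0]) (auto simp: inj_on_def win_trees_def)
  finally show ?thesis .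
qed

lemma gf_win_forests: "gf win_forests = 1 + gf win_trees * gf win_forests"
  using gf_wins_length[of "\<lambda>_. True"] by (simp add: win_forests_def)

lemma gf_even_win_forests: "gf even_win_forests = 1 + gf win_trees * gf odd_win_forests"
  using gf_wins_length[of even] by (simp add: even_win_forests_def odd_win_forests_def)

lemma gf_odd_win_forests: "gf odd_win_forests = gf win_trees * gf even_win_forests"
  using gf_wins_length[of odd] by (simp add: even_win_forests_def odd_win_forests_def)

lemma win_trees_eq:
  "win_trees = {[Node []]} \<union> (\<lambda>(\<phi>, \<psi>). [Node (\<phi> @ [Node \<psi>])]) ` (odd_win_forests \<times> win_forests)"
  (is "_ = _ \<union> ?f ` _" is "_ = ?R")
proof (intro equalityI subsetI)
  fix \<phi> assume "\<phi> \<in> win_trees"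
  then obtain t where t: "\<phi> = [t]" "win t" unfolding win_trees_def by blast
  obtain \<chi> where \<chi>: "t = Node \<chi>" by (cases t)
  show "\<phi> \<in> ?R"
  proof (cases \<chi> rule: rev_cases)
    case (snoc \<omega> s)
    moreover obtain \<psi> where "s = Node \<psi>" by (cases s)
    ultimately have "(\<omega>, \<psi>) \<in> odd_win_forests \<times> win_forests" "\<phi> = ?f (\<omega>, \<psi>)"
      using t \<chi> by (auto simp: win_Node odd_win_forests_def win_forests_def)
    thus ?thesis by blast
  qed (use t \<chi> in auto)
next
  fix \<phi> assume "\<phi> \<in> ?R"
  then consider "\<phi> = [Node []]"
    | \<omega> \<psi> where "\<phi> = [Node (\<omega> @ [Node \<psi>])]" "\<omega> \<in> odd_win_forests" "\<psi> \<in> win_forests"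
    by auto
  thus "\<phi> \<in> win_trees"
    by cases (auto simp: win_trees_def win_Node[of "[]"] win_Node[of "_ @ _"]
        odd_win_forests_def win_forests_def)
qed

lemma gf_win_trees: "gf win_trees = fps_X + fps_X ^ 2 * (gf odd_win_forests * gf win_forests)"
proof -
  let ?f = "\<lambda>(\<phi>, \<psi>). [Node (\<phi> @ [Node \<psi>])]"
  have "gf win_trees = gf ({[Node []]} \<union> ?f ` (odd_win_forests \<times> win_forests))"
    using win_trees_eq by (rule arg_cong)
  also have "\<dots> = gf {[Node []]} + gf (?f ` (odd_win_forests \<times> win_forests))"
    by (rule gf_Un) auto
  also have "gf {[Node []]} = fps_X" by (simp add: gf_single)
  also have "gf (?f ` (odd_win_forests \<times> win_forests))
      = fps_X ^ 2 * (gf odd_win_forests * gf win_forests)"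
    by (rule gf_image_Times) (auto simp: inj_on_def)
  finally show ?thesis .
qed

lemma card_Eeta_wins_Tam_gf:
  "of_nat (card (finite_lattice.Eeta_wins (Tam n))) = gf win_forests $ n"
  by (simp only: card_Eeta_wins_Tam gf_def fps_nth_Abs_fps win_forests_def mem_Collect_eq conj_commute)

lemma Eeta_Tam_gf_eq: "Eeta_Tam_gf = gf win_forests - 1"
  by (rule fps_ext) (simp add: Eeta_Tam_gf_def card_Eeta_wins_Tam_gf gf_nth_0 win_forests_def)

lemma win_system_imp_quartic:
  fixes C D X y :: "'a :: comm_ring_1"
  assumes L: "1 + y = 1 + C * (1 + y)" and D: "D = C * (1 + C * D)"
    and C: "C = X + X\<^sup>2 * (D * (1 + y))"
  shows "X + (- 1 + 3 * X + X\<^sup>2) * y + (- 2 + 2 * X + 3 * X\<^sup>2) * y ^ 2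
    + 3 * X\<^sup>2 * y ^ 3 + X\<^sup>2 * y ^ 4 = 0"
proof -
  note powers = power2_eq_square power3_eq_cube power4_eq_xxxx
  have y: "C * (1 + y) = y" using L by simp
  have "D * (1 + C) = D * (1 + C) * (1 + y - C * (1 + y))" unfolding y by simp
  also have "\<dots> = (D - C * C * D) * (1 + y)" by (simp add: algebra_simps)
  also have "D - C * C * D = C" by (subst (1) D) (simp add: algebra_simps)
  also have "C * (1 + y) = y" by (fact y)
  finally have D_eq: "D * (1 + C) = y" .
  have "(1 + 2 * y) * (y - X * (1 + y)) = (1 + y + C * (1 + y)) * (C * (1 + y) - X * (1 + y))"
    unfolding y by (simp add: algebra_simps)
  also have "\<dots> = (1 + y)^2 * (1 + C) * (C - X)" by (simp add: algebra_simps powers)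
  also have "C - X = X\<^sup>2 * (D * (1 + y))" by (subst (1) C) simp
  also have "(1 + y)^2 * (1 + C) * (X\<^sup>2 * (D * (1 + y))) = X\<^sup>2 * (1 + y) ^ 3 * (D * (1 + C))"
    by (simp add: algebra_simps powers)
  finally have "(1 + 2 * y) * (y - X * (1 + y)) = X\<^sup>2 * (1 + y) ^ 3 * y" unfolding D_eq .
  moreover have "X + (- 1 + 3 * X + X\<^sup>2) * y + (- 2 + 2 * X + 3 * X\<^sup>2) * y ^ 2
    + 3 * X\<^sup>2 * y ^ 3 + X\<^sup>2 * y ^ 4 = X\<^sup>2 * (1 + y) ^ 3 * y - (1 + 2 * y) * (y - X * (1 + y))"
    by (simp add: algebra_simps powers)
  ultimately show ?thesis by simp
qed

lemma gf_win_forests_quartic: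
  fixes y :: "'a :: comm_ring_1 fps"
  assumes y: "y = gf win_forests - 1"
  shows "fps_X + (- 1 + 3 * fps_X + fps_X\<^sup>2) * y + (- 2 + 2 * fps_X + 3 * fps_X\<^sup>2) * y ^ 2
    + 3 * fps_X\<^sup>2 * y ^ 3 + fps_X\<^sup>2 * y ^ 4 = 0"
proof (rule win_system_imp_quartic)
  have eq: "1 + y = gf win_forests" using y by simp
  show "1 + y = 1 + gf win_trees * (1 + y)"
    unfolding eq by (rule gf_win_forests)
  show "gf odd_win_forests = gf win_trees * (1 + gf win_trees * gf odd_win_forests)"
    unfolding gf_even_win_forests[symmetric] by (rule gf_odd_win_forests)
  show "gf win_trees = fps_X + fps_X\<^sup>2 * (gf odd_win_forests * (1 + y))"
    unfolding eq by (rule gf_win_trees)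
qed

lemma annihilates_Q_poly_iff:
  "annihilates Q_poly f \<longleftrightarrow> fps_X + (- 1 + 3 * fps_X + fps_X\<^sup>2) * f
    + (- 2 + 2 * fps_X + 3 * fps_X\<^sup>2) * f ^ 2 + 3 * fps_X\<^sup>2 * f ^ 3 + fps_X\<^sup>2 * f ^ 4 = 0"
proof -
  have c: "fps_const (- 1 :: complex) = - 1" "fps_const (- 2 :: complex) = - 2"
    by (simp_all add: fps_eq_iff fps_numeral_nth)
  have "fps_of_poly [:-1, 3, 1:] = (- 1 + 3 * fps_X + fps_X\<^sup>2 :: complex fps)"
    "fps_of_poly [:-2, 2, 3:] = (- 2 + 2 * fps_X + 3 * fps_X\<^sup>2 :: complex fps)"
    "fps_of_poly [:0, 0, 3:] = (3 * fps_X\<^sup>2 :: complex fps)"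
    "fps_of_poly [:0, 0, 1:] = (fps_X\<^sup>2 :: complex fps)"
    "fps_of_poly [:0, 1:] = (fps_X :: complex fps)"
    by (simp_all add: fps_of_poly_pCons c power2_eq_square distrib_left mult_ac add_ac)
  hence "poly (map_poly fps_of_poly Q_poly) f = fps_X + f * (- 1 + 3 * fps_X + fps_X\<^sup>2
      + f * (- 2 + 2 * fps_X + 3 * fps_X\<^sup>2 + f * (3 * fps_X\<^sup>2 + f * fps_X\<^sup>2)))"
    by (simp only: Q_poly_def map_poly_pCons fps_of_poly_0 map_poly_0 poly_pCons poly_0
        mult_zero_right add_0_right)
  also have "\<dots> = fps_X + (- 1 + 3 * fps_X + fps_X\<^sup>2) * f
    + (- 2 + 2 * fps_X + 3 * fps_X\<^sup>2) * f ^ 2 + 3 * fps_X\<^sup>2 * f ^ 3 + fps_X\<^sup>2 * f ^ 4"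
    by (simp add: algebra_simps power2_eq_square power3_eq_cube power4_eq_xxxx)
  finally show ?thesis by (simp add: annihilates_def)
qed

lemma annihilates_Q_poly: "annihilates Q_poly Eeta_Tam_gf"
  unfolding annihilates_Q_poly_iff by (rule gf_win_forests_quartic[OF Eeta_Tam_gf_eq])

subsection \<open>Algebraic degree\<close>

definition fps_poly_eval :: "'a::comm_ring_1 poly poly \<Rightarrow> 'a fps \<Rightarrow> 'a fps" where
  "fps_poly_eval P f = poly (map_poly fps_of_poly P) f"

lemma fps_poly_eval_0 [simp]: "fps_poly_eval 0 f = 0"
  by (simp add: fps_poly_eval_def)

lemma fps_poly_eval_pCons [simp]:
  "fps_poly_eval (pCons p P) f = fps_of_poly p + f * fps_poly_eval P f"
  by (simp add: fps_poly_eval_def map_poly_pCons)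

lemma fps_poly_eval_add: "fps_poly_eval (P + R) f = fps_poly_eval P f + fps_poly_eval R f"
proof (induction P arbitrary: R)
  case (pCons p P)
  show ?case
  proof (cases R)
    case (pCons q S)
    thus ?thesis
      by (simp add: pCons.IH fps_of_poly_add algebra_simps)
  qed
qed simp

lemma fps_poly_eval_smult: "fps_poly_eval (smult p P) f = fps_of_poly p * fps_poly_eval P f"
  by (induction P) (simp_all add: fps_of_poly_mult algebra_simps)

lemma fps_poly_eval_mult: "fps_poly_eval (P * R) f = fps_poly_eval P f * fps_poly_eval R f"
  by (induction P) (simp_all add: fps_poly_eval_add fps_poly_eval_smult algebra_simps)

lemma annihilates_iff: "annihilates P f \<longleftrightarrow> fps_poly_eval P f = 0"
  by (simp add: annihilates_def fps_poly_eval_def)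

lemma fps_poly_eval_const_coeffs:
  fixes g :: "'a :: idom fps"
  assumes "g $ 0 = 0"
  shows "fps_poly_eval (map_poly (\<lambda>c. [:c:]) p) g = fps_of_poly p oo g"
proof (induction p)
  case (pCons a p)
  thus ?case using assms
    by (simp add: map_poly_pCons fps_of_poly_pCons fps_of_poly_const fps_compose_add_distrib
        fps_compose_mult_distrib mult.commute)
qed simp

text \<open>Interchanging the two variables turns a relation for \<open>f\<close> into one for its compositional
  inverse \<open>g\<close>.\<close>

lemma ex_swapped_relation:
  fixes f g :: "'a :: idom fps"
  assumes g0: "g $ 0 = 0" and fg: "f oo g = fps_X"
  shows "\<exists>M. fps_poly_eval M g = fps_poly_eval P f oo g \<and>
    (\<forall>j. degree (coeff M j) \<le> degree P) \<and> (M = 0 \<longleftrightarrow> P = 0)"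
proof (induction P)
  case 0
  show ?case by (intro exI[of _ 0]) simp
next
  case (pCons p P)
  then obtain M where M: "fps_poly_eval M g = fps_poly_eval P f oo g"
    "\<forall>j. degree (coeff M j) \<le> degree P" "M = 0 \<longleftrightarrow> P = 0" by blast
  define N where "N = map_poly (\<lambda>c. [:c:]) p + smult [:0, 1:] M"
  have N: "coeff N j = pCons (coeff p j) (coeff M j)" for j
    by (simp add: N_def coeff_map_poly)
  have "fps_poly_eval N g = fps_poly_eval (pCons p P) f oo g"
    using M(1) g0 fg
    by (simp add: N_def fps_poly_eval_add fps_poly_eval_smult fps_poly_eval_const_coeffs
        fps_compose_add_distrib fps_compose_mult_distrib)
  moreover have "degree (coeff N j) \<le> degree (pCons p P)" for j
  proof (cases "P = 0")
    case False
    have "degree (coeff N j) \<le> Suc (degree (coeff M j))" unfolding N by (rule degree_pCons_le)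
    thus ?thesis using False M(2)[rule_format, of j] by simp
  qed (use M in \<open>simp add: N\<close>)
  moreover have "N = 0 \<longleftrightarrow> pCons p P = 0"
  proof -
    have "N = 0 \<longleftrightarrow> (\<forall>j. coeff p j = 0 \<and> coeff M j = 0)"
      unfolding poly_eq_iff[of N] N by simp
    also have "\<dots> \<longleftrightarrow> p = 0 \<and> M = 0" by (auto simp: poly_eq_iff)
    finally show ?thesis using M(3) by simp
  qed
  ultimately show ?case by blast
qed

lemma dvd_smult_prime_elem_cancel:
  fixes P M :: "'a :: idom poly"
  assumes p: "prime_elem p" "\<not> [:p:] dvd P" and dvd: "P dvd smult p M"
  shows "P dvd M"
proof -
  have "p \<noteq> 0" using p by auto
  obtain R where R: "smult p M = P * R" using dvd by (elim dvdE)
  have "[:p:] dvd P * R" by (rule dvdI[of _ _ M]) (simp flip: R)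
  hence "[:p:] dvd R" using lift_prime_elem_poly[OF p(1)] p(2) prime_elem_dvd_multD by blast
  then obtain S where "R = smult p S" by (auto elim: dvdE)
  hence "smult p M = smult p (P * S)" using R by simp
  thus ?thesis using \<open>p \<noteq> 0\<close> by (metis smult_cancel dvd_triv_left)
qed

lemma dvd_smult_cancel_no_common_root:
  fixes P M :: "'a :: alg_closed_field poly poly"
  assumes "c \<noteq> 0" and no_common_root: "\<forall>a. \<exists>i. poly (coeff P i) a \<noteq> 0" and "P dvd smult c M"
  shows "P dvd M"
  using assms(1,3)
proof (induction "degree c" arbitrary: c)
  case 0
  then obtain d where "c = [:d:]" "d \<noteq> 0" by (metis degree_eq_zeroE pCons_0_0)
  hence "M = smult [:inverse d:] (smult c M)" by (simp flip: one_pCons)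
  thus ?case using 0 by (metis dvd_smult)
next
  case (Suc n)
  then obtain a where "poly c a = 0" using alg_closed_imp_poly_has_root[of c] by auto
  then obtain d where c: "c = [:- a, 1:] * d" by (auto simp: poly_eq_0_iff_dvd elim: dvdE)
  hence "d \<noteq> 0" using Suc.prems(1) by auto
  have "degree ([:- a, 1:] * d) = Suc (degree d)" using \<open>d \<noteq> 0\<close> by (subst degree_mult_eq) auto
  hence "degree d = n" using Suc.hyps(2) by (simp only: c[symmetric])
  have "prime_elem [:- a, 1:]" by (rule prime_elem_linear_field_poly) simp
  moreover have "\<not> [:[:- a, 1:]:] dvd P"
    using no_common_root by (auto simp: const_poly_dvd_iff poly_eq_0_iff_dvd)
  moreover have "P dvd smult [:- a, 1:] (smult d M)" using Suc.prems(2) by (simp add: c)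
  ultimately have "P dvd smult d M" by (rule dvd_smult_prime_elem_cancel)
  thus ?case using Suc.hyps(1)[of d] \<open>d \<noteq> 0\<close> \<open>degree d = n\<close> by simp
qed

text \<open>Pseudo-division leaves a relation of smaller degree, hence zero.\<close>

lemma minimal_relation_dvd:
  fixes g :: "'a :: alg_closed_field fps"
  assumes no_common_root: "\<forall>a. \<exists>i. poly (coeff P i) a \<noteq> 0" and P: "fps_poly_eval P g = 0"
    and minimal: "\<And>R. fps_poly_eval R g = 0 \<Longrightarrow> degree R < degree P \<Longrightarrow> R = 0"
    and M: "fps_poly_eval M g = 0"
  shows "P dvd M"
proof -
  have "P \<noteq> 0" using no_common_root by auto
  obtain q r where qr: "pseudo_divmod M P = (q, r)" by (cases "pseudo_divmod M P")
  define c where "c = coeff P (degree P) ^ (Suc (degree M) - degree P)"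
  have eq: "smult c M = P * q + r" and r: "r = 0 \<or> degree r < degree P"
    using pseudo_divmod[OF \<open>P \<noteq> 0\<close> qr] by (auto simp: c_def)
  have "fps_poly_eval r g = 0"
    using arg_cong[OF eq, of "\<lambda>p. fps_poly_eval p g"] P M
    by (simp add: fps_poly_eval_add fps_poly_eval_smult fps_poly_eval_mult)
  hence "r = 0" using r minimal by blast
  hence "P dvd smult c M" using eq by simp
  moreover have "c \<noteq> 0" using \<open>P \<noteq> 0\<close> by (simp add: c_def)
  ultimately show ?thesis using dvd_smult_cancel_no_common_root no_common_root by blast
qed

lemma coeff_mult_at_degree_bounds:
  assumes "degree p \<le> d" "degree q \<le> e"
  shows "coeff (p * q) (d + e) = coeff p d * coeff q e"
proof -
  have "coeff p i * coeff q (d + e - i) = 0" if "i \<noteq> d" "i \<le> d + e" for i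
    using that assms by (cases "i < d") (auto simp: coeff_eq_0)
  hence "coeff (p * q) (d + e) = (\<Sum>i\<in>{d}. coeff p i * coeff q (d + e - i))"
    unfolding coeff_mult by (intro sum.mono_neutral_right) auto
  thus ?thesis by simp
qed

lemma ex_top_inner_coeff:
  fixes P :: "'a :: zero poly poly"
  assumes "P \<noteq> 0"
  obtains d where "\<And>i. degree (coeff P i) \<le> d" "map_poly (\<lambda>p. coeff p d) P \<noteq> 0"
proof -
  define d where "d = Max ((\<lambda>i. degree (coeff P i)) ` {i. i \<le> degree P \<and> coeff P i \<noteq> 0})"
  let ?I = "{i. i \<le> degree P \<and> coeff P i \<noteq> 0}"
  have "degree P \<in> ?I" using assms by simp
  hence ne: "(\<lambda>i. degree (coeff P i)) ` ?I \<noteq> {}" by blast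
  have le: "degree (coeff P i) \<le> d" for i
  proof (cases "i \<in> ?I")
    case False
    hence "coeff P i = 0" using coeff_eq_0[of P i] by auto
    thus ?thesis by simp
  qed (auto simp: d_def)
  obtain i where i: "i \<in> ?I" "degree (coeff P i) = d"
    using Max_in[OF _ ne] unfolding d_def[symmetric] by auto
  have "coeff (map_poly (\<lambda>p. coeff p d) P) i \<noteq> 0" using i by (auto simp: coeff_map_poly)
  hence "map_poly (\<lambda>p. coeff p d) P \<noteq> 0" by auto
  thus ?thesis using le that by blast
qed

text \<open>Degrees in the inner variable add up, so they cannot drop under multiplication.\<close>

lemma ex_degree_coeff_mult_ge:
  fixes P N :: "'a :: idom poly poly"
  assumes "P * N \<noteq> 0"
  shows "\<exists>j. degree (coeff P i) \<le> degree (coeff (P * N) j)"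
proof -
  obtain d where d: "\<And>i. degree (coeff P i) \<le> d" "map_poly (\<lambda>p. coeff p d) P \<noteq> 0"
    using ex_top_inner_coeff[of P] assms by auto
  obtain e where e: "\<And>i. degree (coeff N i) \<le> e" "map_poly (\<lambda>p. coeff p e) N \<noteq> 0"
    using ex_top_inner_coeff[of N] assms by auto
  let ?top = "map_poly (\<lambda>p. coeff p d) P * map_poly (\<lambda>p. coeff p e) N"
  have "?top \<noteq> 0" using d(2) e(2) by simp
  then obtain j where j: "coeff ?top j \<noteq> 0" by (auto simp: poly_eq_iff)
  have "coeff ?top j = (\<Sum>i\<le>j. coeff (coeff P i) d * coeff (coeff N (j - i)) e)"
    by (simp add: coeff_mult coeff_map_poly)
  also have "\<dots> = (\<Sum>i\<le>j. coeff (coeff P i * coeff N (j - i)) (d + e))"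
    using coeff_mult_at_degree_bounds[OF d(1) e(1)] by simp
  also have "\<dots> = coeff (coeff (P * N) j) (d + e)" by (simp only: coeff_mult[of P N] coeff_sum)
  finally have "coeff ?top j = coeff (coeff (P * N) j) (d + e)" .
  hence "d + e \<le> degree (coeff (P * N) j)" using j by (intro le_degree) simp
  hence "degree (coeff P i) \<le> degree (coeff (P * N) j)" using d(1)[of i] by linarith
  thus ?thesis by blast
qed

lemma square_eq_square_mult_simple_root_imp_0:
  fixes q u d :: "'a :: idom poly"
  assumes eq: "q\<^sup>2 = u\<^sup>2 * ([:- a, 1:] * d)" and d: "poly d a \<noteq> 0"
  shows "u = 0"
proof (rule ccontr)
  assume u: "u \<noteq> 0"
  have "d \<noteq> 0" using d by auto
  hence lin: "[:- a, 1:] * d \<noteq> 0" using no_zero_divisors[of "[:- a, 1:]" d] by simp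
  hence prod: "(u * u) * ([:- a, 1:] * d) \<noteq> 0" using u no_zero_divisors by blast
  hence q: "q * q \<noteq> 0" using eq by (simp add: power2_eq_square)
  have "order a (q * q) = order a (u * u) + (order a [:- a, 1:] + order a d)"
    using eq order_mult[OF prod] order_mult[OF lin] by (simp add: power2_eq_square)
  also have "order a [:- a, 1:] = 1" using order_power_n_n[of a 1] by simp
  also have "order a d = 0" using d by (simp add: order_root)
  finally have "2 * order a q = 2 * order a u + 1"
    using u q order_mult[OF q] order_mult[of u u a] by simp
  thus False by presburger
qed

lemma quadratic_linear_relations_discriminant:
  fixes g :: "'a :: idom fps"
  assumes quadratic: "fps_poly_eval [:C, B, A:] g = 0" and linear: "fps_poly_eval [:v, u:] g = 0"
  shows "(2 * A * v - B * u)\<^sup>2 = u\<^sup>2 * (B\<^sup>2 - 4 * A * C)"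
proof -
  let ?A = "fps_of_poly A" and ?B = "fps_of_poly B" and ?C = "fps_of_poly C"
  let ?u = "fps_of_poly u" and ?v = "fps_of_poly v"
  have v: "?v = - (?u * g)" using linear by (simp add: eq_neg_iff_add_eq_0 mult.commute)
  have "(2 * ?A * ?v - ?B * ?u)\<^sup>2 - ?u\<^sup>2 * (?B\<^sup>2 - 4 * ?A * ?C) =
      4 * ?A * ?u\<^sup>2 * fps_poly_eval [:C, B, A:] g"
    unfolding v by (simp add: power2_eq_square algebra_simps)
  hence "(2 * ?A * ?v - ?B * ?u)\<^sup>2 = ?u\<^sup>2 * (?B\<^sup>2 - 4 * ?A * ?C)" using quadratic by simp
  hence "fps_of_poly ((2 * A * v - B * u)\<^sup>2) = fps_of_poly (u\<^sup>2 * (B\<^sup>2 - 4 * A * C))"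
    by (simp add: fps_of_poly_mult fps_of_poly_diff fps_of_poly_power)
  thus ?thesis by (simp only: fps_of_poly_eq_iff)
qed

definition Q_lead :: "complex poly" where "Q_lead = [:0, 1:] * [:1, 1:] ^ 3"
definition Q_mid :: "complex poly" where "Q_mid = [:1, 1:] * [:1, 2:]"
definition Q_const :: "complex poly" where "Q_const = - ([:0, 1:] * [:1, 2:])"

definition Q_swapped :: "complex poly poly" where "Q_swapped = [:Q_const, Q_mid, Q_lead:]"

lemma degree_Q_swapped: "degree Q_swapped = 2"
  by (simp add: Q_swapped_def Q_lead_def)

lemma Q_swapped_no_common_root: "\<forall>a. \<exists>i. poly (coeff Q_swapped i) a \<noteq> 0"
proof (rule ccontr)
  assume "\<not> ?thesis"
  then obtain a where "poly (coeff Q_swapped i) a = 0" for i by blast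
  from this[of 0] this[of 1] this[of 2]
  have "poly Q_const a = 0" "poly Q_mid a = 0" "poly Q_lead a = 0"
    by (simp_all add: Q_swapped_def numeral_2_eq_2)
  hence "poly ([:1, 14, 20, 8:] * (Q_const + Q_mid) - [:16:] * Q_lead) a = 0"
    by (simp only: poly_diff poly_mult poly_add) simp
  also have "[:1, 14, 20, 8:] * (Q_const + Q_mid) - [:16:] * Q_lead = 1"
    by (simp add: Q_const_def Q_mid_def Q_lead_def power3_eq_cube one_pCons)
  finally show False by simp
qed

lemma discriminant_Q_swapped:
  "Q_mid\<^sup>2 - 4 * Q_lead * Q_const =
     [:- (- 1/2), 1:] * ([:1, 1:]\<^sup>2 * ([:2:] * [:1, 2, 4, 4 :: complex:]))"
  by (simp add: Q_mid_def Q_lead_def Q_const_def power2_eq_square power3_eq_cube numeral_poly)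

lemma Q_swapped_minimal:
  assumes g: "fps_poly_eval Q_swapped g = 0" and R: "fps_poly_eval R g = 0" and "degree R < 2"
  shows "R = 0"
proof -
  have "R = [:coeff R 0, coeff R 1:]"
    using assms(3) by (intro poly_eqI) (auto simp: coeff_pCons coeff_eq_0 split: nat.splits)
  then obtain u v where vu: "R = [:v, u:]" by blast
  let ?d = "[:1, 1:]\<^sup>2 * ([:2:] * [:1, 2, 4, 4 :: complex:])"
  have "u = 0"
  proof (rule square_eq_square_mult_simple_root_imp_0)
    show "(2 * Q_lead * v - Q_mid * u)\<^sup>2 = u\<^sup>2 * ([:- (- 1/2), 1:] * ?d)"
      unfolding discriminant_Q_swapped[symmetric]
      by (rule quadratic_linear_relations_discriminant)
        (use g R in \<open>simp_all only: Q_swapped_def vu\<close>)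
    show "poly ?d (- 1/2) \<noteq> 0" by simp
  qed
  moreover from this have "v = 0" using R vu fps_of_poly_eq_iff[of v 0] by simp
  ultimately show ?thesis using vu by simp
qed

lemma Q_swapped_annihilates_inverse:
  assumes g0: "g $ 0 = 0" and fg: "f oo g = fps_X" and f: "annihilates Q_poly f"
  shows "fps_poly_eval Q_swapped g = 0"
proof -
  let ?Q = "\<lambda>y z. z + (- 1 + 3 * z + z\<^sup>2) * y + (- 2 + 2 * z + 3 * z\<^sup>2) * y ^ 2
    + 3 * z\<^sup>2 * y ^ 3 + z\<^sup>2 * y ^ 4 :: complex fps"
  have num: "numeral k oo g = (numeral k :: complex fps)" for k
    by (metis fps_const_compose numeral_fps_const)
  have "?Q f fps_X oo g = 0" using f by (simp add: annihilates_Q_poly_iff)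
  hence Q: "?Q fps_X g = 0"
    by (simp add: fps_compose_add_distrib fps_compose_mult_distrib[OF g0]
        fps_compose_power[OF g0, symmetric] fps_compose_sub_distrib fps_compose_uminus g0 fg num)
  have "fps_of_poly [:1, 1 :: complex:] = 1 + fps_X" "fps_of_poly [:1, 2 :: complex:] = 1 + 2 * fps_X"
    by (simp_all add: fps_of_poly_pCons)
  hence "fps_poly_eval Q_swapped g = - (fps_X * (1 + 2 * fps_X)) + g * ((1 + fps_X) * (1 + 2 * fps_X)
      + g * (fps_X * (1 + fps_X) ^ 3))"
    by (simp only: Q_swapped_def Q_lead_def Q_mid_def Q_const_def fps_poly_eval_pCons fps_poly_eval_0
        fps_of_poly_mult fps_of_poly_power fps_of_poly_uminus fps_of_poly_fps_X mult_zero_right add_0_right)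
  also have "\<dots> = ?Q fps_X g"
    by (simp add: power2_eq_square power3_eq_cube power4_eq_xxxx algebra_simps)
  finally show ?thesis using Q by simp
qed

lemma algebraic_of_degree_4:
  assumes f0: "f $ 0 = 0" and f: "annihilates Q_poly f"
  shows "algebraic_of_degree f 4"
proof -
  have f1: "f $ 1 \<noteq> 0"
    using arg_cong[OF f[unfolded annihilates_Q_poly_iff], of "\<lambda>h. h $ 1"] f0
    by (simp add: fps_mult_nth power2_eq_square power3_eq_cube power4_eq_xxxx fps_numeral_nth)
  define g where "g = fps_inv f"
  have g0: "g $ 0 = 0" by (simp add: g_def fps_inv_def)
  have fg: "f oo g = fps_X" unfolding g_def using fps_inv_right[OF f0 f1] .
  have g: "fps_poly_eval Q_swapped g = 0" using g0 fg f by (rule Q_swapped_annihilates_inverse)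
  have "4 \<le> degree P" if P: "P \<noteq> 0" "annihilates P f" for P
  proof -
    obtain M where M: "fps_poly_eval M g = fps_poly_eval P f oo g"
        "\<forall>j. degree (coeff M j) \<le> degree P" "M \<noteq> 0"
      using ex_swapped_relation[OF g0 fg, of P] P(1) by blast
    have "fps_poly_eval M g = 0" using M P by (simp add: annihilates_iff)
    hence "Q_swapped dvd M"
      using Q_swapped_minimal[OF g] degree_Q_swapped
      by (intro minimal_relation_dvd[OF Q_swapped_no_common_root g]) auto
    then obtain N where "M = Q_swapped * N" by (elim dvdE)
    then obtain j where "degree (coeff Q_swapped 2) \<le> degree (coeff M j)"
      using ex_degree_coeff_mult_ge[of Q_swapped N 2] M(3) by blast
    moreover have "degree (coeff Q_swapped 2) = 4"
      by (simp add: Q_swapped_def Q_lead_def numeral_2_eq_2 degree_mult_eq degree_power_eq)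
    ultimately show ?thesis using M(2) le_trans by metis
  qed
  moreover have "degree Q_poly = 4" "Q_poly \<noteq> 0" by (simp_all add: Q_poly_def)
  ultimately show ?thesis using f unfolding algebraic_of_degree_def by blast
qed

subsection \<open>The critical point\<close>

text \<open>Eliminating \<open>r\<close> from \<open>\<kappa> = r + r\<^sup>2 K(\<kappa>)\<close> and \<open>1 = r\<^sup>2 K'(\<kappa>)\<close>, where
  \<open>K(c) = c / ((1 - c)\<^sup>2 (1 + c))\<close>, leaves this equation for \<open>\<kappa>\<close>.\<close>

definition critical_poly :: "real \<Rightarrow> real" where
  "critical_poly k = 2*k^7 + 8*k^6 + 2*k^5 + 2*k^4 + 2*k^3 + k^2 - 1"

lemma ex_critical_poly_root: "\<exists>k. 0.52700329 < k \<and> k < 0.52700330 \<and> critical_poly k = 0"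
proof -
  let ?a = "0.52700329 :: real" and ?b = "0.52700330 :: real"
  have ab: "critical_poly ?a < 0" "0 < critical_poly ?b"
    by (simp_all add: critical_poly_def power_divide)
  have "\<exists>x\<ge>?a. x \<le> ?b \<and> critical_poly x = 0"
    by (rule IVT') (use ab in \<open>auto simp: critical_poly_def intro!: continuous_intros\<close>)
  then obtain x where x: "?a \<le> x" "x \<le> ?b" "critical_poly x = 0" by blast
  moreover have "x \<noteq> ?a" "x \<noteq> ?b" using x(3) ab less_irrefl by metis+
  ultimately show ?thesis by (intro exI[of _ x]) auto
qed

definition growth_poly :: "real \<Rightarrow> real" where
  "growth_poly x = 32*x^7 - 32*x^6 - 155*x^5 - 20*x^4 - 148*x^3 + 60*x^2 - 8*x - 4"

lemma homogenized_growth_poly: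
  assumes "d \<noteq> 0"
  shows "d^7 * growth_poly (a / d) = 32*a^7 - 32*a^6*d - 155*a^5*d^2 - 20*a^4*d^3 - 148*a^3*d^4
    + 60*a^2*d^5 - 8*a*d^6 - 4*d^7"
proof -
  define x where "x = a / d"
  have "a = x * d" using assms by (simp add: x_def)
  thus ?thesis unfolding x_def[symmetric] growth_poly_def by algebra
qed

lemma critical_poly_dvd_growth_poly:
  fixes k :: real
  assumes "k^2*(1 + 3*k) \<noteq> 0"
  shows "(k^2*(1 + 3*k))^7 * growth_poly ((1 + k + 2*k^2) / (k^2*(1 + 3*k)))
    = critical_poly k * (-32 - 224*k - 1120*k^2 - 3808*k^3 - 10565*k^4 - 22775*k^5 - 40824*k^6
      - 57040*k^7 - 64005*k^8 - 50805*k^9 - 27324*k^10 - 3078*k^11 + 2916*k^12 + 1458*k^13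
      - 4374*k^14)"
  unfolding homogenized_growth_poly[OF assms] critical_poly_def by algebra

text \<open>Multiplied by \<open>25x\<^sup>2 + 10x + 3\<close>, the polynomial has a single sign change.\<close>

lemma growth_poly_root_unique:
  assumes x: "0 < x" "growth_poly x = 0" and y: "0 < y" "growth_poly y = 0"
  shows "x = y"
proof -
  define S where "S t = 480*t + 4099*t^2 + 2146*t^3 + 4365*t^4 + 40*t^5 + 44*t^6 + 64*t^8 + 12*t^9"
    for t :: real
  have mono: "S t < S u" if "0 \<le> t" "t < u" for t u
    unfolding S_def using that
    by (intro add_strict_mono mult_strict_left_mono power_strict_mono) auto
  have S: "S (inverse a) = 800" if a: "0 < a" "growth_poly a = 0" for a
  proof -
    have "growth_poly a * (25*a^2 + 10*a + 3) = 800*a^9 - (480*a^8 + 4099*a^7 + 2146*a^6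
        + 4365*a^5 + 40*a^4 + 44*a^3 + 64*a + 12)"
      unfolding growth_poly_def by algebra
    moreover have "a^9 * S (inverse a) = 480*a^8 + 4099*a^7 + 2146*a^6
        + 4365*a^5 + 40*a^4 + 44*a^3 + 64*a + 12"
      using a(1) by (simp add: S_def field_simps power_numeral_reduce)
    ultimately have "a^9 * S (inverse a) = a^9 * 800" using a(2) by simp
    thus ?thesis using a(1) by simp
  qed
  have "inverse x = inverse y"
    using S[OF x] S[OF y] mono[of "inverse x" "inverse y"] mono[of "inverse y" "inverse x"] x(1) y(1)
    by (cases "inverse x" "inverse y" rule: linorder_cases) auto
  thus ?thesis by simp
qed

text \<open>The square of \<open>\<gamma>\<close> is a rational function of \<open>\<kappa>\<close>; this is its reduction modulo
  \<open>critical_poly\<close>, whose positive coefficients make it monotone.\<close>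

definition gamma_sq :: "real \<Rightarrow> real" where
  "gamma_sq k = (518517 + 1126001*k + 1662664*k^2 + 1976382*k^3 + 2389564*k^4 + 2623010*k^5
     + 555282*k^6) / 1993216"

lemma gamma_sq_mult_eq:
  assumes "critical_poly k = 0"
  shows "gamma_sq k * (4*(1 - k)^5*(1 + k + 2*k^2)*(1 + 5*k + 3*k^2 + 3*k^3))
    = k^2*(1 + 3*k)*(1 + 5*k^4 + 2*k^5)"
proof -
  have "gamma_sq k * (4*(1 - k)^5*(1 + k + 2*k^2)*(1 + 5*k + 3*k^2 + 3*k^3))
      - k^2*(1 + 3*k)*(1 + 5*k^4 + 2*k^5) = critical_poly k * ((-518517 - 1644518*k + 2376292*k^2
        - 1861948*k^3 + 5776342*k^4 - 9936636*k^5 + 6920780*k^6 - 5067372*k^7 + 4624815*k^8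
        - 1665846*k^9) / 498304)"
    unfolding gamma_sq_def critical_poly_def by (simp add: field_simps) algebra
  thus ?thesis using assms by simp
qed

lemma eqI_mod_critical_poly:
  assumes "critical_poly k = 0" "p - q = critical_poly k * s"
  shows "p = q"
  using assms by simp

text \<open>The equation for \<open>\<gamma>\<^sup>2\<close> is checked by Horner's scheme, reducing modulo \<open>critical_poly\<close> after
  each step.\<close>

lemma gamma_sq_leading_Horner_steps:
  assumes root: "critical_poly k = 0"
  defines "G \<equiv> gamma_sq k"
  shows "((17348952064*G - 11927404544)*G - 6678731520)*G - 886278144 =
    -463572864 + 445054464*k + 412806400*k^2 + 330036352*k^3 + 262593536*k^4 + 1677510656*k^5
      + 428867072*k^6"
proof -
  define A6 where "A6 = -7414232576 + 9800712704*k + 14471827456*k^2 + 17202428928*k^3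
      + 20798765056*k^4 + 22830679040*k^5 + 4833174528*k^6"
  define A5 where "A5 = -4062835200 + 3973137920*k + 4499620352*k^2 + 4246573056*k^3
      + 5456282624*k^4 + 11411680768*k^5 + 2691778560*k^6"
  define A4 where "A4 = -463572864 + 445054464*k + 412806400*k^2 + 330036352*k^3 + 262593536*k^4
      + 1677510656*k^5 + 428867072*k^6"
  note defs = G_def gamma_sq_def critical_poly_def A6_def A5_def A4_def
  have horner6: "17348952064 * G - 11927404544 = A6" unfolding defs by (simp add: field_simps)
  have horner5: "A6 * G - 6678731520 = A5"
    by (rule eqI_mod_critical_poly[OF root, where s =
        "(1040722889703 + 1285146968982*k + 1357426934838*k^2
        + 1253467398248*k^3 + 839834039772*k^4 + 154169049762*k^5) / 229"])
      (unfold defs, simp add: field_simps, algebra)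
  have horner4: "A5 * G - 886278144 = A4"
    by (rule eqI_mod_critical_poly[OF root, where s =
        "(5760140716365 + 6643958245482*k + 7266107960973*k^2
        + 8033492357441*k^3 + 7244607686979*k^4 + 1459664240580*k^5) / 3893"])
      (unfold defs, simp add: field_simps, algebra)
  show ?thesis unfolding horner6 horner5 horner4 unfolding A4_def ..
qed

lemma gamma_sq_root:
  assumes root: "critical_poly k = 0"
  defines "G \<equiv> gamma_sq k"
  shows "17348952064*G^7 - 11927404544*G^6 - 6678731520*G^5 - 886278144*G^4 - 33824320*G^3
    - 516144*G^2 + 4048*G + 11 = 0"
proof -
  define A4 where "A4 = ((17348952064*G - 11927404544)*G - 6678731520)*G - 886278144"
  note A4_eq = A4_def[unfolded G_def gamma_sq_leading_Horner_steps[OF root]]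
  define A3 where "A3 = -13363360 + 10042272*k + 10991232*k^2 + 22476864*k^3 - 12791680*k^4
      + 68243392*k^5 + 19264896*k^6"
  define A2 where "A2 = -113744 + 198016*k - 228320*k^2 + 484160*k^3 - 369264*k^4 + 559712*k^5
      + 183552*k^6"
  define A1 where "A1 = -190 + 390*k - 548*k^2 + 956*k^3 - 744*k^4 + 916*k^5 + 316*k^6"
  note defs = G_def gamma_sq_def critical_poly_def A4_eq A3_def A2_def A1_def
  have horner3: "A4 * G - 33824320 = A3"
    by (rule eqI_mod_critical_poly[OF root, where s =
        "(2196511902891 + 2431497032451*k + 2801940841989*k^2
        + 3582898927172*k^3 + 4311896205916*k^4 + 930242833884*k^5) / 15572"])
      (unfold defs, simp add: field_simps, algebra)
  have horner2: "A3 * G - 516144 = A2"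
    by (rule eqI_mod_critical_poly[OF root, where s =
        "(241599982985 + 319836144756*k + 390254281632*k^2
        + 385799897462*k^3 + 713070970794*k^4 + 167147655948*k^5) / 62288"])
      (unfold defs, simp add: field_simps, algebra)
  have horner1: "A2 * G + 4048 = A1"
    by (rule eqI_mod_critical_poly[OF root, where s =
        "(3158184265 + 1636159357*k + 8373644207*k^2
        + 1922302367*k^3 + 12017632614*k^4 + 3185097552*k^5) / 124576"])
      (unfold defs, simp add: field_simps, algebra)
  have horner0: "A1 * G + 11 = 0"
    by (rule eqI_mod_critical_poly[OF root, where s =
        "(38296427 + 5859280*k + 118752970*k^2 + 6662092*k^3
        + 158908256*k^4 + 43867278*k^5) / 996608"])
      (unfold defs, simp add: field_simps, algebra)
  have "17348952064*G^7 - 11927404544*G^6 - 6678731520*G^5 - 886278144*G^4 - 33824320*G^3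
      - 516144*G^2 + 4048*G + 11 = (((A4*G - 33824320)*G - 516144)*G + 4048)*G + 11"
    unfolding A4_def by algebra
  also have "\<dots> = 0" unfolding horner3 horner2 horner1 horner0 ..
  finally show ?thesis .
qed

lemma gamma_sq_bounds:
  assumes "0.52700329 < k" "k < 0.52700330"
  shows "1.042395^2 < gamma_sq k" "gamma_sq k < 1.042405^2"
proof -
  have mono: "gamma_sq x \<le> gamma_sq y" if "0 \<le> x" "x \<le> y" for x y
    unfolding gamma_sq_def using that
    by (intro divide_right_mono add_mono mult_left_mono power_mono) auto
  have "1.042395^2 < gamma_sq 0.52700329"
    by (simp add: gamma_sq_def power_divide)
  also have "\<dots> \<le> gamma_sq k" using assms by (intro mono) auto
  finally show "1.042395^2 < gamma_sq k" .
  have "gamma_sq k \<le> gamma_sq 0.52700330" using assms by (intro mono) auto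
  also have "\<dots> < 1.042405^2" by (simp add: gamma_sq_def power_divide)
  finally show "gamma_sq k < 1.042405^2" .
qed

locale critical_point =
  fixes \<kappa> :: real
  assumes \<kappa>: "0 < \<kappa>" "\<kappa> < 1" and root: "critical_poly \<kappa> = 0"
begin

definition r :: real where "r = \<kappa>^2 * (1 + 3 * \<kappa>) / (1 + \<kappa> + 2 * \<kappa>^2)"

lemma r_denominator_pos: "0 < 1 + \<kappa> + 2 * \<kappa>^2"
  using \<kappa> by (simp add: add_pos_nonneg)

lemma r_mult_denominator: "r * (1 + \<kappa> + 2 * \<kappa>^2) = \<kappa>^2 * (1 + 3 * \<kappa>)"
  using r_denominator_pos by (simp add: r_def)

lemma r_pos: "0 < r"
  using \<kappa> r_denominator_pos by (simp add: r_def)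

lemma critical_derivative: "r^2 * (1 + \<kappa> + 2 * \<kappa>^2) = (1 - \<kappa>) ^ 3 * (1 + \<kappa>)^2"
proof -
  define b where "b = 1 + \<kappa> + 2 * \<kappa>^2"
  have "b * (r^2 * b) = (r * b)^2" by (simp add: power2_eq_square)
  also have "\<dots> = \<kappa> ^ 4 * (1 + 3 * \<kappa>)^2" unfolding r_mult_denominator[folded b_def] by algebra
  also have "\<dots> = b * ((1 - \<kappa>) ^ 3 * (1 + \<kappa>)^2) + critical_poly \<kappa>"
    unfolding b_def critical_poly_def by algebra
  finally show ?thesis using r_denominator_pos root by (simp add: b_def)
qed

lemma critical_value: "(\<kappa> - r) * ((1 - \<kappa>)^2 * (1 + \<kappa>)) = r^2 * \<kappa>"
proof -
  define b where "b = 1 + \<kappa> + 2 * \<kappa>^2"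
  have "b * ((\<kappa> - r) * ((1 - \<kappa>)^2 * (1 + \<kappa>))) = (\<kappa> * b - r * b) * ((1 - \<kappa>)^2 * (1 + \<kappa>))"
    by algebra
  also have "\<dots> = \<kappa> * ((1 - \<kappa>) ^ 3 * (1 + \<kappa>)^2)"
    unfolding r_mult_denominator[folded b_def] unfolding b_def by algebra
  also have "\<dots> = b * (r^2 * \<kappa>)" unfolding critical_derivative[symmetric] b_def by simp
  finally show ?thesis using r_denominator_pos by (simp add: b_def)
qed

lemma growth_poly_inverse_r: "growth_poly (1 / r) = 0"
proof -
  have "\<kappa>^2 * (1 + 3 * \<kappa>) \<noteq> 0" using \<kappa> by auto
  thus ?thesis using critical_poly_dvd_growth_poly[of \<kappa>] root by (simp add: r_def)
qed

lemma growth_poly_root_iff: "0 < x \<and> growth_poly x = 0 \<longleftrightarrow> x = 1 / r"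
  using growth_poly_root_unique[of x "1 / r"] growth_poly_inverse_r r_pos by auto

lemma inverse_r_bounds:
  assumes "0.52700329 < \<kappa>" "\<kappa> < 0.52700330"
  shows "\<bar>1 / r - 2.90511\<bar> < 0.000005"
proof -
  have pos: "0 < \<kappa>^2 * (1 + 3 * \<kappa>)" using \<kappa> by simp
  have mono: "1 + y + 2*y^2 \<le> 1 + z + 2*z^2" "y^2*(1 + 3*y) \<le> z^2*(1 + 3*z)"
    if "0 \<le> y" "y \<le> z" for y z :: real
    using that by (auto intro!: mult_mono power_mono add_mono)
  have eq: "1 / r = (1 + \<kappa> + 2*\<kappa>^2) / (\<kappa>^2 * (1 + 3*\<kappa>))" by (simp add: r_def)
  have "1 / r \<le> (1 + 0.52700330 + 2*0.52700330^2) / (0.52700329^2*(1 + 3*0.52700329))"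
    unfolding eq by (rule frac_le[OF _ mono(1) _ mono(2)]) (use assms in auto)
  also have "\<dots> < 2.905115" by (simp add: power_divide)
  finally have upper: "1 / r < 2.905115" .
  have "2.905105 < (1 + 0.52700329 + 2*0.52700329^2) / (0.52700330^2*(1 + 3*0.52700330) :: real)"
    by (simp add: power_divide)
  also have "\<dots> \<le> 1 / r"
    unfolding eq by (rule frac_le[OF _ mono(1) pos mono(2)]) (use assms in auto)
  finally have "2.905105 < 1 / r" .
  with upper have "1 / r - 2.90511 < 0.000005" "- (1 / r - 2.90511) < 0.000005" by simp_all
  thus ?thesis by (simp only: abs_less_iff)
qed

text \<open>Near \<open>\<kappa>\<close>, the inverse \<open>z\<close> of \<open>C\<close> satisfies \<open>1 - z / r \<sim> w\<^sub>0 (\<kappa> - c)\<^sup>2\<close>; since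
  \<open>1 + F = 1 / (1 - C)\<close>, this makes \<open>\<gamma>\<close> the constant in the asymptotics.\<close>

definition w0 :: real where
  "w0 = (1 - \<kappa>) * (1 + 5 * \<kappa> + 3 * \<kappa>^2 + 3 * \<kappa> ^ 3) * (1 + \<kappa> + 2 * \<kappa>^2) /
    (\<kappa>^2 * (1 + 3 * \<kappa>) * (1 + 5 * \<kappa> ^ 4 + 2 * \<kappa> ^ 5))"

definition \<gamma> :: real where "\<gamma> = 1 / (2 * sqrt w0 * (1 - \<kappa>)^2)"

lemma w0_pos: "0 < w0"
  unfolding w0_def using \<kappa> by (intro divide_pos_pos mult_pos_pos add_pos_pos) auto

lemma \<gamma>_pos: "0 < \<gamma>"
  using \<kappa> w0_pos by (simp add: \<gamma>_def)

lemma \<gamma>_squared: "\<gamma>^2 = gamma_sq \<kappa>"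
proof -
  define p where "p = \<kappa>^2 * (1 + 3 * \<kappa>) * (1 + 5 * \<kappa> ^ 4 + 2 * \<kappa> ^ 5)"
  define q where "q = (1 - \<kappa>) * (1 + 5 * \<kappa> + 3 * \<kappa>^2 + 3 * \<kappa> ^ 3) * (1 + \<kappa> + 2 * \<kappa>^2)"
  have q: "0 < q" unfolding q_def using \<kappa> by (intro mult_pos_pos add_pos_pos) auto
  have "gamma_sq \<kappa> * (4 * (1 - \<kappa>) ^ 4 * q) = p"
  proof -
    have "4 * (1 - \<kappa>) ^ 4 * q =
        4 * (1 - \<kappa>) ^ 5 * (1 + \<kappa> + 2 * \<kappa>^2) * (1 + 5 * \<kappa> + 3 * \<kappa>^2 + 3 * \<kappa> ^ 3)"
      unfolding q_def by algebra
    thus ?thesis using gamma_sq_mult_eq[OF root] by (simp only: p_def)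
  qed
  hence "gamma_sq \<kappa> = p / (4 * (1 - \<kappa>) ^ 4 * q)" using q \<kappa> by (simp add: eq_divide_eq)
  moreover have "\<gamma>^2 = 1 / (4 * (1 - \<kappa>) ^ 4 * w0)"
    using w0_pos by (simp add: \<gamma>_def power_divide power_mult_distrib)
  moreover have "w0 = q / p" by (simp add: w0_def p_def q_def)
  ultimately show ?thesis by simp
qed

lemma \<gamma>_root:
  "17348952064*\<gamma>^14 - 11927404544*\<gamma>^12 - 6678731520*\<gamma>^10 - 886278144*\<gamma>^8
     - 33824320*\<gamma>^6 - 516144*\<gamma>^4 + 4048*\<gamma>^2 + 11 = 0"
proof -
  have "\<gamma> ^ (2 * j) = gamma_sq \<kappa> ^ j" for j unfolding \<gamma>_squared[symmetric] by (simp add: power_mult)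
  from this[of 2] this[of 3] this[of 4] this[of 5] this[of 6] this[of 7] \<gamma>_squared
  show ?thesis using gamma_sq_root[OF root] by simp
qed

lemma \<gamma>_bounds:
  assumes "0.52700329 < \<kappa>" "\<kappa> < 0.52700330"
  shows "\<bar>\<gamma> - 1.04240\<bar> < 0.000005"
proof -
  note squared = gamma_sq_bounds[OF assms, folded \<gamma>_squared]
  have "1.042395 < \<gamma>" "\<gamma> < 1.042405"
    using power_less_imp_less_base[OF squared(1)] power_less_imp_less_base[OF squared(2)] \<gamma>_pos
    by simp_all
  hence "\<gamma> - 1.04240 < 0.000005" "- (\<gamma> - 1.04240) < 0.000005" by simp_all
  thus ?thesis by (simp only: abs_less_iff)
qed

end

subsection \<open>Transfer of a square-root singularity\<close>

lemma Gamma_minus_one_half: "Gamma (- 1/2 :: complex) = - 2 * of_real (sqrt pi)"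
proof -
  have "Gamma (- 1/2 + 1 :: complex) = (- 1/2) * Gamma (- 1/2)"
  proof (rule Gamma_plus1, rule notI)
    assume "(- 1/2 :: complex) \<in> \<int>\<^sub>\<le>\<^sub>0"
    then obtain n where "(- 1/2 :: complex) = of_int n" by (auto elim: nonpos_Ints_cases)
    hence "real_of_int (2 * n) = real_of_int (- 1)" by (simp add: complex_eq_iff)
    thus False unfolding of_int_eq_iff by presburger
  qed
  thus ?thesis by (simp add: Gamma_one_half_complex)
qed

lemma gbinomial_tendsto:
  fixes a :: real
  shows "(\<lambda>n. ((of_real a :: complex) gchoose n) * (- 1) ^ n * of_real (real n powr (a + 1)))
    \<longlonglongrightarrow> inverse (Gamma (- of_real a))"
proof (rule Lim_transform_eventually[OF gbinomial_asymptotic])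
  show "\<forall>\<^sub>F n in sequentially. ((of_real a :: complex) gchoose n) /
      ((- 1) ^ n / exp ((of_real a + 1) * of_real (ln (real n)))) =
      (of_real a gchoose n) * (- 1) ^ n * of_real (real n powr (a + 1))"
    using eventually_gt_at_top[of 0]
  proof eventually_elim
    case (elim n)
    have "exp ((of_real a + 1) * of_real (ln (real n))) =
        (of_real (exp ((a + 1) * ln (real n))) :: complex)"
      by (simp flip: exp_of_real)
    also have "exp ((a + 1) * ln (real n)) = real n powr (a + 1)" using elim by (simp add: powr_def)
    finally show ?case by (simp add: field_simps flip: power_mult_distrib)
  qed
qed

definition one_minus_powr_fps :: "real \<Rightarrow> real \<Rightarrow> complex fps" where
  "one_minus_powr_fps r a = Abs_fps (\<lambda>n. (of_real a gchoose n) * (- 1 / of_real r) ^ n)"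

lemma has_fps_expansion_one_minus_powr:
  assumes r: "0 < r"
  shows "(\<lambda>z. (1 - z / of_real r) powr of_real a) has_fps_expansion one_minus_powr_fps r a"
proof -
  define c :: complex where "c = - 1 / of_real r"
  let ?a = "of_real a :: complex"
  have "((\<lambda>x. (1 + x) powr ?a) \<circ> (\<lambda>z. c * z)) has_fps_expansion
      (fps_binomial ?a oo (fps_const c * fps_X))"
    by (intro has_fps_expansion_compose has_fps_expansion_binomial_complex fps_expansion_intros) auto
  also have "(\<lambda>x. (1 + x) powr ?a) \<circ> (\<lambda>z. c * z) = (\<lambda>z. (1 - z / of_real r) powr ?a)"
    by (auto simp: c_def fun_eq_iff)
  also have "fps_binomial ?a oo (fps_const c * fps_X) = one_minus_powr_fps r a"
    unfolding fps_compose_linear by (simp add: fps_eq_iff mult.commute one_minus_powr_fps_def c_def)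
  finally show ?thesis .
qed

lemma one_minus_powr_fps_nth_tendsto:
  assumes "0 < r"
  shows "(\<lambda>n. one_minus_powr_fps r a $ n * of_real (r ^ n * real n powr (a + 1)))
    \<longlonglongrightarrow> inverse (Gamma (- of_real a))"
proof -
  have "(- 1 / of_real r) ^ n * of_real r ^ n = (- 1 :: complex) ^ n" for n
    using assms by (simp flip: power_mult_distrib)
  hence "one_minus_powr_fps r a $ n * of_real (r ^ n * real n powr (a + 1)) =
      (of_real a gchoose n) * (- 1) ^ n * of_real (real n powr (a + 1))" for n
    unfolding one_minus_powr_fps_def fps_nth_Abs_fps of_real_mult of_real_power by (metis mult.assoc)
  thus ?thesis using gbinomial_tendsto[of a] by (simp only:)
qed

lemma one_minus_powr_fps_nth_tendsto_0:
  assumes "0 < r" and "b < a + 1"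
  shows "(\<lambda>n. one_minus_powr_fps r a $ n * of_real (r ^ n * real n powr b)) \<longlonglongrightarrow> 0"
proof (rule Lim_transform_eventually)
  have "(\<lambda>n. real n powr (b - (a + 1))) \<longlonglongrightarrow> 0"
    using assms(2) by (intro tendsto_neg_powr filterlim_real_sequentially) simp
  hence "(\<lambda>n. one_minus_powr_fps r a $ n * of_real (r ^ n * real n powr (a + 1)) *
      of_real (real n powr (b - (a + 1)))) \<longlonglongrightarrow> inverse (Gamma (- of_real a)) * of_real 0"
    by (intro tendsto_mult one_minus_powr_fps_nth_tendsto assms tendsto_of_real)
  thus "(\<lambda>n. one_minus_powr_fps r a $ n * of_real (r ^ n * real n powr (a + 1)) *
      of_real (real n powr (b - (a + 1)))) \<longlonglongrightarrow> 0" by simp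
  have "real n powr (a + 1) * real n powr (b - (a + 1)) = real n powr b" for n
    by (simp flip: powr_add)
  thus "\<forall>\<^sub>F n in sequentially. one_minus_powr_fps r a $ n * of_real (r ^ n * real n powr (a + 1)) *
      of_real (real n powr (b - (a + 1))) = one_minus_powr_fps r a $ n * of_real (r ^ n * real n powr b)"
    by (simp add: mult.assoc flip: of_real_mult)
qed

lemma ex_fps_expansion_cubic_csqrt:
  assumes r: "0 < r"
  defines "s \<equiv> \<lambda>z. csqrt (1 - z / of_real r)"
  obtains T where "(\<lambda>z. c0 + c1 * s z + c2 * s z ^ 2 + c3 * s z ^ 3) has_fps_expansion T"
    and "(\<lambda>n. T $ n * of_real (r ^ n * real n powr (3/2))) \<longlonglongrightarrow> - c1 / (2 * of_real (sqrt pi))"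
proof -
  let ?B = "one_minus_powr_fps r"
  define T where "T = fps_const c0 + fps_const c1 * ?B (1/2) +
    fps_const c2 * (1 - fps_const (1 / of_real r) * fps_X) + fps_const c3 * ?B (3/2)"
  let ?f = "\<lambda>z. c0 + c1 * (1 - z / of_real r) powr of_real (1/2) + c2 * (1 - (1 / of_real r) * z) +
    c3 * (1 - z / of_real r) powr of_real (3/2)"
  have f: "?f has_fps_expansion T"
    unfolding T_def by (intro fps_expansion_intros has_fps_expansion_one_minus_powr[OF r])
  have "?f z = c0 + c1 * s z + c2 * s z ^ 2 + c3 * s z ^ 3" for z
  proof (cases "1 - z / of_real r = 0")
    case False
    have half: "(1 - z / of_real r) powr of_real (1/2) = s z" by (simp add: s_def csqrt_conv_powr)
    have square: "1 - (1 / of_real r) * z = s z ^ 2" by (simp add: s_def)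
    have "(1 - z / of_real r) powr of_real (3/2) = (1 - z / of_real r) powr (1 + of_real (1/2))" by simp
    also have "\<dots> = s z ^ 3"
      unfolding powr_add half using False square by (simp add: power3_eq_cube power2_eq_square)
    finally show ?thesis unfolding half square by (simp only:)
  qed (simp add: s_def)
  hence expansion: "(\<lambda>z. c0 + c1 * s z + c2 * s z ^ 2 + c3 * s z ^ 3) has_fps_expansion T"
    using f by (simp only:)
  have "(\<lambda>n. c1 * (?B (1/2) $ n * of_real (r ^ n * real n powr (1/2 + 1))) +
      c3 * (?B (3/2) $ n * of_real (r ^ n * real n powr (3/2))))
      \<longlonglongrightarrow> c1 * inverse (Gamma (- of_real (1/2))) + c3 * 0"
    using r by (intro tendsto_intros one_minus_powr_fps_nth_tendsto one_minus_powr_fps_nth_tendsto_0) auto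
  also have "c1 * inverse (Gamma (- of_real (1/2))) + c3 * 0 = - c1 / (2 * of_real (sqrt pi))"
    using Gamma_minus_one_half by (simp add: field_simps)
  finally have "(\<lambda>n. T $ n * of_real (r ^ n * real n powr (3/2))) \<longlonglongrightarrow> - c1 / (2 * of_real (sqrt pi))"
  proof (rule Lim_transform_eventually)
    show "\<forall>\<^sub>F n in sequentially. c1 * (?B (1/2) $ n * of_real (r ^ n * real n powr (1/2 + 1))) +
        c3 * (?B (3/2) $ n * of_real (r ^ n * real n powr (3/2))) =
        T $ n * of_real (r ^ n * real n powr (3/2))"
      using eventually_ge_at_top[of 2] by eventually_elim (simp add: T_def algebra_simps)
  qed
  thus ?thesis using that expansion by blast
qed

lemma norm_higher_deriv_le_of_deriv2:
  assumes hol: "f holomorphic_on ball 0 r" and r: "0 < r"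
    and M: "\<forall>z\<in>ball 0 r. norm (deriv (deriv f) z) \<le> M"
  shows "norm ((deriv ^^ (n + 2)) f 0) \<le> fact n * M / r ^ n"
proof -
  let ?g = "deriv (deriv f)"
  have holg: "?g holomorphic_on ball 0 r" using hol by (intro holomorphic_deriv) auto
  have "\<forall>\<^sub>F s in at_left r. norm ((deriv ^^ n) ?g 0) \<le> fact n * M / s ^ n"
    using eventually_at_left_real[OF r]
  proof eventually_elim
    case (elim s)
    have sub: "cball 0 s \<subseteq> ball (0::complex) r" using elim by auto
    show ?case
    proof (rule Cauchy_inequality)
      show "?g holomorphic_on ball 0 s"
        using holg sub by (meson ball_subset_cball holomorphic_on_subset order.trans)
      show "continuous_on (cball 0 s) ?g"
        using holg sub holomorphic_on_imp_continuous_on continuous_on_subset by blast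
      show "0 < s" using elim by simp
      fix z :: complex assume "norm (0 - z) = s"
      thus "norm (?g z) \<le> M" using elim M by simp
    qed
  qed
  moreover have "((\<lambda>s. fact n * M / s ^ n) \<longlongrightarrow> fact n * M / r ^ n) (at_left r)"
    using r by (intro tendsto_intros) auto
  ultimately have "norm ((deriv ^^ n) ?g 0) \<le> fact n * M / r ^ n"
    by (intro tendsto_lowerbound[where F = "at_left r"]) auto
  moreover have "(deriv ^^ (n + 2)) f = (deriv ^^ n) ?g"
    by (simp only: funpow_add o_apply) (simp add: numeral_2_eq_2)
  ultimately show ?thesis by simp
qed

lemma fps_nth_tendsto_0_of_bounded_deriv2:
  assumes hol: "g holomorphic_on ball 0 r" and r: "0 < r" and g: "g has_fps_expansion h"
    and M: "\<forall>z\<in>ball 0 r. norm (deriv (deriv g) z) \<le> M"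
  shows "(\<lambda>n. h $ n * of_real (r ^ n * real n powr (3/2))) \<longlonglongrightarrow> 0"
proof (rule Lim_null_comparison)
  show "\<forall>\<^sub>F n in sequentially. norm (h $ n * of_real (r ^ n * real n powr (3/2)))
      \<le> M * r^2 * (real n powr (3/2) / (real n * (real n - 1)))"
    using eventually_ge_at_top[of 2]
  proof eventually_elim
    case (elim n)
    then obtain m where n: "n = m + 2" by (metis add.commute le_Suc_ex)
    have fact: "fact n = real n * (real n - 1) * fact m" by (simp add: n algebra_simps)
    have "norm (h $ n) = norm ((deriv ^^ (m + 2)) g 0) / fact n"
      using fps_nth_fps_expansion[OF g, of n] by (simp only: norm_divide norm_fact n)
    also have "\<dots> \<le> fact m * M / r ^ m / fact n"
      by (intro divide_right_mono norm_higher_deriv_le_of_deriv2[OF hol r M]) auto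
    also have "\<dots> = M * r^2 / (real n * (real n - 1)) / r ^ n"
    proof -
      have "fact m * M / r ^ m / (x * fact m) = M * r^2 / x / r ^ n" for x
        using r by (simp add: n power_add power2_eq_square)
      thus ?thesis unfolding fact .
    qed
    finally have "norm (h $ n) * (r ^ n * real n powr (3/2)) \<le>
        M * r^2 / (real n * (real n - 1)) / r ^ n * (r ^ n * real n powr (3/2))"
      using r by (intro mult_right_mono) auto
    thus ?case using r by (simp add: norm_mult norm_power)
  qed
  have "(\<lambda>n. real n powr (3/2) / (real n * (real n - 1))) \<longlonglongrightarrow> 0" by real_asymp
  thus "(\<lambda>n. M * r^2 * (real n powr (3/2) / (real n * (real n - 1)))) \<longlonglongrightarrow> 0"
    by (rule tendsto_mult_right_zero)
qed

lemma Re_less_of_norm_le: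
  fixes z :: complex
  assumes "norm z \<le> r" "z \<noteq> of_real r"
  shows "Re z < r"
proof (rule ccontr)
  assume "\<not> Re z < r"
  hence Re: "Re z = r" using complex_Re_le_cmod[of z] assms(1) by linarith
  have "(Re z)\<^sup>2 + (Im z)\<^sup>2 \<le> r\<^sup>2"
    unfolding cmod_power2[symmetric] using assms(1) by (intro power_mono) auto
  hence "Im z = 0" using Re by simp
  thus False using Re assms(2) by (simp add: complex_eq_iff)
qed

lemma ball_subset_Re_less: "ball 0 r \<subseteq> {z. Re z < r}"
  by (auto intro: order_le_less_trans[OF complex_Re_le_cmod])

lemma Re_one_minus_divide_pos:
  assumes "0 < r" "Re z < r"
  shows "0 < Re (1 - z / of_real r)"
  using assms by (simp add: Re_divide_of_real)

lemma csqrt_one_minus_divide_has_field_derivative: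
  assumes "0 < r" "Re z < r"
  shows "((\<lambda>z. csqrt (1 - z / of_real r)) has_field_derivative
    - 1 / (2 * of_real r * csqrt (1 - z / of_real r))) (at z)"
proof -
  have "1 - z / of_real r \<notin> \<real>\<^sub>\<le>\<^sub>0"
    using Re_one_minus_divide_pos[OF assms] by (auto simp: complex_nonpos_Reals_iff)
  hence "((\<lambda>z. csqrt (1 - z / of_real r)) has_field_derivative
      - (1 / of_real r) / (2 * csqrt (1 - z / of_real r))) (at z)"
    using assms by (auto intro!: derivative_eq_intros simp: field_simps)
  thus ?thesis by (simp add: mult_ac)
qed

lemma comp_csqrt_has_field_derivative:
  assumes r: "0 < r" and U: "open U" "U \<subseteq> {z. Re z < r}" and F: "F holomorphic_on ball 0 e"
    and s: "\<And>z. z \<in> U \<Longrightarrow> csqrt (1 - z / of_real r) \<in> ball 0 e"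
    and R: "\<And>z. z \<in> U \<Longrightarrow> R z = F (csqrt (1 - z / of_real r))" and z: "z \<in> U"
  shows "(R has_field_derivative - deriv F (csqrt (1 - z / of_real r)) /
    (2 * of_real r * csqrt (1 - z / of_real r))) (at z)"
proof -
  have "Re z < r" using U(2) z by auto
  from DERIV_chain2[OF holomorphic_derivI[OF F open_ball s[OF z]]
      csqrt_one_minus_divide_has_field_derivative[OF r this]]
  have "((\<lambda>w. F (csqrt (1 - w / of_real r))) has_field_derivative
      - deriv F (csqrt (1 - z / of_real r)) / (2 * of_real r * csqrt (1 - z / of_real r))) (at z)"
    by simp
  thus ?thesis by (rule has_field_derivative_transform_within_open[OF _ U(1) z]) (simp add: R)
qed

lemma deriv2_comp_csqrt:
  assumes r: "0 < r" and U: "open U" "U \<subseteq> {z. Re z < r}" and F: "F holomorphic_on ball 0 e"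
    and s: "\<And>z. z \<in> U \<Longrightarrow> csqrt (1 - z / of_real r) \<in> ball 0 e"
    and R: "\<And>z. z \<in> U \<Longrightarrow> R z = F (csqrt (1 - z / of_real r))" and z: "z \<in> U"
  defines "s0 \<equiv> csqrt (1 - z / of_real r)"
  shows "deriv (deriv R) z = (deriv (deriv F) s0 * s0 - deriv F s0) / (4 * of_real r ^ 2 * s0 ^ 3)"
proof -
  let ?s = "\<lambda>z. csqrt (1 - z / of_real r)"
  define a b where "a = deriv (deriv F) s0" and "b = deriv F s0"
  have Re: "Re z < r" using U(2) z by auto
  have nonzero: "s0 \<noteq> 0" using Re_one_minus_divide_pos[OF r Re] by (auto simp: s0_def)
  have F': "deriv F holomorphic_on ball 0 e" using F by (intro holomorphic_deriv) auto
  have ds: "(?s has_field_derivative - 1 / (2 * of_real r * s0)) (at z)"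
    unfolding s0_def by (rule csqrt_one_minus_divide_has_field_derivative[OF r Re])
  have dF: "((\<lambda>w. deriv F (?s w)) has_field_derivative a * (- 1 / (2 * of_real r * s0))) (at z)"
    unfolding a_def s0_def by (rule DERIV_chain2[OF holomorphic_derivI[OF F' open_ball s[OF z]]
          ds[unfolded s0_def]])
  have "((\<lambda>w. - deriv F (?s w) / (2 * of_real r * ?s w)) has_field_derivative
      (- (a * (- 1 / (2 * of_real r * s0))) * (2 * of_real r * s0) -
        (- b) * (2 * of_real r * (- 1 / (2 * of_real r * s0)))) /
      ((2 * of_real r * s0) * (2 * of_real r * s0))) (at z)"
    unfolding b_def s0_def using r nonzero
    by (intro DERIV_divide DERIV_minus DERIV_cmult dF[unfolded s0_def] ds[unfolded s0_def])
      (auto simp: s0_def)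
  also have "(- (a * (- 1 / (2 * of_real r * s0))) * (2 * of_real r * s0) -
        (- b) * (2 * of_real r * (- 1 / (2 * of_real r * s0)))) = a - b / s0"
    using r nonzero by simp
  also have "(a - b / s0) / ((2 * of_real r * s0) * (2 * of_real r * s0)) =
      (a * s0 - b) / (4 * of_real r ^ 2 * s0 ^ 3)"
    using r nonzero by (simp add: field_simps power2_eq_square power3_eq_cube)
  finally have "(deriv R has_field_derivative (a * s0 - b) / (4 * of_real r ^ 2 * s0 ^ 3)) (at z)"
    by (rule has_field_derivative_transform_within_open[OF _ U(1) z])
      (rule DERIV_imp_deriv[OF comp_csqrt_has_field_derivative[OF r U F s R], symmetric])
  thus ?thesis unfolding a_def b_def by (rule DERIV_imp_deriv)
qed

lemma continuous_image_bounded: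
  fixes f :: "complex \<Rightarrow> complex"
  assumes "continuous_on K f" "compact K"
  shows "\<exists>M. \<forall>z\<in>K. norm (f z) \<le> M"
  using compact_imp_bounded[OF compact_continuous_image[OF assms]] unfolding bounded_iff by blast

lemma deriv_power4_mult:
  assumes H: "H holomorphic_on S" "open S" and s: "s \<in> S"
  shows "deriv (\<lambda>s. s ^ 4 * H s) s = 4 * s ^ 3 * H s + s ^ 4 * deriv H s"
  by (rule DERIV_imp_deriv) (auto intro!: derivative_eq_intros holomorphic_derivI[OF H s])

lemma deriv2_power4_mult:
  assumes H: "H holomorphic_on S" "open S" and s: "s \<in> S"
  shows "deriv (deriv (\<lambda>s. s ^ 4 * H s)) s =
    12 * s\<^sup>2 * H s + 8 * s ^ 3 * deriv H s + s ^ 4 * deriv (deriv H) s"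
proof (rule DERIV_imp_deriv)
  have "((\<lambda>s. 4 * s ^ 3 * H s + s ^ 4 * deriv H s) has_field_derivative
      12 * s\<^sup>2 * H s + 8 * s ^ 3 * deriv H s + s ^ 4 * deriv (deriv H) s) (at s)"
    by (auto intro!: derivative_eq_intros holomorphic_derivI[OF H s]
        holomorphic_derivI[OF holomorphic_deriv[OF H] H(2) s] simp: algebra_simps)
  thus "(deriv (\<lambda>s. s ^ 4 * H s) has_field_derivative
      12 * s\<^sup>2 * H s + 8 * s ^ 3 * deriv H s + s ^ 4 * deriv (deriv H) s) (at s)"
    by (rule has_field_derivative_transform_within_open[OF _ H(2) s]) (simp add: deriv_power4_mult[OF H])
qed

text \<open>For \<open>F(s) = s\<^sup>4 H(s)\<close> the formula for the second derivative has no denominator.\<close>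

lemma bounded_deriv2_power4_csqrt:
  assumes r: "0 < r" and U: "open U" "U \<subseteq> ball 0 r" and H: "H holomorphic_on ball 0 e" and e: "0 < e"
    and s: "\<And>z. z \<in> U \<Longrightarrow> norm (csqrt (1 - z / of_real r)) \<le> e / 2"
    and R: "\<And>z. z \<in> U \<Longrightarrow> R z = csqrt (1 - z / of_real r) ^ 4 * H (csqrt (1 - z / of_real r))"
  obtains M where "\<And>z. z \<in> U \<Longrightarrow> norm (deriv (deriv R) z) \<le> M"
proof -
  define B where "B s = (8 * H s + 7 * s * deriv H s + s\<^sup>2 * deriv (deriv H) s) / (4 * of_real r ^ 2)"
    for s
  have "B holomorphic_on ball 0 e"
    unfolding B_def using r by (auto intro!: holomorphic_intros H holomorphic_deriv)
  hence "continuous_on (cball 0 (e / 2)) B"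
    by (rule continuous_on_subset[OF holomorphic_on_imp_continuous_on]) (use e in auto)
  from continuous_image_bounded[OF this compact_cball]
  obtain M where M: "\<forall>s\<in>cball 0 (e / 2). norm (B s) \<le> M" by blast
  have U_Re: "U \<subseteq> {z. Re z < r}" using U(2) ball_subset_Re_less by (rule order.trans)
  have s_ball: "csqrt (1 - z / of_real r) \<in> ball 0 e" if "z \<in> U" for z using s[OF that] e by simp
  have power4: "(\<lambda>s. s ^ 4 * H s) holomorphic_on ball 0 e" by (intro holomorphic_intros H)
  have "norm (deriv (deriv R) z) \<le> M" if z: "z \<in> U" for z
  proof -
    define s where "s = csqrt (1 - z / of_real r)"
    have "norm z < r" using z U(2) by auto
    hence "s \<noteq> 0" using r by (auto simp: s_def)
    have s_e: "s \<in> ball 0 e" using s_ball[OF z] by (simp add: s_def)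
    have "deriv (deriv R) z = ((12 * s\<^sup>2 * H s + 8 * s ^ 3 * deriv H s + s ^ 4 * deriv (deriv H) s) * s
        - (4 * s ^ 3 * H s + s ^ 4 * deriv H s)) / (4 * of_real r ^ 2 * s ^ 3)"
      using deriv2_comp_csqrt[OF r U(1) U_Re power4 s_ball R z, folded s_def]
      by (simp only: deriv_power4_mult[OF H open_ball s_e] deriv2_power4_mult[OF H open_ball s_e])
    also have "\<dots> = s ^ 3 * (8 * H s + 7 * s * deriv H s + s\<^sup>2 * deriv (deriv H) s)
        / (4 * of_real r ^ 2 * s ^ 3)"
      by (simp add: algebra_simps power2_eq_square power3_eq_cube power4_eq_xxxx)
    also have "\<dots> = B s" using \<open>s \<noteq> 0\<close> by (simp add: B_def)
    finally show ?thesis using M s[OF z] by (simp add: s_def)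
  qed
  thus ?thesis using that by blast
qed

lemma holomorphic_on_comp_csqrt:
  assumes P: "P holomorphic_on UNIV" and r: "0 < r"
  shows "(\<lambda>z. P (csqrt (1 - z / of_real r))) holomorphic_on {z. Re z < r}"
proof -
  have "1 - z / of_real r \<notin> \<real>\<^sub>\<le>\<^sub>0" if "Re z < r" for z
    using Re_one_minus_divide_pos[OF r that] by (auto simp: complex_nonpos_Reals_iff)
  hence "(\<lambda>z. csqrt (1 - z / of_real r)) holomorphic_on {z. Re z < r}"
    using r by (intro holomorphic_intros) auto
  thus ?thesis using holomorphic_on_compose_gen[OF _ P] by (auto simp: o_def)
qed

lemma bounded_deriv2_comp_csqrt_away:
  assumes P: "P holomorphic_on UNIV" and r: "0 < r" and \<epsilon>: "0 < \<epsilon>"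
  obtains M where "\<And>z. norm z < r \<Longrightarrow> \<epsilon> \<le> norm (z - of_real r) \<Longrightarrow>
    norm (deriv (deriv (\<lambda>z. P (csqrt (1 - z / of_real r)))) z) \<le> M"
proof -
  let ?f = "\<lambda>z. P (csqrt (1 - z / of_real r))"
  have "?f holomorphic_on {z. Re z < r}" using P r by (rule holomorphic_on_comp_csqrt)
  hence hol: "deriv (deriv ?f) holomorphic_on {z. Re z < r}"
    by (intro holomorphic_deriv open_halfspace_Re_lt)
  define K where "K = cball 0 r - ball (of_real r :: complex) \<epsilon>"
  have "K \<subseteq> {z. Re z < r}"
  proof
    fix z assume "z \<in> K"
    hence "norm z \<le> r" "z \<noteq> of_real r" using \<epsilon> by (auto simp: K_def)
    thus "z \<in> {z. Re z < r}" using Re_less_of_norm_le by blast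
  qed
  hence cont: "continuous_on K (deriv (deriv ?f))"
    using hol holomorphic_on_imp_continuous_on continuous_on_subset by blast
  have "compact K" unfolding K_def by (intro compact_diff compact_cball open_ball)
  from continuous_image_bounded[OF cont this]
  obtain M where M: "\<forall>z\<in>K. norm (deriv (deriv ?f) z) \<le> M" by blast
  show ?thesis
  proof (rule that)
    fix z :: complex assume "norm z < r" "\<epsilon> \<le> norm (z - of_real r)"
    hence "z \<in> K" by (simp add: K_def dist_norm norm_minus_commute)
    thus "norm (deriv (deriv ?f) z) \<le> M" using M by blast
  qed
qed

lemma holomorphic_factor_id:
  assumes f: "f holomorphic_on ball 0 e" and e: "0 < e"
  shows "\<exists>g. g holomorphic_on ball 0 e \<and> g 0 = deriv f 0 \<and> (\<forall>s\<in>ball 0 e. f s = f 0 + s * g s)"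
proof (intro exI conjI ballI)
  let ?g = "\<lambda>s. if s = 0 then deriv f 0 else (f s - f 0) / (s - 0)"
  show "?g holomorphic_on ball 0 e" using f e by (intro pole_lemma) auto
  show "?g 0 = deriv f 0" by simp
  fix s :: complex assume "s \<in> ball 0 e"
  show "f s = f 0 + s * ?g s" by simp
qed

lemma holomorphic_cubic_Taylor:
  assumes f: "f holomorphic_on ball 0 e" and e: "0 < e"
  obtains H a2 a3 where "H holomorphic_on ball 0 e"
    "\<forall>s\<in>ball 0 e. f s = f 0 + deriv f 0 * s + a2 * s\<^sup>2 + a3 * s ^ 3 + s ^ 4 * H s"
proof -
  obtain g1 where g1: "g1 holomorphic_on ball 0 e" "g1 0 = deriv f 0" "\<forall>s\<in>ball 0 e. f s = f 0 + s * g1 s"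
    using holomorphic_factor_id[OF f e] by blast
  obtain g2 where g2: "g2 holomorphic_on ball 0 e" "\<forall>s\<in>ball 0 e. g1 s = g1 0 + s * g2 s"
    using holomorphic_factor_id[OF g1(1) e] by blast
  obtain g3 where g3: "g3 holomorphic_on ball 0 e" "\<forall>s\<in>ball 0 e. g2 s = g2 0 + s * g3 s"
    using holomorphic_factor_id[OF g2(1) e] by blast
  obtain H where H: "H holomorphic_on ball 0 e" "\<forall>s\<in>ball 0 e. g3 s = g3 0 + s * H s"
    using holomorphic_factor_id[OF g3(1) e] by blast
  show ?thesis
  proof (rule that[OF H(1), of "g2 0" "g3 0"], rule ballI)
    fix s :: complex assume s: "s \<in> ball 0 e"
    have "f s = f 0 + s * (deriv f 0 + s * (g2 0 + s * (g3 0 + s * H s)))"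
      using g1(2) g1(3)[rule_format, OF s] g2(2)[rule_format, OF s] g3(2)[rule_format, OF s]
        H(2)[rule_format, OF s] by metis
    thus "f s = f 0 + deriv f 0 * s + g2 0 * s\<^sup>2 + g3 0 * s ^ 3 + s ^ 4 * H s"
      by (simp add: algebra_simps power2_eq_square power3_eq_cube power4_eq_xxxx)
  qed
qed

lemma bounded_deriv2_diff_comp_csqrt_away:
  assumes L: "L holomorphic_on ball 0 r" and P: "P holomorphic_on UNIV" and r: "0 < r" and \<epsilon>: "0 < \<epsilon>"
    and away: "\<exists>M. \<forall>z. norm z < r \<and> \<epsilon> \<le> norm (z - of_real r) \<longrightarrow> norm (deriv (deriv L) z) \<le> M"
  obtains M where "\<And>z. norm z < r \<Longrightarrow> \<epsilon> \<le> norm (z - of_real r) \<Longrightarrow>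
    norm (deriv (deriv (\<lambda>z. L z - P (csqrt (1 - z / of_real r)))) z) \<le> M"
proof -
  let ?P = "\<lambda>z. P (csqrt (1 - z / of_real r))"
  obtain M1 where M1: "\<And>z. norm z < r \<Longrightarrow> \<epsilon> \<le> norm (z - of_real r) \<Longrightarrow> norm (deriv (deriv L) z) \<le> M1"
    using away by blast
  obtain M2 where M2: "\<And>z. norm z < r \<Longrightarrow> \<epsilon> \<le> norm (z - of_real r) \<Longrightarrow> norm (deriv (deriv ?P) z) \<le> M2"
    using bounded_deriv2_comp_csqrt_away[OF P r \<epsilon>] by blast
  have holP: "?P holomorphic_on ball 0 r"
    using holomorphic_on_comp_csqrt[OF P r] ball_subset_Re_less by (rule holomorphic_on_subset)
  show ?thesis
  proof (rule that)
    fix z :: complex assume z: "norm z < r" "\<epsilon> \<le> norm (z - of_real r)"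
    hence "deriv (deriv (\<lambda>z. L z - ?P z)) z = deriv (deriv L) z - deriv (deriv ?P) z"
      using higher_deriv_diff[OF L holP open_ball, of z 2] by (simp add: numeral_2_eq_2)
    hence "norm (deriv (deriv (\<lambda>z. L z - ?P z)) z) \<le> norm (deriv (deriv L) z) + norm (deriv (deriv ?P) z)"
      by (simp only: norm_triangle_ineq4)
    thus "norm (deriv (deriv (\<lambda>z. L z - ?P z)) z) \<le> M1 + M2" using M1[OF z] M2[OF z] by linarith
  qed
qed

lemma eventually_norm_csqrt_less:
  assumes "0 < r" "0 < \<epsilon>"
  shows "\<forall>\<^sub>F z in at (of_real r) within A. norm (csqrt (1 - z / of_real r)) < \<epsilon>"
proof -
  have "((\<lambda>z. norm (csqrt (1 - z / of_real r))) \<longlongrightarrow> sqrt (norm (1 - complex_of_real r / of_real r)))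
      (at (of_real r) within A)"
    unfolding norm_csqrt using assms by (intro tendsto_intros) auto
  thus ?thesis using assms by (intro order_tendstoD(2)[where a = \<epsilon>]) auto
qed

lemma bounded_deriv2_sqrt_remainder:
  assumes r: "0 < r" and L: "L holomorphic_on ball 0 r" and P: "P holomorphic_on UNIV"
    and H: "H holomorphic_on ball 0 e" "0 < e"
    and near: "\<forall>\<^sub>F z in at (of_real r) within ball 0 r. csqrt (1 - z / of_real r) \<in> ball 0 e \<longrightarrow>
      L z = P (csqrt (1 - z / of_real r)) +
        csqrt (1 - z / of_real r) ^ 4 * H (csqrt (1 - z / of_real r))"
    and away: "\<And>\<epsilon>. 0 < \<epsilon> \<Longrightarrow>
      \<exists>M. \<forall>z. norm z < r \<and> \<epsilon> \<le> norm (z - of_real r) \<longrightarrow> norm (deriv (deriv L) z) \<le> M"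
  shows "\<exists>M. \<forall>z\<in>ball 0 r. norm (deriv (deriv (\<lambda>z. L z - P (csqrt (1 - z / of_real r)))) z) \<le> M"
proof -
  let ?s = "\<lambda>z. csqrt (1 - z / of_real r)"
  define R where "R z = L z - P (?s z)" for z
  have "\<forall>\<^sub>F z in at (of_real r) within ball 0 r. norm (?s z) < e / 2"
    using r H(2) by (intro eventually_norm_csqrt_less) auto
  with near have "\<forall>\<^sub>F z in at (of_real r) within ball 0 r.
      norm (?s z) < e / 2 \<and> R z = ?s z ^ 4 * H (?s z)"
    by eventually_elim (use H(2) in \<open>auto simp: R_def\<close>)
  then obtain \<epsilon> where \<epsilon>: "0 < \<epsilon>" and local: "\<forall>z\<in>ball 0 r. z \<noteq> of_real r \<and> dist z (of_real r) < \<epsilon> \<longrightarrow>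
      norm (?s z) < e / 2 \<and> R z = ?s z ^ 4 * H (?s z)"
    unfolding eventually_at by blast
  define U where "U = ball 0 r \<inter> ball (complex_of_real r) \<epsilon>"
  have U: "open U" "U \<subseteq> ball 0 r" by (auto simp: U_def)
  have local_U: "norm (?s z) < e / 2 \<and> R z = ?s z ^ 4 * H (?s z)" if "z \<in> U" for z
  proof -
    have "z \<noteq> of_real r" using that r by (auto simp: U_def)
    thus ?thesis using local that by (simp add: U_def dist_commute)
  qed
  obtain M1 where M1: "\<And>z. z \<in> U \<Longrightarrow> norm (deriv (deriv R) z) \<le> M1"
    by (rule bounded_deriv2_power4_csqrt[OF r U H, of R]) (use local_U in \<open>auto intro: less_imp_le\<close>)
  obtain M2 where M2: "\<And>z. norm z < r \<Longrightarrow> \<epsilon> \<le> norm (z - of_real r) \<Longrightarrow> norm (deriv (deriv R) z) \<le> M2"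
    using bounded_deriv2_diff_comp_csqrt_away[OF L P r \<epsilon> away[OF \<epsilon>]] unfolding R_def by blast
  have "norm (deriv (deriv R) z) \<le> max M1 M2" if z: "z \<in> ball 0 r" for z
  proof (cases "z \<in> U")
    case True
    thus ?thesis using M1 by (simp add: le_max_iff_disj)
  next
    case False
    hence "norm z < r" "\<epsilon> \<le> norm (z - of_real r)"
      using z by (auto simp: U_def dist_norm norm_minus_commute)
    thus ?thesis using M2 by (simp add: le_max_iff_disj)
  qed
  thus ?thesis unfolding R_def by blast
qed

theorem sqrt_singularity_transfer:
  assumes r: "0 < r" and L: "L holomorphic_on ball 0 r" "L has_fps_expansion f"
    and G: "G holomorphic_on ball 0 e" "0 < e"
    and near: "\<forall>\<^sub>F z in at (of_real r) within ball 0 r. L z = G (csqrt (1 - z / of_real r))"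
    and away: "\<And>\<epsilon>. 0 < \<epsilon> \<Longrightarrow>
      \<exists>M. \<forall>z. norm z < r \<and> \<epsilon> \<le> norm (z - of_real r) \<longrightarrow> norm (deriv (deriv L) z) \<le> M"
  shows "(\<lambda>n. f $ n * of_real (r ^ n * real n powr (3/2)))
    \<longlonglongrightarrow> - deriv G 0 / (2 * of_real (sqrt pi))"
proof -
  let ?s = "\<lambda>z. csqrt (1 - z / of_real r)"
  obtain H a2 a3 where H: "H holomorphic_on ball 0 e"
    "\<forall>s\<in>ball 0 e. G s = G 0 + deriv G 0 * s + a2 * s\<^sup>2 + a3 * s ^ 3 + s ^ 4 * H s"
    using holomorphic_cubic_Taylor[OF G] .
  define P where "P s = G 0 + deriv G 0 * s + a2 * s\<^sup>2 + a3 * s ^ 3" for s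
  obtain T where T: "(\<lambda>z. P (?s z)) has_fps_expansion T"
    "(\<lambda>n. T $ n * of_real (r ^ n * real n powr (3/2))) \<longlonglongrightarrow> - deriv G 0 / (2 * of_real (sqrt pi))"
    using ex_fps_expansion_cubic_csqrt[OF r, of "G 0" "deriv G 0" a2 a3, folded P_def] .
  have P: "P holomorphic_on UNIV" unfolding P_def by (intro holomorphic_intros)
  have "\<forall>\<^sub>F z in at (of_real r) within ball 0 r. ?s z \<in> ball 0 e \<longrightarrow> L z = P (?s z) + ?s z ^ 4 * H (?s z)"
    using near by eventually_elim (use H(2) in \<open>simp add: P_def\<close>)
  from bounded_deriv2_sqrt_remainder[OF r L(1) P H(1) G(2) this away]
  obtain M where M: "\<forall>z\<in>ball 0 r. norm (deriv (deriv (\<lambda>z. L z - P (?s z))) z) \<le> M" by blast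
  have "(\<lambda>z. P (?s z)) holomorphic_on ball 0 r"
    using holomorphic_on_subset[OF holomorphic_on_comp_csqrt[OF P r] ball_subset_Re_less] by blast
  hence "(\<lambda>z. L z - P (?s z)) holomorphic_on ball 0 r" by (rule holomorphic_on_diff[OF L(1)])
  moreover have "(\<lambda>z. L z - P (?s z)) has_fps_expansion f - T"
    by (rule has_fps_expansion_diff[OF L(2) T(1)])
  ultimately have "(\<lambda>n. (f - T) $ n * of_real (r ^ n * real n powr (3/2))) \<longlonglongrightarrow> 0"
    using M by (rule fps_nth_tendsto_0_of_bounded_deriv2[OF _ r])
  from tendsto_add[OF this T(2)] show ?thesis by (simp add: left_diff_distrib)
qed

subsection \<open>Absolutely convergent power series on a closed disc\<close>

definition fps_abs_summable :: "real \<Rightarrow> complex fps \<Rightarrow> bool" where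
  "fps_abs_summable r f \<longleftrightarrow> 0 < r \<and> summable (\<lambda>n. norm (f $ n) * r ^ n)"

lemma norm_fps_term_le:
  fixes f :: "complex fps"
  assumes "norm z \<le> r"
  shows "norm (f $ n * z ^ n) \<le> norm (f $ n) * r ^ n"
  unfolding norm_mult norm_power using assms by (intro mult_left_mono power_mono) auto

lemma fps_abs_summable_summable_norm:
  assumes "fps_abs_summable r f" "norm z \<le> r"
  shows "summable (\<lambda>n. norm (f $ n * z ^ n))"
proof (rule summable_comparison_test')
  show "summable (\<lambda>n. norm (f $ n) * r ^ n)" using assms(1) by (simp add: fps_abs_summable_def)
  show "norm (norm (f $ n * z ^ n)) \<le> norm (f $ n) * r ^ n" if "0 \<le> n" for n
    using norm_fps_term_le[OF assms(2)] by simp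
qed

lemma fps_abs_summable_conv_radius:
  assumes "fps_abs_summable r f"
  shows "ereal r \<le> fps_conv_radius f"
proof -
  have r: "0 < r" using assms by (simp add: fps_abs_summable_def)
  have "summable (\<lambda>n. f $ n * of_real r ^ n)"
    by (rule summable_norm_cancel, rule fps_abs_summable_summable_norm[OF assms]) (use r in simp)
  thus ?thesis using conv_radius_geI[of "fps_nth f" "of_real r"] r by (simp add: fps_conv_radius_def)
qed

lemma holomorphic_on_eval_fps_ball:
  assumes "fps_abs_summable r f"
  shows "eval_fps f holomorphic_on ball 0 r"
proof (rule holomorphic_on_eval_fps)
  show "(ball 0 r :: complex set) \<subseteq> eball 0 (fps_conv_radius f)"
  proof
    fix z :: complex assume "z \<in> ball 0 r"
    hence "ereal (norm z) < ereal r" by simp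
    thus "z \<in> eball 0 (fps_conv_radius f)"
      using order_less_le_trans[OF _ fps_abs_summable_conv_radius[OF assms]] by (simp add: eball_def)
  qed
qed

lemma eval_fps_has_fps_expansion_abs_summable:
  assumes "fps_abs_summable r f"
  shows "eval_fps f has_fps_expansion f"
proof (rule eval_fps_has_fps_expansion)
  have "0 < ereal r" using assms by (simp add: fps_abs_summable_def)
  thus "0 < fps_conv_radius f" using fps_abs_summable_conv_radius[OF assms] by (rule order_less_le_trans)
qed

lemma norm_eval_fps_le:
  assumes "fps_abs_summable r f" "norm z \<le> r"
  shows "norm (eval_fps f z) \<le> (\<Sum>n. norm (f $ n) * r ^ n)"
proof -
  note summable = fps_abs_summable_summable_norm[OF assms]
  have "norm (eval_fps f z) \<le> (\<Sum>n. norm (f $ n * z ^ n))"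
    unfolding eval_fps_def by (rule summable_norm[OF summable])
  also have "\<dots> \<le> (\<Sum>n. norm (f $ n) * r ^ n)"
    using assms by (intro suminf_le summable norm_fps_term_le) (auto simp: fps_abs_summable_def)
  finally show ?thesis .
qed

lemma continuous_on_eval_fps_cball:
  assumes "fps_abs_summable r f"
  shows "continuous_on (cball 0 r) (eval_fps f)"
proof (rule uniform_limit_theorem[OF _ _ sequentially_bot])
  show "uniform_limit (cball 0 r) (\<lambda>N z. \<Sum>n<N. f $ n * z ^ n) (eval_fps f) sequentially"
    unfolding eval_fps_def
    using assms norm_fps_term_le[of _ r f]
    by (intro Weierstrass_m_test[where M = "\<lambda>n. norm (f $ n) * r ^ n"]) (auto simp: fps_abs_summable_def)
  show "\<forall>\<^sub>F N in sequentially. continuous_on (cball 0 r) (\<lambda>z. \<Sum>n<N. f $ n * z ^ n)"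
    by (intro always_eventually allI continuous_intros)
qed

lemma fps_abs_summable_add:
  assumes "fps_abs_summable r f" "fps_abs_summable r g"
  shows "fps_abs_summable r (f + g)"
proof -
  have "summable (\<lambda>n. norm (f $ n) * r ^ n + norm (g $ n) * r ^ n)"
    using assms unfolding fps_abs_summable_def by (intro summable_add) auto
  moreover have "norm (norm ((f + g) $ n) * r ^ n) \<le> norm (f $ n) * r ^ n + norm (g $ n) * r ^ n" for n
    using norm_triangle_ineq[of "f $ n" "g $ n"] assms(1)
    by (auto simp: fps_abs_summable_def distrib_right[symmetric] intro!: mult_right_mono)
  ultimately show ?thesis
    using assms(1) unfolding fps_abs_summable_def by (blast intro: summable_comparison_test')
qed

lemma fps_abs_summable_mult:
  assumes "fps_abs_summable r f" "fps_abs_summable r g"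
  shows "fps_abs_summable r (f * g)"
proof -
  let ?a = "\<lambda>n. norm (f $ n) * r ^ n" and ?b = "\<lambda>n. norm (g $ n) * r ^ n"
  have r: "0 < r" using assms(1) by (simp add: fps_abs_summable_def)
  hence "summable (\<lambda>n. \<Sum>i\<le>n. ?a i * ?b (n - i))"
    using assms by (intro summable_Cauchy_product) (simp_all add: fps_abs_summable_def)
  moreover have "norm (norm ((f * g) $ n) * r ^ n) \<le> (\<Sum>i\<le>n. ?a i * ?b (n - i))" for n
  proof -
    have "norm ((f * g) $ n) * r ^ n \<le> (\<Sum>i\<le>n. norm (f $ i) * norm (g $ (n - i))) * r ^ n"
      unfolding fps_mult_nth atLeast0AtMost norm_mult[symmetric]
      using r by (intro mult_right_mono norm_sum) auto
    also have "\<dots> = (\<Sum>i\<le>n. ?a i * ?b (n - i))"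
      unfolding sum_distrib_right by (intro sum.cong) (auto simp flip: power_add)
    finally show ?thesis using r by simp
  qed
  ultimately show ?thesis
    using r unfolding fps_abs_summable_def by (blast intro: summable_comparison_test')
qed

lemma fps_abs_summable_fps_X_power:
  assumes "0 < r"
  shows "fps_abs_summable r (fps_X ^ k)"
proof -
  have "summable (\<lambda>n. norm ((fps_X ^ k :: complex fps) $ n) * r ^ n)"
    by (rule summable_finite[of "{k}"]) (auto simp: fps_X_power_nth)
  thus ?thesis using assms by (simp add: fps_abs_summable_def)
qed

lemma eval_fps_add_cball:
  assumes "fps_abs_summable r f" "fps_abs_summable r g" "norm z \<le> r"
  shows "eval_fps (f + g) z = eval_fps f z + eval_fps g z"
  using suminf_add[OF summable_norm_cancel[OF fps_abs_summable_summable_norm[OF assms(1,3)]]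
      summable_norm_cancel[OF fps_abs_summable_summable_norm[OF assms(2,3)]]]
  by (simp add: eval_fps_def distrib_right)

lemma eval_fps_mult_cball:
  assumes "fps_abs_summable r f" "fps_abs_summable r g" "norm z \<le> r"
  shows "eval_fps (f * g) z = eval_fps f z * eval_fps g z"
proof -
  have "f $ i * z ^ i * (g $ (n - i) * z ^ (n - i)) = f $ i * g $ (n - i) * z ^ n" if "i \<le> n" for i n
    using that by (simp add: mult_ac flip: power_add)
  hence "(\<Sum>i\<le>n. f $ i * z ^ i * (g $ (n - i) * z ^ (n - i))) = (f * g) $ n * z ^ n" for n
    unfolding fps_mult_nth atLeast0AtMost sum_distrib_right by (intro sum.cong) auto
  thus ?thesis
    using Cauchy_product[OF fps_abs_summable_summable_norm[OF assms(1,3)]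
        fps_abs_summable_summable_norm[OF assms(2,3)]]
    by (simp add: eval_fps_def)
qed

subsection \<open>Convergence at the critical point\<close>

definition psum :: "real fps \<Rightarrow> real \<Rightarrow> nat \<Rightarrow> real" where
  "psum f x N = (\<Sum>n\<le>N. f $ n * x ^ n)"

lemma psum_nonneg: "(\<And>n. 0 \<le> f $ n) \<Longrightarrow> 0 \<le> x \<Longrightarrow> 0 \<le> psum f x N"
  by (auto simp: psum_def intro!: sum_nonneg)

lemma psum_add: "psum (f + g) x N = psum f x N + psum g x N"
  by (simp add: psum_def algebra_simps sum.distrib)

lemma psum_1: "psum 1 x N = 1"
  by (induction N) (simp_all add: psum_def)

lemma psum_X_le:
  assumes "0 \<le> x"
  shows "psum fps_X x N \<le> x"
proof -
  have "psum fps_X x (Suc N) = x" for N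
    by (induction N) (simp_all add: psum_def fps_X_def)
  thus ?thesis using assms by (cases N) (auto simp: psum_def)
qed

lemma psum_X_mult: "psum (fps_X * f) x (Suc N) = x * psum f x N"
  unfolding psum_def sum.atMost_Suc_shift by (simp add: sum_distrib_left mult_ac)

lemma psum_mono:
  assumes "\<And>n. 0 \<le> f $ n" "0 \<le> x" "N \<le> M"
  shows "psum f x N \<le> psum f x M"
  unfolding psum_def using assms by (intro sum_mono2) auto

lemma psum_mult_le:
  assumes f: "\<And>n. 0 \<le> f $ n" and g: "\<And>n. 0 \<le> g $ n" and x: "0 \<le> x"
  shows "psum (f * g) x N \<le> psum f x N * psum g x N"
proof -
  have "psum (f * g) x N = (\<Sum>n\<le>N. \<Sum>i\<le>n. (f $ i * x ^ i) * (g $ (n - i) * x ^ (n - i)))"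
    unfolding psum_def fps_mult_nth sum_distrib_right atLeast0AtMost
  proof (intro sum.cong refl)
    fix n i :: nat assume "i \<in> {..n}"
    hence "x ^ n = x ^ i * x ^ (n - i)" by (simp flip: power_add)
    thus "f $ i * g $ (n - i) * x ^ n = f $ i * x ^ i * (g $ (n - i) * x ^ (n - i))" by simp
  qed
  also have "\<dots> = (\<Sum>(i,j)\<in>{(i,j). i + j \<le> N}. (f $ i * x ^ i) * (g $ j * x ^ j))"
    by (rule sum.triangle_reindex_eq[symmetric])
  also have "\<dots> \<le> (\<Sum>(i,j)\<in>{..N} \<times> {..N}. (f $ i * x ^ i) * (g $ j * x ^ j))"
    using f g x by (intro sum_mono2) auto
  also have "\<dots> = psum f x N * psum g x N"
    unfolding psum_def sum_product sum.cartesian_product ..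
  finally show ?thesis .
qed

lemma psum_bounded_imp_summable:
  assumes "\<And>n. 0 \<le> f $ n" "0 \<le> x" "\<And>N. psum f x N \<le> B"
  shows "summable (\<lambda>n. f $ n * x ^ n)" "(\<Sum>n. f $ n * x ^ n) \<le> B"
proof -
  show s: "summable (\<lambda>n. f $ n * x ^ n)"
  proof (rule bounded_imp_summable[of _ B])
    fix N show "(\<Sum>n\<le>N. f $ n * x ^ n) \<le> B" using assms(3)[of N] by (simp add: psum_def)
  qed (use assms in auto)
  show "(\<Sum>n. f $ n * x ^ n) \<le> B"
  proof (rule suminf_le_const[OF s])
    fix N
    have "(\<Sum>n<N. f $ n * x ^ n) \<le> psum f x N"
      unfolding psum_def using assms by (intro sum_mono2) auto
    thus "(\<Sum>n<N. f $ n * x ^ n) \<le> B" using assms(3)[of N] by linarith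
  qed
qed

lemma gf_nonneg: "0 \<le> (gf A :: real fps) $ n"
  by (simp add: gf_def)

lemma norm_gf_nth: "norm (gf A $ n :: complex) = gf A $ n"
  by (simp add: gf_def)

context critical_point
begin

lemma psum_win_forests_le_of_win_trees:
  assumes C: "psum (gf win_trees) r N \<le> \<kappa>"
  shows "psum (gf win_forests) r N \<le> 1 / (1 - \<kappa>)"
    and "psum (gf odd_win_forests) r N \<le> \<kappa> / (1 - \<kappa>^2)"
proof -
  let ?C = "psum (gf win_trees) r N" and ?L = "psum (gf win_forests) r N"
    and ?O = "psum (gf odd_win_forests) r N" and ?E = "psum (gf even_win_forests) r N"
  have r0: "0 \<le> r" using r_pos by simp
  note nonneg = psum_nonneg[OF gf_nonneg r0] and mult_le = psum_mult_le[OF gf_nonneg gf_nonneg r0]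
  have "?L \<le> 1 + ?C * ?L"
    by (subst (1) gf_win_forests) (use mult_le in \<open>simp add: psum_add psum_1\<close>)
  also have "\<dots> \<le> 1 + \<kappa> * ?L" using C nonneg by (intro add_mono mult_right_mono) auto
  finally show "?L \<le> 1 / (1 - \<kappa>)" using \<kappa> by (simp add: field_simps)
  have "?E \<le> 1 + ?C * ?O"
    by (subst (1) gf_even_win_forests) (use mult_le in \<open>simp add: psum_add psum_1\<close>)
  also have "\<dots> \<le> 1 + \<kappa> * ?O" using C nonneg by (intro add_mono mult_right_mono) auto
  finally have E: "?E \<le> 1 + \<kappa> * ?O" .
  have "?O \<le> ?C * ?E" by (subst (1) gf_odd_win_forests) (rule mult_le)
  also have "\<dots> \<le> \<kappa> * (1 + \<kappa> * ?O)" using C E nonneg \<kappa> by (intro mult_mono) auto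
  finally have "?O * (1 - \<kappa>^2) \<le> \<kappa>" by (simp add: power2_eq_square algebra_simps)
  moreover have "\<kappa>^2 < 1" using \<kappa> by (simp add: power_less_one_iff)
  ultimately show "?O \<le> \<kappa> / (1 - \<kappa>^2)" by (simp add: pos_le_divide_eq)
qed

lemma critical_value_fixed_point: "r + r * (r * (\<kappa> / (1 - \<kappa>^2) * (1 / (1 - \<kappa>)))) = \<kappa>"
proof -
  have eq: "(1 - \<kappa>^2) * (1 - \<kappa>) = (1 - \<kappa>)^2 * (1 + \<kappa>)" by algebra
  have "r * (r * (\<kappa> / (1 - \<kappa>^2) * (1 / (1 - \<kappa>)))) = r^2 * \<kappa> / ((1 - \<kappa>^2) * (1 - \<kappa>))"
    by (simp add: power2_eq_square)
  also have "\<dots> = \<kappa> - r" unfolding eq critical_value[symmetric] using \<kappa> by simp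
  finally show ?thesis by simp
qed

lemma psum_win_trees_le: "psum (gf win_trees) r N \<le> \<kappa>"
proof (induction N)
  case 0
  show ?case using \<kappa> by (simp add: psum_def gf_nth_0 win_trees_def)
next
  case (Suc N)
  let ?O = "psum (gf odd_win_forests) r N" and ?L = "psum (gf win_forests) r N"
  let ?OL = "gf odd_win_forests * gf win_forests :: real fps"
  have r0: "0 \<le> r" using r_pos by simp
  note nonneg = psum_nonneg[OF gf_nonneg r0]
  have XOL: "0 \<le> (fps_X * ?OL) $ n" for n
    by (auto simp: fps_mult_nth intro!: sum_nonneg gf_nonneg mult_nonneg_nonneg)
  have k2: "\<kappa>^2 < 1" using \<kappa> by (simp add: power_less_one_iff)
  have "psum (gf win_trees) r (Suc N) = psum fps_X r (Suc N) + psum (fps_X * (fps_X * ?OL)) r (Suc N)"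
    by (subst gf_win_trees) (simp add: psum_add power2_eq_square mult.assoc)
  also have "\<dots> \<le> r + r * psum (fps_X * ?OL) r N"
    using psum_X_le[OF r0] by (simp add: psum_X_mult)
  also have "psum (fps_X * ?OL) r N \<le> psum (fps_X * ?OL) r (Suc N)"
    by (intro psum_mono XOL r0) simp
  also have "\<dots> = r * psum ?OL r N" by (rule psum_X_mult)
  also have "psum ?OL r N \<le> ?O * ?L" by (rule psum_mult_le[OF gf_nonneg gf_nonneg r0])
  also have "\<dots> \<le> \<kappa> / (1 - \<kappa>^2) * (1 / (1 - \<kappa>))"
    using psum_win_forests_le_of_win_trees[OF Suc.IH] nonneg \<kappa> k2 by (intro mult_mono) auto
  also note critical_value_fixed_point
  finally show ?case using r_pos by simp
qed

lemma fps_abs_summable_gf: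
  assumes "\<And>N. psum (gf A) r N \<le> B"
  shows "fps_abs_summable r (gf A)"
  using psum_bounded_imp_summable(1)[OF gf_nonneg _ assms] r_pos
  by (simp add: fps_abs_summable_def norm_gf_nth)

lemmas abs_summable_win_trees = fps_abs_summable_gf[OF psum_win_trees_le]
  and abs_summable_win_forests = fps_abs_summable_gf[OF psum_win_forests_le_of_win_trees(1)[OF psum_win_trees_le]]
  and abs_summable_odd_win_forests =
    fps_abs_summable_gf[OF psum_win_forests_le_of_win_trees(2)[OF psum_win_trees_le]]

lemmas abs_summable_intros = fps_abs_summable_add fps_abs_summable_mult
  fps_abs_summable_fps_X_power[OF r_pos] abs_summable_win_trees abs_summable_win_forests
  abs_summable_odd_win_forests

definition tree_fun :: "complex \<Rightarrow> complex" where "tree_fun = eval_fps (gf win_trees)"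
definition forest_fun :: "complex \<Rightarrow> complex" where "forest_fun = eval_fps (gf win_forests)"

definition J :: "complex \<Rightarrow> complex" where "J c = (1 - c)^2 * (1 + c)"
definition K :: "complex \<Rightarrow> complex" where "K c = c / J c"
definition K' :: "complex \<Rightarrow> complex" where "K' c = (1 + c + 2 * c\<^sup>2) / ((1 - c) ^ 3 * (1 + c)^2)"

lemma holomorphic_tree_fun: "tree_fun holomorphic_on ball 0 r"
  unfolding tree_fun_def by (rule holomorphic_on_eval_fps_ball[OF abs_summable_win_trees])

lemma holomorphic_forest_fun: "forest_fun holomorphic_on ball 0 r"
  unfolding forest_fun_def by (rule holomorphic_on_eval_fps_ball[OF abs_summable_win_forests])

lemma continuous_on_tree_fun: "continuous_on (cball 0 r) tree_fun"
  unfolding tree_fun_def by (rule continuous_on_eval_fps_cball[OF abs_summable_win_trees])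

lemma forest_fun_has_fps_expansion: "forest_fun has_fps_expansion gf win_forests"
  unfolding forest_fun_def by (rule eval_fps_has_fps_expansion_abs_summable[OF abs_summable_win_forests])

lemma norm_tree_fun_le:
  assumes "norm z \<le> r"
  shows "norm (tree_fun z) \<le> \<kappa>"
proof -
  have "norm (tree_fun z) \<le> (\<Sum>n. norm (gf win_trees $ n :: complex) * r ^ n)"
    unfolding tree_fun_def by (rule norm_eval_fps_le[OF abs_summable_win_trees assms])
  also have "\<dots> \<le> \<kappa>"
    using psum_bounded_imp_summable(2)[OF gf_nonneg _ psum_win_trees_le] r_pos by (simp add: norm_gf_nth)
  finally show ?thesis .
qed

lemma ball_1_neq: "c \<in> ball 0 1 \<Longrightarrow> 1 - c \<noteq> (0 :: complex)" "c \<in> ball 0 1 \<Longrightarrow> 1 + c \<noteq> (0 :: complex)"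
  by (auto simp: add_eq_0_iff)

lemma tree_fun_ball: "norm z \<le> r \<Longrightarrow> tree_fun z \<in> ball 0 1"
  using norm_tree_fun_le[of z] \<kappa> by simp

lemma J_nonzero: "c \<in> ball 0 1 \<Longrightarrow> J c \<noteq> 0"
  using ball_1_neq by (simp add: J_def)

lemma forest_fun_eq:
  assumes z: "norm z \<le> r"
  shows "forest_fun z = inverse (1 - tree_fun z)"
proof -
  have "forest_fun z = eval_fps (fps_X ^ 0 + gf win_trees * gf win_forests) z"
    unfolding forest_fun_def by (subst gf_win_forests) simp
  also have "\<dots> = 1 + tree_fun z * forest_fun z"
    by (simp only: eval_fps_add_cball[OF _ _ z] eval_fps_mult_cball[OF _ _ z] abs_summable_intros
        tree_fun_def forest_fun_def) simp
  finally have "forest_fun z * (1 - tree_fun z) = 1" by (simp add: algebra_simps)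
  thus ?thesis using ball_1_neq(1)[OF tree_fun_ball[OF z]] by (simp add: field_simps)
qed

lemma tree_fun_eq:
  assumes z: "norm z \<le> r"
  shows "tree_fun z = z + z\<^sup>2 * K (tree_fun z)"
proof -
  define c where "c = tree_fun z"
  define d where "d = eval_fps (gf odd_win_forests) z"
  note eval = eval_fps_add_cball[OF _ _ z] eval_fps_mult_cball[OF _ _ z] abs_summable_intros
  have odd: "gf odd_win_forests = gf win_trees * (fps_X ^ 0 + gf win_trees * gf odd_win_forests)"
    unfolding power_0 gf_even_win_forests[symmetric] by (rule gf_odd_win_forests)
  have "d = eval_fps (gf win_trees * (fps_X ^ 0 + gf win_trees * gf odd_win_forests)) z"
    unfolding d_def using odd by (rule arg_cong)
  also have "\<dots> = c * (1 + c * d)" by (simp only: eval c_def d_def tree_fun_def) simp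
  finally have "d * (1 - c\<^sup>2) = c" by (simp add: algebra_simps power2_eq_square)
  moreover have ne: "1 - c \<noteq> 0" "1 + c \<noteq> 0"
    using ball_1_neq[OF tree_fun_ball[OF z]] by (auto simp: c_def)
  moreover have "1 - c\<^sup>2 = (1 - c) * (1 + c)" by algebra
  ultimately have d: "d = c / ((1 - c) * (1 + c))" by (simp add: eq_divide_eq)
  have "c = eval_fps (fps_X ^ 1 + fps_X ^ 2 * (gf odd_win_forests * gf win_forests)) z"
    unfolding c_def tree_fun_def by (subst gf_win_trees) simp
  also have "\<dots> = z + z\<^sup>2 * (d * forest_fun z)"
    by (simp only: eval d_def forest_fun_def) simp
  also have "d * forest_fun z = K c"
    unfolding d forest_fun_eq[OF z] c_def[symmetric] K_def J_def using ne
    by (simp add: field_simps power2_eq_square)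
  finally show ?thesis by (simp add: c_def)
qed

definition quad :: "complex \<Rightarrow> complex" where
  "quad c = c\<^sup>2 + of_real (2 * \<kappa> - 1 - r) * c - of_real ((1 + 3 * \<kappa>) / (1 + \<kappa> + 2 * \<kappa>^2))"

lemma double_root: "(c - of_real r) * J c - of_real r ^ 2 * c = (c - of_real \<kappa>)^2 * quad c"
proof -
  define k R b where "k = complex_of_real \<kappa>" and "R = complex_of_real r"
    and "b = 1 + k + 2 * k\<^sup>2"
  have b: "b = of_real (1 + \<kappa> + 2 * \<kappa>^2)" by (simp add: b_def k_def)
  hence b_nonzero: "b \<noteq> 0" using r_denominator_pos by (simp only: of_real_eq_0_iff)
  have "R * b = of_real (r * (1 + \<kappa> + 2 * \<kappa>^2))" by (simp add: R_def b)
  hence Rb: "R * b = k\<^sup>2 * (1 + 3 * k)" unfolding r_mult_denominator by (simp add: k_def)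
  have crit: "2*k^7 + 8*k^6 + 2*k^5 + 2*k^4 + 2*k^3 + k\<^sup>2 - 1 = 0"
    using arg_cong[OF root, of complex_of_real] by (simp add: critical_poly_def k_def)
  have "b\<^sup>2 * ((c - R) * J c - R ^ 2 * c) = (b * c - R * b) * b * J c - (R * b)^2 * c" by algebra
  also have "\<dots> = (c - k)^2 * b * (b * c\<^sup>2 + (2 * k * b - b - R * b) * c - (1 + 3 * k))
      - (2*k^7 + 8*k^6 + 2*k^5 + 2*k^4 + 2*k^3 + k\<^sup>2 - 1) * c"
    unfolding Rb unfolding b_def J_def by algebra
  also have "\<dots> = b\<^sup>2 * ((c - k)^2 * (c\<^sup>2 + (2 * k - 1 - R) * c - (1 + 3 * k) / b))"
    unfolding crit using b_nonzero by (simp add: field_simps power2_eq_square)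
  also have "c\<^sup>2 + (2 * k - 1 - R) * c - (1 + 3 * k) / b = quad c"
    by (simp add: quad_def k_def R_def b)
  finally show ?thesis using b_nonzero by (simp add: k_def R_def)
qed

lemma tree_fun_curve:
  assumes "norm z \<le> r"
  shows "(tree_fun z - z) * J (tree_fun z) = z\<^sup>2 * tree_fun z"
proof -
  have "J (tree_fun z) \<noteq> 0" by (rule J_nonzero[OF tree_fun_ball[OF assms]])
  moreover have "tree_fun z - z = z\<^sup>2 * (tree_fun z / J (tree_fun z))"
    using tree_fun_eq[OF assms] by (simp add: K_def algebra_simps)
  ultimately show ?thesis by simp
qed

lemma tree_fun_quad:
  assumes "norm z \<le> r"
  defines "c \<equiv> tree_fun z"
  shows "(c - of_real \<kappa>)^2 * quad c = (z - of_real r) * (J c + (z + of_real r) * c)"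
  using tree_fun_curve[OF assms(1)] unfolding double_root[symmetric] c_def by algebra

lemma quad_of_real:
  "quad (of_real v) = of_real (v^2 + (2 * \<kappa> - 1 - r) * v - (1 + 3 * \<kappa>) / (1 + \<kappa> + 2 * \<kappa>^2))"
  by (simp add: quad_def)

lemma quad_kappa:
  "quad (of_real \<kappa>) =
     - of_real ((1 - \<kappa>) * (1 + 5 * \<kappa> + 3 * \<kappa>^2 + 3 * \<kappa> ^ 3) / (1 + \<kappa> + 2 * \<kappa>^2))"
proof -
  define b where "b = 1 + \<kappa> + 2 * \<kappa>^2"
  have b: "b \<noteq> 0" using r_denominator_pos by (simp add: b_def)
  define m where "m = \<kappa>^2 + (2 * \<kappa> - 1 - r) * \<kappa>"
  have "m * b - (1 + 3 * \<kappa>) = \<kappa>^2 * b + (2 * \<kappa> * b - b - r * b) * \<kappa> - (1 + 3 * \<kappa>)"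
    unfolding m_def by algebra
  also have "\<dots> = - ((1 - \<kappa>) * (1 + 5 * \<kappa> + 3 * \<kappa>^2 + 3 * \<kappa> ^ 3))"
    unfolding r_mult_denominator[folded b_def] unfolding b_def by algebra
  finally have "(m * b - (1 + 3 * \<kappa>)) / b = - ((1 - \<kappa>) * (1 + 5 * \<kappa> + 3 * \<kappa>^2 + 3 * \<kappa> ^ 3) / b)"
    by simp
  hence "m - (1 + 3 * \<kappa>) / b = - ((1 - \<kappa>) * (1 + 5 * \<kappa> + 3 * \<kappa>^2 + 3 * \<kappa> ^ 3) / b)"
    using b by (simp add: diff_divide_distrib)
  hence "quad (of_real \<kappa>) =
      of_real (- ((1 - \<kappa>) * (1 + 5 * \<kappa> + 3 * \<kappa>^2 + 3 * \<kappa> ^ 3) / b))"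
    unfolding quad_of_real m_def b_def by (rule arg_cong)
  thus ?thesis unfolding b_def of_real_minus .
qed

lemma quad_of_real_nonzero:
  assumes "0 \<le> v" "v \<le> \<kappa>"
  shows "quad (of_real v) \<noteq> 0"
proof -
  define m q where "m = 2 * \<kappa> - 1 - r" and "q = (1 + 3 * \<kappa>) / (1 + \<kappa> + 2 * \<kappa>^2)"
  have q: "0 < q" using \<kappa> r_denominator_pos by (simp add: q_def)
  have "0 < (1 - \<kappa>) * (1 + 5 * \<kappa> + 3 * \<kappa>^2 + 3 * \<kappa> ^ 3) / (1 + \<kappa> + 2 * \<kappa>^2)"
    using \<kappa> r_denominator_pos by (intro divide_pos_pos mult_pos_pos add_pos_pos) auto
  moreover have "quad (of_real \<kappa>) = of_real (\<kappa> * (\<kappa> + m) - q)"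
    unfolding quad_of_real m_def q_def by (simp add: algebra_simps power2_eq_square)
  ultimately have at_kappa: "\<kappa> * (\<kappa> + m) < q"
    unfolding quad_kappa of_real_minus[symmetric] of_real_eq_iff by linarith
  have "v * (v + m) \<le> v * (\<kappa> + m)" using assms by (intro mult_left_mono) auto
  also have "\<dots> < q"
  proof (cases "0 \<le> \<kappa> + m")
    case True
    hence "v * (\<kappa> + m) \<le> \<kappa> * (\<kappa> + m)" using assms by (intro mult_right_mono) auto
    thus ?thesis using at_kappa by linarith
  next
    case False
    hence "v * (\<kappa> + m) \<le> 0" using assms by (intro mult_nonneg_nonpos) auto
    thus ?thesis using q by linarith
  qed
  finally have "v^2 + m * v - q \<noteq> 0" by (simp add: algebra_simps power2_eq_square)
  thus ?thesis unfolding quad_of_real m_def q_def of_real_eq_0_iff .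
qed

lemma tree_fun_r: "tree_fun (of_real r) = of_real \<kappa>"
proof -
  define v where "v = (\<Sum>n. gf win_trees $ n * r ^ n)"
  have gf: "gf win_trees $ n = complex_of_real (gf win_trees $ n)" for n by (simp add: gf_def)
  note summable = psum_bounded_imp_summable[OF gf_nonneg _ psum_win_trees_le]
  have "tree_fun (of_real r) = (\<Sum>n. of_real (gf win_trees $ n * r ^ n))"
    unfolding tree_fun_def eval_fps_def by (subst gf) simp
  also have "\<dots> = of_real v"
    unfolding v_def by (rule suminf_of_real[OF summable(1), symmetric]) (use r_pos in simp)
  finally have eq: "tree_fun (of_real r) = of_real v" .
  have "0 \<le> v" unfolding v_def using summable(1) r_pos gf_nonneg by (intro suminf_nonneg) auto
  moreover have "v \<le> \<kappa>" unfolding v_def using summable(2) r_pos by simp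
  ultimately have "quad (of_real v) \<noteq> 0" by (rule quad_of_real_nonzero)
  moreover have "(of_real v - of_real \<kappa>)^2 * quad (of_real v) = 0"
    using tree_fun_quad[of "of_real r"] r_pos eq by simp
  ultimately show ?thesis using eq by simp
qed

lemma J_kappa: "J (of_real \<kappa>) = of_real ((1 - \<kappa>)^2 * (1 + \<kappa>))"
  by (simp add: J_def)

lemma tree_fun_eq_kappa_imp_r:
  assumes z: "norm z \<le> r" and "tree_fun z = of_real \<kappa>"
  shows "z = of_real r"
proof (rule ccontr)
  assume "z \<noteq> of_real r"
  hence "J (of_real \<kappa>) + (z + of_real r) * of_real \<kappa> = 0"
    using tree_fun_quad[OF z] assms(2) by simp
  hence "Re (J (of_real \<kappa>) + (z + of_real r) * of_real \<kappa>) = 0" by simp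
  hence "(1 - \<kappa>)^2 * (1 + \<kappa>) + (Re z + r) * \<kappa> = 0" unfolding J_kappa by simp
  moreover have "0 < (1 - \<kappa>)^2 * (1 + \<kappa>)" using \<kappa> by simp
  moreover have "0 \<le> (Re z + r) * \<kappa>" using z \<kappa> abs_Re_le_cmod[of z] by (intro mult_nonneg_nonneg) auto
  ultimately show False by linarith
qed

lemma K_has_field_derivative:
  assumes "c \<in> ball 0 1"
  shows "(K has_field_derivative K' c) (at c)"
proof -
  note ne = ball_1_neq[OF assms]
  define A where "A = - 2 * (1 - c) * (1 + c) + (1 - c)^2"
  have "(J has_field_derivative A) (at c)"
    unfolding A_def J_def by (auto intro!: derivative_eq_intros simp: algebra_simps power2_eq_square)
  hence "(K has_field_derivative (1 * J c - c * A) / (J c * J c)) (at c)"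
    unfolding K_def using J_nonzero[OF assms] by (intro DERIV_divide DERIV_ident) auto
  moreover have "(1 * J c - c * A) / (J c * J c) = K' c"
  proof -
    have "(1 * J c - c * A) * ((1 - c) ^ 3 * (1 + c)^2) = (1 + c + 2 * c\<^sup>2) * (J c * J c)"
      unfolding A_def J_def by algebra
    thus ?thesis using J_nonzero[OF assms] ne unfolding K'_def by (subst frac_eq_eq) auto
  qed
  ultimately show ?thesis by simp
qed

lemma holomorphic_K: "K holomorphic_on ball 0 1"
  unfolding K_def using J_nonzero by (auto intro!: holomorphic_intros simp: J_def)

lemma holomorphic_K': "K' holomorphic_on ball 0 1"
  unfolding K'_def using ball_1_neq by (auto intro!: holomorphic_intros)

text \<open>Equality \<open>r\<^sup>2 K'(\<kappa>) = 1\<close> holds at \<open>z = r\<close>; elsewhere \<open>C(z) \<noteq> \<kappa>\<close> and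
  the factor \<open>1 / (1 - C(z))\<close> is strictly smaller.\<close>

lemma one_minus_K'_nonzero:
  assumes z: "norm z \<le> r" "z \<noteq> of_real r"
  shows "1 - z\<^sup>2 * K' (tree_fun z) \<noteq> 0"
proof -
  define c where "c = tree_fun z"
  have c: "norm c \<le> \<kappa>" "c \<noteq> of_real \<kappa>"
    using norm_tree_fun_le[OF z(1)] tree_fun_eq_kappa_imp_r[OF z(1)] z(2) by (auto simp: c_def)
  have square: "norm (c\<^sup>2) \<le> \<kappa>^2" using c(1) by (simp add: norm_power power_mono)
  have away: "1 - \<kappa> < norm (1 - c)"
    using Re_less_of_norm_le[OF c] complex_Re_le_cmod[of "1 - c"] by simp
  have "norm (z\<^sup>2 * (1 + c + 2 * c\<^sup>2)) < norm ((1 - c) ^ 3 * (1 + c)\<^sup>2)"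
  proof -
    have "norm (1 + c + 2 * c\<^sup>2) \<le> norm (1 + c) + norm (2 * c\<^sup>2)" by (rule norm_triangle_ineq)
    also have "\<dots> \<le> 1 + \<kappa> + 2 * \<kappa>\<^sup>2"
      using norm_triangle_ineq[of 1 c] c(1) square by (simp add: norm_mult)
    finally have "norm (z\<^sup>2 * (1 + c + 2 * c\<^sup>2)) \<le> r\<^sup>2 * (1 + \<kappa> + 2 * \<kappa>\<^sup>2)"
      unfolding norm_mult norm_power using z(1) by (intro mult_mono power_mono) auto
    also have "\<dots> = (1 - \<kappa>) * (1 - \<kappa>\<^sup>2)\<^sup>2" unfolding critical_derivative by algebra
    also have "\<dots> < norm (1 - c) * norm (1 - c\<^sup>2) ^ 2"
    proof (rule mult_less_le_imp_less[OF away])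
      show "(1 - \<kappa>\<^sup>2)\<^sup>2 \<le> norm (1 - c\<^sup>2) ^ 2"
        using norm_triangle_ineq2[of 1 "c\<^sup>2"] square \<kappa>
        by (intro power_mono) (auto simp: power_le_one_iff)
      show "0 \<le> 1 - \<kappa>" "0 < (1 - \<kappa>\<^sup>2)\<^sup>2" using \<kappa> by (auto simp: power2_eq_1_iff)
    qed
    also have "\<dots> = norm ((1 - c) * (1 - c\<^sup>2)\<^sup>2)" by (simp add: norm_mult norm_power)
    also have "(1 - c) * (1 - c\<^sup>2)\<^sup>2 = (1 - c) ^ 3 * (1 + c)\<^sup>2" by algebra
    finally show ?thesis .
  qed
  moreover have "(1 - c) ^ 3 * (1 + c)\<^sup>2 \<noteq> 0"
    using ball_1_neq[OF tree_fun_ball[OF z(1)]] by (simp add: c_def)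
  ultimately show ?thesis unfolding K'_def c_def[symmetric] by (auto simp: field_simps)
qed

lemma tree_fun_has_field_derivative:
  "z \<in> ball 0 r \<Longrightarrow> (tree_fun has_field_derivative deriv tree_fun z) (at z)"
  using holomorphic_tree_fun by (intro holomorphic_derivI) auto

lemma deriv_tree_fun_has_field_derivative:
  "z \<in> ball 0 r \<Longrightarrow> (deriv tree_fun has_field_derivative deriv (deriv tree_fun) z) (at z)"
  using holomorphic_deriv[OF holomorphic_tree_fun] by (intro holomorphic_derivI) auto

lemma comp_tree_fun_has_field_derivative:
  assumes f: "f holomorphic_on ball 0 1" and z: "z \<in> ball 0 r"
  shows "((\<lambda>z. f (tree_fun z)) has_field_derivative deriv f (tree_fun z) * deriv tree_fun z) (at z)"
  using DERIV_chain2[OF holomorphic_derivI[OF f] tree_fun_has_field_derivative[OF z]] z tree_fun_ball[of z]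
  by simp

lemma deriv_K: "c \<in> ball 0 1 \<Longrightarrow> deriv K c = K' c"
  by (rule DERIV_imp_deriv[OF K_has_field_derivative])

lemma deriv_tree_fun:
  assumes z: "z \<in> ball 0 r"
  shows "deriv tree_fun z = 1 + (2 * z * K (tree_fun z) + z\<^sup>2 * (K' (tree_fun z) * deriv tree_fun z))"
proof -
  have "((\<lambda>w. K (tree_fun w)) has_field_derivative K' (tree_fun z) * deriv tree_fun z) (at z)"
    using comp_tree_fun_has_field_derivative[OF holomorphic_K z] deriv_K[OF tree_fun_ball] z by simp
  hence "((\<lambda>w. w + w\<^sup>2 * K (tree_fun w)) has_field_derivative
      1 + (2 * z * K (tree_fun z) + z\<^sup>2 * (K' (tree_fun z) * deriv tree_fun z))) (at z)"
    by (auto intro!: derivative_eq_intros simp: algebra_simps)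
  hence "(tree_fun has_field_derivative
      1 + (2 * z * K (tree_fun z) + z\<^sup>2 * (K' (tree_fun z) * deriv tree_fun z))) (at z)"
    by (rule has_field_derivative_transform_within_open[OF _ open_ball z]) (simp add: tree_fun_eq[symmetric])
  thus ?thesis by (rule DERIV_imp_deriv)
qed

lemma deriv2_tree_fun:
  assumes z: "z \<in> ball 0 r"
  defines "c \<equiv> tree_fun z" and "c1 \<equiv> deriv tree_fun z" and "c2 \<equiv> deriv (deriv tree_fun) z"
  shows "c2 = 2 * K c + 4 * z * K' c * c1 + z\<^sup>2 * deriv K' c * c1\<^sup>2 + z\<^sup>2 * K' c * c2"
proof -
  have dK: "((\<lambda>w. K (tree_fun w)) has_field_derivative K' c * c1) (at z)"
    using comp_tree_fun_has_field_derivative[OF holomorphic_K z] deriv_K[OF tree_fun_ball] z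
    by (simp add: c_def c1_def)
  have dK': "((\<lambda>w. K' (tree_fun w)) has_field_derivative deriv K' c * c1) (at z)"
    using comp_tree_fun_has_field_derivative[OF holomorphic_K' z] by (simp add: c_def c1_def)
  have "((\<lambda>w. 1 + (2 * w * K (tree_fun w) + w\<^sup>2 * (K' (tree_fun w) * deriv tree_fun w))) has_field_derivative
      2 * K c + 4 * z * K' c * c1 + z\<^sup>2 * deriv K' c * c1\<^sup>2 + z\<^sup>2 * K' c * c2) (at z)"
    by (auto intro!: derivative_eq_intros dK dK' deriv_tree_fun_has_field_derivative[OF z]
        simp: c_def[symmetric] c1_def[symmetric] c2_def[symmetric] algebra_simps power2_eq_square)
  hence "(deriv tree_fun has_field_derivative
      2 * K c + 4 * z * K' c * c1 + z\<^sup>2 * deriv K' c * c1\<^sup>2 + z\<^sup>2 * K' c * c2) (at z)"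
    by (rule has_field_derivative_transform_within_open[OF _ open_ball z]) (rule deriv_tree_fun[symmetric])
  thus ?thesis unfolding c2_def by (rule DERIV_imp_deriv)
qed

lemma deriv2_forest_fun:
  assumes z: "z \<in> ball 0 r"
  shows "deriv (deriv forest_fun) z =
    deriv (deriv tree_fun) z * forest_fun z ^ 2 + 2 * deriv tree_fun z ^ 2 * forest_fun z ^ 3"
proof -
  have d1: "(forest_fun has_field_derivative deriv tree_fun w * forest_fun w ^ 2) (at w)"
    if w: "w \<in> ball 0 r" for w
  proof -
    have "1 - tree_fun w \<noteq> 0" using ball_1_neq(1)[OF tree_fun_ball] w by simp
    hence "((\<lambda>w. inverse (1 - tree_fun w)) has_field_derivative deriv tree_fun w * forest_fun w ^ 2) (at w)"
      using w by (auto intro!: derivative_eq_intros tree_fun_has_field_derivative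
          simp: forest_fun_eq power2_eq_square)
    thus ?thesis
      by (rule has_field_derivative_transform_within_open[OF _ open_ball w]) (simp add: forest_fun_eq)
  qed
  have "((\<lambda>w. deriv tree_fun w * forest_fun w ^ 2) has_field_derivative
      deriv (deriv tree_fun) z * forest_fun z ^ 2 + 2 * deriv tree_fun z ^ 2 * forest_fun z ^ 3) (at z)"
    by (auto intro!: derivative_eq_intros d1[OF z] deriv_tree_fun_has_field_derivative[OF z]
        simp: algebra_simps power2_eq_square power3_eq_cube)
  hence "(deriv forest_fun has_field_derivative
      deriv (deriv tree_fun) z * forest_fun z ^ 2 + 2 * deriv tree_fun z ^ 2 * forest_fun z ^ 3) (at z)"
    by (rule has_field_derivative_transform_within_open[OF _ open_ball z])
      (rule DERIV_imp_deriv[OF d1, symmetric])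
  thus ?thesis by (rule DERIV_imp_deriv)
qed

text \<open>Solved for the derivatives, these equations extend them continuously to the closed disc minus
  \<open>r\<close>.\<close>

definition tree_fun_deriv :: "complex \<Rightarrow> complex" where
  "tree_fun_deriv z = (1 + 2 * z * K (tree_fun z)) / (1 - z\<^sup>2 * K' (tree_fun z))"

definition tree_fun_deriv2 :: "complex \<Rightarrow> complex" where
  "tree_fun_deriv2 z = (2 * K (tree_fun z) + 4 * z * K' (tree_fun z) * tree_fun_deriv z
    + z\<^sup>2 * deriv K' (tree_fun z) * (tree_fun_deriv z)\<^sup>2) / (1 - z\<^sup>2 * K' (tree_fun z))"

lemma deriv_tree_fun_eq:
  assumes "z \<in> ball 0 r"
  shows "deriv tree_fun z = tree_fun_deriv z" and "deriv (deriv tree_fun) z = tree_fun_deriv2 z"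
proof -
  have nonzero: "1 - z\<^sup>2 * K' (tree_fun z) \<noteq> 0" using assms by (intro one_minus_K'_nonzero) auto
  have "deriv tree_fun z * (1 - z\<^sup>2 * K' (tree_fun z)) = 1 + 2 * z * K (tree_fun z)"
    using deriv_tree_fun[OF assms] by algebra
  thus d1: "deriv tree_fun z = tree_fun_deriv z"
    using nonzero by (simp add: tree_fun_deriv_def eq_divide_eq)
  have "deriv (deriv tree_fun) z * (1 - z\<^sup>2 * K' (tree_fun z)) =
      2 * K (tree_fun z) + 4 * z * K' (tree_fun z) * tree_fun_deriv z
        + z\<^sup>2 * deriv K' (tree_fun z) * (tree_fun_deriv z)\<^sup>2"
    using deriv2_tree_fun[OF assms] unfolding d1 by algebra
  thus "deriv (deriv tree_fun) z = tree_fun_deriv2 z"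
    using nonzero by (simp add: tree_fun_deriv2_def eq_divide_eq)
qed

lemma continuous_on_comp_tree_fun:
  assumes "f holomorphic_on ball 0 1"
  shows "continuous_on (cball 0 r - {of_real r}) (\<lambda>z. f (tree_fun z))"
proof (rule continuous_on_compose2[OF holomorphic_on_imp_continuous_on[OF assms]])
  show "continuous_on (cball 0 r - {of_real r}) tree_fun"
    using continuous_on_tree_fun by (rule continuous_on_subset) auto
qed (use tree_fun_ball in auto)

lemma continuous_on_tree_fun_deriv:
  "continuous_on (cball 0 r - {of_real r}) tree_fun_deriv"
  "continuous_on (cball 0 r - {of_real r}) tree_fun_deriv2"
proof -
  note K = continuous_on_comp_tree_fun[OF holomorphic_K] continuous_on_comp_tree_fun[OF holomorphic_K']
    continuous_on_comp_tree_fun[OF holomorphic_deriv[OF holomorphic_K' open_ball]]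
  have "continuous_on (cball 0 r - {of_real r}) (\<lambda>z. 1 - z\<^sup>2 * K' (tree_fun z))"
    by (intro continuous_intros K)
  moreover from this show d1: "continuous_on (cball 0 r - {of_real r}) tree_fun_deriv"
    unfolding tree_fun_deriv_def using one_minus_K'_nonzero by (intro continuous_intros K) auto
  ultimately show "continuous_on (cball 0 r - {of_real r}) tree_fun_deriv2"
    unfolding tree_fun_deriv2_def using one_minus_K'_nonzero by (intro continuous_intros K d1) auto
qed

lemma deriv2_forest_fun_bounded_away:
  assumes \<epsilon>: "0 < \<epsilon>"
  shows "\<exists>M. \<forall>z. norm z < r \<and> \<epsilon> \<le> norm (z - of_real r) \<longrightarrow> norm (deriv (deriv forest_fun) z) \<le> M"
proof -
  define S where "S = cball 0 r - ball (of_real r :: complex) \<epsilon>"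
  define d2 where "d2 z = tree_fun_deriv2 z * inverse (1 - tree_fun z) ^ 2
    + 2 * tree_fun_deriv z ^ 2 * inverse (1 - tree_fun z) ^ 3" for z
  have sub: "S \<subseteq> cball 0 r - {of_real r}" using \<epsilon> by (auto simp: S_def)
  have "(\<lambda>c. inverse (1 - c)) holomorphic_on ball 0 1"
    using ball_1_neq(1) by (intro holomorphic_intros) auto
  hence "continuous_on (cball 0 r - {of_real r}) d2"
    unfolding d2_def
    by (intro continuous_intros continuous_on_tree_fun_deriv continuous_on_comp_tree_fun)
  hence "continuous_on S d2" using sub by (rule continuous_on_subset)
  moreover have "compact S" unfolding S_def by (intro compact_diff compact_cball open_ball)
  ultimately have "\<exists>M. \<forall>z\<in>S. norm (d2 z) \<le> M" by (rule continuous_image_bounded)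
  then obtain M where M: "\<forall>z\<in>S. norm (d2 z) \<le> M" by blast
  have "norm (deriv (deriv forest_fun) z) \<le> M" if z: "norm z < r" "\<epsilon> \<le> norm (z - of_real r)" for z
  proof -
    have "z \<in> S" using z by (simp add: S_def dist_norm norm_minus_commute)
    moreover have "deriv (deriv forest_fun) z = d2 z"
      using deriv2_forest_fun[of z] deriv_tree_fun_eq[of z] forest_fun_eq[of z] z(1) by (simp add: d2_def)
    ultimately show ?thesis using M by simp
  qed
  thus ?thesis by blast
qed

end

subsection \<open>Expansion at the singularity\<close>

lemma holomorphic_local_inverse:
  assumes f: "f holomorphic_on S" and S: "open S" "k \<in> S" and deriv: "deriv f k \<noteq> 0"
  obtains g d e where "0 < d" "0 < e" "g holomorphic_on ball (f k) e" "g ` ball (f k) e \<subseteq> S"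
    "\<And>c. c \<in> ball k d \<Longrightarrow> g (f c) = c" "deriv g (f k) = inverse (deriv f k)"
proof -
  obtain d where d: "0 < d" "ball k d \<subseteq> S" "open (f ` ball k d)" "inj_on f (ball k d)"
    using has_complex_derivative_locally_invertible[OF f S(2,1) deriv] by blast
  have "f holomorphic_on ball k d" using f d(2) by (rule holomorphic_on_subset)
  then obtain g where g: "g holomorphic_on f ` ball k d"
      "\<And>c. c \<in> ball k d \<Longrightarrow> deriv f c * deriv g (f c) = 1" "\<And>c. c \<in> ball k d \<Longrightarrow> g (f c) = c"
    using holomorphic_has_inverse[OF _ open_ball d(4)] by blast
  have k: "k \<in> ball k d" using d by simp
  then obtain e where e: "0 < e" "ball (f k) e \<subseteq> f ` ball k d"
    using d(3) open_contains_ball by (metis imageI)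
  show ?thesis
  proof (rule that[OF d(1) e(1) _ _ g(3)])
    show "g holomorphic_on ball (f k) e" using g(1) e(2) by (rule holomorphic_on_subset)
    show "g ` ball (f k) e \<subseteq> S" using e(2) d(2) g(3) by force
    show "deriv g (f k) = inverse (deriv f k)" using g(2)[OF k] by (simp add: inverse_unique)
  qed
qed

lemma Re_csqrt_pos:
  assumes "0 < Re w"
  shows "\<bar>Im (csqrt w)\<bar> < Re (csqrt w)"
proof -
  have "Re w = (Re (csqrt w))\<^sup>2 - (Im (csqrt w))\<^sup>2"
    using arg_cong[OF power2_csqrt[of w], of Re] by (simp add: power2_eq_square)
  hence "(Im (csqrt w))\<^sup>2 < (Re (csqrt w))\<^sup>2" using assms by linarith
  moreover have "0 \<le> Re (csqrt w)" using csqrt_principal[of w] by auto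
  ultimately show ?thesis by (metis abs_le_square_iff abs_of_nonneg not_less)
qed

text \<open>Both square roots lie in the sector \<open>|arg| < \<pi> / 4\<close>, which fixes the sign.\<close>

lemma mult_csqrt_eq_csqrtI:
  assumes square: "a\<^sup>2 * w = u" and Re: "0 < Re a" "0 < Re w" "0 < Re u"
  shows "a * csqrt w = csqrt u"
proof -
  define h s where "h = csqrt w" and "s = csqrt u"
  have "(a * h)\<^sup>2 = s\<^sup>2" using square by (simp add: h_def s_def power_mult_distrib)
  hence "a * h = s \<or> a * h = - s" by (simp add: power2_eq_iff)
  moreover have "a * h \<noteq> - s"
  proof
    assume "a * h = - s"
    hence "a * (h * cnj h) = - (s * cnj h)" by (metis mult.assoc mult_minus_left)
    hence "Re (a * of_real (norm h ^ 2)) = Re (- (s * cnj h))" by (simp only: complex_norm_square)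
    hence "Re a * norm h ^ 2 = - (Re s * Re h + Im s * Im h)" by (simp add: mult.commute)
    moreover have "0 \<le> Re a * norm h ^ 2" using Re(1) by simp
    moreover have "\<bar>Im s * Im h\<bar> < Re s * Re h"
      unfolding abs_mult h_def s_def using Re_csqrt_pos[OF Re(2)] Re_csqrt_pos[OF Re(3)]
      by (intro mult_strict_mono') auto
    ultimately show False by linarith
  qed
  ultimately show ?thesis by (auto simp: h_def s_def)
qed

context critical_point
begin

definition D :: "complex \<Rightarrow> complex" where "D c = csqrt ((J c)\<^sup>2 + 4 * c\<^sup>2 * J c)"
definition W :: "complex \<Rightarrow> complex" where
  "W c = - (2 * quad c) / (of_real r * (J c + D c + 2 * of_real r * c))"

lemma D_eqI:
  assumes "(c - z) * J c = z\<^sup>2 * c" "0 < Re (2 * c * z + J c)"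
  shows "D c = 2 * c * z + J c"
proof -
  have "(2 * c * z + J c)\<^sup>2 = (J c)\<^sup>2 + 4 * c\<^sup>2 * J c" using assms(1) by algebra
  thus ?thesis unfolding D_def using assms(2) by (intro csqrt_unique) auto
qed

lemma J_kappa_pos: "0 < Re (2 * of_real \<kappa> * of_real r + J (of_real \<kappa>))"
proof -
  have "0 < 2 * \<kappa> * r + (1 - \<kappa>)^2 * (1 + \<kappa>)" using \<kappa> r_pos by (intro add_pos_pos) auto
  also have "\<dots> = Re (2 * of_real \<kappa> * of_real r + J (of_real \<kappa>))" unfolding J_kappa by simp
  finally show ?thesis .
qed

lemma D_kappa: "D (of_real \<kappa>) = 2 * of_real \<kappa> * of_real r + J (of_real \<kappa>)"
  using tree_fun_curve[of "of_real r"] J_kappa_pos r_pos by (intro D_eqI) (simp_all add: tree_fun_r)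

lemma W_kappa: "W (of_real \<kappa>) = of_real w0"
proof -
  define b where "b = 1 + \<kappa> + 2 * \<kappa>^2"
  define n where "n = (1 - \<kappa>) * (1 + 5 * \<kappa> + 3 * \<kappa>^2 + 3 * \<kappa> ^ 3)"
  define d where "d = (1 - \<kappa>)^2 * (1 + \<kappa>) + 2 * r * \<kappa>"
  have b: "b \<noteq> 0" using r_denominator_pos by (simp add: b_def)
  have "d * b = (1 - \<kappa>)^2 * (1 + \<kappa>) * b + 2 * \<kappa> * (r * b)" by (simp add: d_def algebra_simps)
  also have "\<dots> = 1 + 5 * \<kappa> ^ 4 + 2 * \<kappa> ^ 5"
    unfolding r_mult_denominator[folded b_def] unfolding b_def by algebra
  finally have db: "d * b = 1 + 5 * \<kappa> ^ 4 + 2 * \<kappa> ^ 5" .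
  have "w0 = n * b / ((r * b) * (d * b))"
    unfolding db r_mult_denominator[folded b_def] unfolding w0_def n_def b_def by simp
  hence w0: "w0 = (n / b) / (r * d)" using b by simp
  have "W (of_real \<kappa>) = of_real (2 * (n / b)) / (of_real r * of_real (2 * d))"
    unfolding W_def quad_kappa D_kappa J_kappa n_def b_def d_def by (simp add: algebra_simps)
  also have "\<dots> = of_real (2 * (n / b) / (r * (2 * d)))" by (simp only: of_real_divide of_real_mult)
  also have "2 * (n / b) / (r * (2 * d)) = w0" unfolding w0 by simp
  finally show ?thesis .
qed

lemma csqrt_W_analytic: "(\<lambda>c. csqrt (W c)) analytic_on {of_real \<kappa>}"
proof -
  have J: "J analytic_on {of_real \<kappa>}" unfolding J_def by (intro analytic_intros)
  have pos: "0 < (1 - \<kappa>)^2 * (1 + \<kappa>)" using \<kappa> by simp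
  have "(J (of_real \<kappa>))\<^sup>2 + 4 * (of_real \<kappa>)\<^sup>2 * J (of_real \<kappa>) =
      of_real (((1 - \<kappa>)^2 * (1 + \<kappa>))\<^sup>2 + 4 * \<kappa>\<^sup>2 * ((1 - \<kappa>)^2 * (1 + \<kappa>)))"
    by (simp add: J_kappa)
  moreover have "0 < ((1 - \<kappa>)^2 * (1 + \<kappa>))\<^sup>2 + 4 * \<kappa>\<^sup>2 * ((1 - \<kappa>)^2 * (1 + \<kappa>))"
    using pos \<kappa> by (intro add_pos_pos mult_pos_pos) auto
  ultimately have "(J (of_real \<kappa>))\<^sup>2 + 4 * (of_real \<kappa>)\<^sup>2 * J (of_real \<kappa>) \<notin> \<real>\<^sub>\<le>\<^sub>0"
    by (simp only: complex_nonpos_Reals_iff Re_complex_of_real not_le) simp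
  hence D: "D analytic_on {of_real \<kappa>}" unfolding D_def by (intro analytic_intros J) auto
  have quad: "quad analytic_on {of_real \<kappa>}" unfolding quad_def by (intro analytic_intros)
  have "J (of_real \<kappa>) + D (of_real \<kappa>) + 2 * of_real r * of_real \<kappa> =
      2 * (2 * of_real \<kappa> * of_real r + J (of_real \<kappa>))" unfolding D_kappa by (simp add: algebra_simps)
  also have "\<dots> \<noteq> 0"
    using J_kappa_pos by (metis less_irrefl mult_eq_0_iff zero_complex.sel(1) zero_neq_numeral)
  finally have "W analytic_on {of_real \<kappa>}"
    unfolding W_def using r_pos by (intro analytic_intros J D quad) auto
  moreover have "W (of_real \<kappa>) \<notin> \<real>\<^sub>\<le>\<^sub>0" unfolding W_kappa using w0_pos by simp
  ultimately show ?thesis by (intro analytic_intros) auto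
qed

lemma tree_fun_tendsto: "(tree_fun \<longlongrightarrow> of_real \<kappa>) (at (of_real r) within ball 0 r)"
proof -
  have "continuous (at (of_real r) within cball 0 r) tree_fun"
    using continuous_on_tree_fun r_pos by (simp add: continuous_on_eq_continuous_within)
  hence "(tree_fun \<longlongrightarrow> of_real \<kappa>) (at (of_real r) within cball 0 r)"
    unfolding continuous_within tree_fun_r .
  thus ?thesis by (rule tendsto_within_subset) (rule ball_subset_cball)
qed

text \<open>The function \<open>\<sigma>\<close> is a local coordinate at \<open>\<kappa>\<close> whose square is \<open>1 - z / r\<close> on the curve.\<close>

definition \<sigma> :: "complex \<Rightarrow> complex" where "\<sigma> c = (of_real \<kappa> - c) * csqrt (W c)"

lemma sigma_tree_fun:
  assumes z: "norm z < r" and c: "c = tree_fun z" and Re: "0 < Re (2 * c * z + J c)"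
    "0 < Re (J c + (z + of_real r) * c)" "0 < Re (W c)"
  shows "\<sigma> c = csqrt (1 - z / of_real r)"
  unfolding \<sigma>_def
proof (rule mult_csqrt_eq_csqrtI)
  have D: "D c = 2 * c * z + J c" using tree_fun_curve[of z] z c Re(1) by (intro D_eqI) auto
  have ne: "J c + (z + of_real r) * c \<noteq> 0" using Re(2) by (metis less_irrefl zero_complex.sel(1))
  define x where "x = J c + (z + of_real r) * c"
  have "J c + D c + 2 * of_real r * c = 2 * x" unfolding D x_def by (simp add: algebra_simps)
  hence "(of_real \<kappa> - c)\<^sup>2 * W c = - ((c - of_real \<kappa>)\<^sup>2 * quad c) / (of_real r * x)"
    by (simp add: W_def power2_commute)
  also have "(c - of_real \<kappa>)\<^sup>2 * quad c = (z - of_real r) * x"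
    unfolding c x_def using z by (intro tree_fun_quad) simp
  also have "- ((z - of_real r) * x) / (of_real r * x) = 1 - z / of_real r"
    using ne[folded x_def] r_pos by (simp add: diff_divide_distrib)
  finally show "(of_real \<kappa> - c)\<^sup>2 * W c = 1 - z / of_real r" .
  have "c \<noteq> of_real \<kappa>" using tree_fun_eq_kappa_imp_r[of z] z r_pos c by auto
  moreover have "norm c \<le> \<kappa>" using norm_tree_fun_le[of z] z c by simp
  ultimately show "0 < Re (of_real \<kappa> - c)" using Re_less_of_norm_le by simp
  show "0 < Re (1 - z / of_real r)"
    using z complex_Re_le_cmod[of z] by (intro Re_one_minus_divide_pos r_pos) simp
qed (rule Re(3))

lemma eventually_sigma_tree_fun:
  "\<forall>\<^sub>F z in at (of_real r) within ball 0 r. \<sigma> (tree_fun z) = csqrt (1 - z / of_real r)"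
proof -
  let ?F = "at (complex_of_real r) within ball 0 r"
  have C: "(tree_fun \<longlongrightarrow> of_real \<kappa>) ?F" by (rule tree_fun_tendsto)
  have id: "((\<lambda>z. z) \<longlongrightarrow> of_real r) ?F" by (rule tendsto_ident_at)
  have JC: "((\<lambda>z. J (tree_fun z)) \<longlongrightarrow> J (of_real \<kappa>)) ?F" unfolding J_def by (intro tendsto_intros C)
  have "((\<lambda>z. Re (2 * tree_fun z * z + J (tree_fun z))) \<longlongrightarrow>
      Re (2 * of_real \<kappa> * of_real r + J (of_real \<kappa>))) ?F"
    by (intro tendsto_intros C id JC)
  hence "\<forall>\<^sub>F z in ?F. 0 < Re (2 * tree_fun z * z + J (tree_fun z))"
    using J_kappa_pos by (rule order_tendstoD)
  moreover have "((\<lambda>z. Re (J (tree_fun z) + (z + of_real r) * tree_fun z)) \<longlongrightarrow>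
      Re (J (of_real \<kappa>) + (of_real r + of_real r) * of_real \<kappa>)) ?F"
    by (intro tendsto_intros C id JC)
  hence "\<forall>\<^sub>F z in ?F. 0 < Re (J (tree_fun z) + (z + of_real r) * tree_fun z)"
    using J_kappa_pos by (intro order_tendstoD(1)) (auto simp: algebra_simps)
  moreover have "\<forall>\<^sub>F z in ?F. 0 < Re (W (tree_fun z))"
  proof -
    have "isCont (\<lambda>c. (csqrt (W c))\<^sup>2) (of_real \<kappa>)"
      using analytic_at_imp_isCont[OF csqrt_W_analytic] by (intro continuous_intros)
    hence "isCont W (of_real \<kappa>)" by simp
    hence "((\<lambda>z. Re (W (tree_fun z))) \<longlongrightarrow> Re (W (of_real \<kappa>))) ?F"
      using C by (intro tendsto_intros isCont_tendsto_compose[of _ W])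
    thus ?thesis using w0_pos by (intro order_tendstoD(1)) (auto simp: W_kappa)
  qed
  moreover have "\<forall>\<^sub>F z in ?F. norm z < r" by (auto simp: eventually_at_filter)
  ultimately show ?thesis by eventually_elim (rule sigma_tree_fun[OF _ refl])
qed

lemma deriv_sigma_kappa: "deriv \<sigma> (of_real \<kappa>) = - of_real (sqrt w0)"
proof (rule DERIV_imp_deriv)
  let ?h = "\<lambda>c. csqrt (W c)" and ?k = "complex_of_real \<kappa>"
  have "(\<sigma> has_field_derivative (0 - 1) * ?h ?k + deriv ?h ?k * (?k - ?k)) (at ?k)"
    unfolding \<sigma>_def
    by (intro DERIV_mult DERIV_diff DERIV_const DERIV_ident analytic_derivI[OF csqrt_W_analytic])
  thus "(\<sigma> has_field_derivative - of_real (sqrt w0)) (at ?k)"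
    using w0_pos by (simp add: W_kappa csqrt_of_real)
qed

lemma ex_sigma_inverse:
  obtains g d e where "0 < d" "0 < e" "g holomorphic_on ball 0 e" "g ` ball 0 e \<subseteq> ball 0 1"
    "\<And>c. c \<in> ball (of_real \<kappa>) d \<Longrightarrow> g (\<sigma> c) = c" "deriv g 0 = - of_real (1 / sqrt w0)"
proof -
  have "\<sigma> analytic_on {of_real \<kappa>}" unfolding \<sigma>_def by (intro analytic_intros csqrt_W_analytic)
  then obtain \<delta> where \<delta>: "0 < \<delta>" "\<sigma> holomorphic_on ball (of_real \<kappa>) \<delta>"
    unfolding analytic_on_def by auto
  define S where "S = ball (complex_of_real \<kappa>) \<delta> \<inter> ball 0 1"
  have S: "open S" "of_real \<kappa> \<in> S" using \<delta>(1) \<kappa> by (auto simp: S_def)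
  have hol: "\<sigma> holomorphic_on S" using \<delta>(2) by (rule holomorphic_on_subset) (simp add: S_def)
  have "deriv \<sigma> (of_real \<kappa>) \<noteq> 0" using w0_pos by (simp add: deriv_sigma_kappa)
  with hol S obtain g d e where g: "0 < d" "0 < e" "g holomorphic_on ball (\<sigma> (of_real \<kappa>)) e"
    "g ` ball (\<sigma> (of_real \<kappa>)) e \<subseteq> S" "\<And>c. c \<in> ball (of_real \<kappa>) d \<Longrightarrow> g (\<sigma> c) = c"
    "deriv g (\<sigma> (of_real \<kappa>)) = inverse (deriv \<sigma> (of_real \<kappa>))"
    by (rule holomorphic_local_inverse) blast
  have "\<sigma> (of_real \<kappa>) = 0" by (simp add: \<sigma>_def)
  thus ?thesis using g by (intro that[of d e g]) (auto simp: S_def deriv_sigma_kappa inverse_eq_divide)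
qed

lemma forest_fun_near:
  obtains e G where "G holomorphic_on ball 0 e" "0 < e"
    "deriv G 0 = - of_real (1 / (sqrt w0 * (1 - \<kappa>)^2))"
    "\<forall>\<^sub>F z in at (of_real r) within ball 0 r. forest_fun z = G (csqrt (1 - z / of_real r))"
proof -
  obtain g d e where g: "0 < d" "0 < e" "g holomorphic_on ball 0 e" "g ` ball 0 e \<subseteq> ball 0 1"
    "\<And>c. c \<in> ball (of_real \<kappa>) d \<Longrightarrow> g (\<sigma> c) = c" "deriv g 0 = - of_real (1 / sqrt w0)"
    by (rule ex_sigma_inverse) blast
  define G where "G s = inverse (1 - g s)" for s
  have g_ne: "1 - g s \<noteq> 0" if "s \<in> ball 0 e" for s using ball_1_neq(1) g(4) that by blast
  have "G holomorphic_on ball 0 e"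
    unfolding G_def using g(3) g_ne by (intro holomorphic_intros) auto
  moreover have "deriv G 0 = - of_real (1 / (sqrt w0 * (1 - \<kappa>)^2))"
  proof -
    have "(g has_field_derivative - of_real (1 / sqrt w0)) (at 0)"
      using holomorphic_derivI[OF g(3) open_ball, of 0] g(2,6) by simp
    moreover have "g 0 = of_real \<kappa>" using g(5)[of "of_real \<kappa>"] g(1) by (simp add: \<sigma>_def)
    ultimately have "(G has_field_derivative - of_real (1 / sqrt w0) * inverse ((1 - of_real \<kappa>)\<^sup>2)) (at 0)"
      unfolding G_def using g_ne[of 0] g(2) by (auto intro!: derivative_eq_intros simp: power2_eq_square)
    hence "deriv G 0 = - of_real (1 / sqrt w0) * inverse ((1 - of_real \<kappa>)\<^sup>2)" by (rule DERIV_imp_deriv)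
    thus ?thesis by (simp add: field_simps)
  qed
  moreover have "\<forall>\<^sub>F z in at (of_real r) within ball 0 r. forest_fun z = G (csqrt (1 - z / of_real r))"
  proof -
    have "\<forall>\<^sub>F z in at (of_real r) within ball 0 r. dist (tree_fun z) (of_real \<kappa>) < d"
      by (rule tendstoD[OF tree_fun_tendsto g(1)])
    moreover have "\<forall>\<^sub>F z in at (complex_of_real r) within ball 0 r. norm z < r"
      by (auto simp: eventually_at_filter)
    ultimately show ?thesis using eventually_sigma_tree_fun
    proof eventually_elim
      case (elim z)
      hence "g (csqrt (1 - z / of_real r)) = tree_fun z"
        using g(5)[of "tree_fun z"] by (simp add: dist_commute)
      thus ?case using forest_fun_eq[of z] elim(2) by (simp add: G_def)
    qed
  qed
  ultimately show ?thesis using that g(2) by blast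
qed

theorem gf_win_forests_tendsto:
  "(\<lambda>n. gf win_forests $ n * complex_of_real (r ^ n * real n powr (3/2))) \<longlonglongrightarrow> of_real (\<gamma> / sqrt pi)"
proof -
  obtain e G where G: "G holomorphic_on ball 0 e" "0 < e"
    "deriv G 0 = - of_real (1 / (sqrt w0 * (1 - \<kappa>)^2))"
    "\<forall>\<^sub>F z in at (of_real r) within ball 0 r. forest_fun z = G (csqrt (1 - z / of_real r))"
    by (rule forest_fun_near)
  have "(\<lambda>n. gf win_forests $ n * complex_of_real (r ^ n * real n powr (3/2)))
      \<longlonglongrightarrow> - deriv G 0 / (2 * of_real (sqrt pi))"
    by (rule sqrt_singularity_transfer[OF r_pos holomorphic_forest_fun forest_fun_has_fps_expansion
          G(1,2,4) deriv2_forest_fun_bounded_away])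
  also have "- deriv G 0 / (2 * of_real (sqrt pi)) = of_real (\<gamma> / sqrt pi)"
    unfolding G(3) by (simp add: \<gamma>_def field_simps)
  finally show ?thesis .
qed

end

subsection \<open>Asymptotics\<close>

lemma asymp_equiv_of_scaled_tendsto:
  fixes f :: "nat \<Rightarrow> real"
  assumes lim: "(\<lambda>n. f n * (r ^ n * real n powr a)) \<longlonglongrightarrow> c" and "c \<noteq> 0" "0 < r"
  shows "f \<sim>[at_top] (\<lambda>n. c * real n powr (- a) * (1 / r) ^ n)"
proof (rule asymp_equivI', rule Lim_transform_eventually)
  have "(\<lambda>n. f n * (r ^ n * real n powr a) / c) \<longlonglongrightarrow> c / c"
    using assms by (intro tendsto_divide tendsto_const) auto
  thus "(\<lambda>n. f n * (r ^ n * real n powr a) / c) \<longlonglongrightarrow> 1" using \<open>c \<noteq> 0\<close> by simp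
  show "\<forall>\<^sub>F n in sequentially.
      f n * (r ^ n * real n powr a) / c = f n / (c * real n powr (- a) * (1 / r) ^ n)"
    using eventually_gt_at_top[of 0]
    by eventually_elim (use assms in \<open>simp add: powr_minus power_divide field_simps\<close>)
qed

lemma (in critical_point) card_Eeta_wins_Tam_asymp_equiv:
  "(\<lambda>n. real (card (finite_lattice.Eeta_wins (Tam n)))) \<sim>[at_top]
     (\<lambda>n. \<gamma> / sqrt pi * real n powr (-3/2) * (1 / r) ^ n)"
proof -
  define f where "f n = real (card (finite_lattice.Eeta_wins (Tam n)))" for n
  have "gf win_forests $ n = complex_of_real (f n)" for n
    using card_Eeta_wins_Tam_gf[of n, where 'a = complex] by (simp add: f_def)
  hence "(\<lambda>n. complex_of_real (f n * (r ^ n * real n powr (3/2)))) \<longlonglongrightarrow> of_real (\<gamma> / sqrt pi)"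
    using gf_win_forests_tendsto by simp
  hence "(\<lambda>n. f n * (r ^ n * real n powr (3/2))) \<longlonglongrightarrow> \<gamma> / sqrt pi" by (simp only: tendsto_of_real_iff)
  hence "f \<sim>[at_top] (\<lambda>n. \<gamma> / sqrt pi * real n powr (- (3/2)) * (1 / r) ^ n)"
    by (rule asymp_equiv_of_scaled_tendsto) (use \<gamma>_pos r_pos in simp_all)
  thus ?thesis by (simp only: f_def[abs_def] minus_divide_left)
qed

theorem theorem1p10:
  shows "annihilates Q_poly Eeta_Tam_gf \<and>
    algebraic_of_degree Eeta_Tam_gf 4 \<and>
    (\<exists>\<rho> \<gamma> :: real.
       (\<forall>x. x > 0 \<and> 32*x^7 - 32*x^6 - 155*x^5 - 20*x^4 - 148*x^3 + 60*x^2 - 8*x - 4 = 0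
          \<longleftrightarrow> x = \<rho>) \<and>
       \<bar>\<rho> - 2.90511\<bar> < 0.000005 \<and>
       17348952064*\<gamma>^14 - 11927404544*\<gamma>^12 - 6678731520*\<gamma>^10 - 886278144*\<gamma>^8
         - 33824320*\<gamma>^6 - 516144*\<gamma>^4 + 4048*\<gamma>^2 + 11 = 0 \<and>
       \<bar>\<gamma> - 1.04240\<bar> < 0.000005 \<and>
       (\<lambda>n. real (card (finite_lattice.Eeta_wins (Tam n))))
         \<sim>[at_top] (\<lambda>n. \<gamma> / sqrt pi * real n powr (-3/2) * \<rho> ^ n))"
proof -
  obtain k where k: "0.52700329 < k" "k < 0.52700330" "critical_poly k = 0"
    using ex_critical_poly_root by blast
  interpret critical_point k using k by unfold_locales auto
  have degree: "algebraic_of_degree Eeta_Tam_gf 4"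
    using annihilates_Q_poly by (intro algebraic_of_degree_4) (simp add: Eeta_Tam_gf_def)
  note asymptotics = growth_poly_root_iff inverse_r_bounds[OF k(1,2)] \<gamma>_root \<gamma>_bounds[OF k(1,2)]
    card_Eeta_wins_Tam_asymp_equiv
  show ?thesis
    using annihilates_Q_poly degree asymptotics unfolding growth_poly_def by blast
qed

end
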